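(* Let $\Theta=(T,\{K_t\},\{\Sigma_e\},\{\phi_e\})$ be a tree system of metric compacta and let $\Pi$ be a partition of $T$ into subtrees. Then the consolidation $\Theta_\Pi$ is a tree system of metric compacta, and $\lim\Theta_\Pi$ is homeomorphic to $\lim\Theta$, via the canonical bijection which is the identity on each $K_t$ ($t\in V_T$), sends each end of a subtree $S\in\Pi$ to the same end viewed as an end of $T$, and sends an end of $T_\Pi$ represented by a ray $(S_0,S_1,\dots)$ to the end of $T$ represented by the ray in $T$ passing consecutively through the edges $e_i$ joining $S_{i-1}$ to $S_i$ and the paths in $S_i$ between them.
   Context: Trees: for a tree $T$, $V_T$ is its vertex set and $O_T$ its set of oriented edges; each $e\in O_T$ has initial vertex $\alpha(e)$, terminal vertex $\omega(e)$, and $\bar e$ denotes the oppositely oriented edge; $N_t=\{e\in O_T:\alpha(e)=t\}$. A family of subsets of a compact metric space is null if for every $\epsilon>0$ only finitely many of its members have diameter $\ge\epsilon$. A tree system of metric compacta is a tuple $\Theta=(T,\{K_t\},\{\Sigma_e\},\{\phi_e\})$ where $T$ is a countable tree, each $K_t$ is a compact metric space, each $\Sigma_e$ is a nonempty compact subset of $K_{\alpha(e)}$, each $\phi_e:\Sigma_e\to\Sigma_{\bar e}$ is a homeomorphism with $\phi_{\bar e}=\phi_e^{-1}$, and for each $t$ the family $\{\Sigma_e:e\in N_t\}$ consists of pairwise disjoint sets and is null in $K_t$. Limit: $E_T$ is the set of ends of $T$; $\#\Theta$ is the quotient of $\bigsqcup_tK_t$ by $x\sim\phi_e(x)$; as a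 set $\lim\Theta=\#\Theta\sqcup E_T$. For a finite subtree $F$, $K_F$ is the quotient of $\bigsqcup_{t\in V_F}K_t$ by $x\sim\phi_e(x)$ for edges $e$ of $F$; $N_F=\{e:\alpha(e)\in V_F,\omega(e)\notin V_F\}$; $U\subset K_F$ is saturated if each $\Sigma_e$ ($e\in N_F$) is contained in or disjoint from $U$; for saturated $U$, $G(U)$ is the union of $U$, of all $K_t$ ($t\notin V_F$) such that the shortest path from $F$ to $t$ starts with some $e\in N_F$ with $\Sigma_e\subset U$, and of all ends represented by rays starting in $F$ and leaving $F$ immediately through such an edge $e$. The topology on $\lim\Theta$ has basis all $G(U)$ with $U$ open and saturated in some $K_F$. For a subtree $S$, $\Theta_S$ denotes the restriction of $\Theta$ to $S$ (vertices and edges of $S$ only). Consolidation: a partition $\Pi$ of $T$ into subtrees is a family of subtrees (possibly single vertices) whose vertex sets are pairwise disjoint and cover $V_T$. The consolidation $\Theta_\Pi=(T_\Pi,\{K_S\}_{S\in\Pi},\{\Sigma_e\}_{e\in O_\Pi},\{\phi_e\}_{e\in O_\Pi})$ has underlying tree $T_\Pi$ with vertex set $\Pi$ and oriented edge set $O_\Pi$ = the edges of $T$ not lying in any $S\in\Pi$, where $\alpha_\Pi(e)$ (resp. $\omega_\Pi(e)$) is the $S\in\Pi$ containing $\alpha(e)$ (resp. $\omega(e)$); $K_S=\lim\Theta_S$; and $\Sigma_e\subset K_{\alpha(e)}\subset K_{\alpha_\Pi(e)}$, $\phi_e$ are as in $\Theta$. *)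

theory Defs
  imports "HOL-Analysis.Analysis"
begin

section \<open>Trees given by oriented edges\<close>

text \<open>A tree is given by a vertex set V, a set Ed of oriented edges, initial / terminal
vertex maps al (alpha) and om (omega), and the orientation reversal rv (e to e-bar).\<close>

definition walk :: "'e set \<Rightarrow> ('e \<Rightarrow> 'v) \<Rightarrow> ('e \<Rightarrow> 'v) \<Rightarrow> 'e list \<Rightarrow> bool" where
  "walk Ed al om es \<longleftrightarrow> set es \<subseteq> Ed \<and>
     (\<forall>i. Suc i < length es \<longrightarrow> om (es ! i) = al (es ! Suc i))"

definition walk_from_to :: "'e set \<Rightarrow> ('e \<Rightarrow> 'v) \<Rightarrow> ('e \<Rightarrow> 'v) \<Rightarrow> 'e list \<Rightarrow> 'v \<Rightarrow> 'v \<Rightarrow> bool" where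
  "walk_from_to Ed al om es u v \<longleftrightarrow> walk Ed al om es \<and>
     ((es = [] \<and> u = v) \<or> (es \<noteq> [] \<and> al (hd es) = u \<and> om (last es) = v))"

definition reduced :: "('e \<Rightarrow> 'e) \<Rightarrow> 'e list \<Rightarrow> bool" where
  "reduced rv es \<longleftrightarrow> (\<forall>i. Suc i < length es \<longrightarrow> es ! Suc i \<noteq> rv (es ! i))"

definition is_tree :: "'v set \<Rightarrow> 'e set \<Rightarrow> ('e \<Rightarrow> 'v) \<Rightarrow> ('e \<Rightarrow> 'v) \<Rightarrow> ('e \<Rightarrow> 'e) \<Rightarrow> bool" where
  "is_tree V Ed al om rv \<longleftrightarrow>
     V \<noteq> {} \<and> countable V \<and>
     (\<forall>e\<in>Ed. al e \<in> V \<and> om e \<in> V \<and> rv e \<in> Ed \<and> rv e \<noteq> e \<and> rv (rv e) = e \<and> al (rv e) = om e) \<and>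
     (\<forall>u\<in>V. \<forall>v\<in>V. \<exists>es. walk_from_to Ed al om es u v) \<and>
     (\<forall>es. walk Ed al om es \<and> es \<noteq> [] \<and> reduced rv es \<longrightarrow> al (hd es) \<noteq> om (last es))"

text \<open>A subtree is represented by its vertex set S (a subtree of a tree is determined by
its vertex set: its edges are exactly the edges of T with both endpoints in S).\<close>

definition sub_edges :: "'e set \<Rightarrow> ('e \<Rightarrow> 'v) \<Rightarrow> ('e \<Rightarrow> 'v) \<Rightarrow> 'v set \<Rightarrow> 'e set" where
  "sub_edges Ed al om S = {e \<in> Ed. al e \<in> S \<and> om e \<in> S}"

definition is_subtree :: "'v set \<Rightarrow> 'e set \<Rightarrow> ('e \<Rightarrow> 'v) \<Rightarrow> ('e \<Rightarrow> 'v) \<Rightarrow> 'v set \<Rightarrow> bool" where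
  "is_subtree V Ed al om S \<longleftrightarrow> S \<noteq> {} \<and> S \<subseteq> V \<and>
     (\<forall>u\<in>S. \<forall>v\<in>S. \<exists>es. walk_from_to (sub_edges Ed al om S) al om es u v)"

definition tree_partition :: "'v set \<Rightarrow> 'e set \<Rightarrow> ('e \<Rightarrow> 'v) \<Rightarrow> ('e \<Rightarrow> 'v) \<Rightarrow> 'v set set \<Rightarrow> bool" where
  "tree_partition V Ed al om P \<longleftrightarrow> (\<forall>S\<in>P. is_subtree V Ed al om S) \<and>
     (\<forall>S\<in>P. \<forall>S'\<in>P. S \<noteq> S' \<longrightarrow> S \<inter> S' = {}) \<and> \<Union>P = V"

section \<open>Rays and ends\<close>

definition is_ray :: "'v set \<Rightarrow> 'e set \<Rightarrow> ('e \<Rightarrow> 'v) \<Rightarrow> ('e \<Rightarrow> 'v) \<Rightarrow> (nat \<Rightarrow> 'v) \<Rightarrow> bool" where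
  "is_ray V Ed al om r \<longleftrightarrow> (\<forall>n. r n \<in> V \<and> (\<exists>e\<in>Ed. al e = r n \<and> om e = r (Suc n)) \<and>
     r (Suc (Suc n)) \<noteq> r n)"

text \<open>In a tree two rays are equivalent (define the same end) iff they share a tail.\<close>
definition ray_equiv :: "(nat \<Rightarrow> 'v) \<Rightarrow> (nat \<Rightarrow> 'v) \<Rightarrow> bool" where
  "ray_equiv r r' \<longleftrightarrow> (\<exists>k j. \<forall>n. r (n + k) = r' (n + j))"

definition end_of :: "'v set \<Rightarrow> 'e set \<Rightarrow> ('e \<Rightarrow> 'v) \<Rightarrow> ('e \<Rightarrow> 'v) \<Rightarrow> (nat \<Rightarrow> 'v) \<Rightarrow> (nat \<Rightarrow> 'v) set" where
  "end_of V Ed al om r = {r'. is_ray V Ed al om r' \<and> ray_equiv r r'}"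

definition ends :: "'v set \<Rightarrow> 'e set \<Rightarrow> ('e \<Rightarrow> 'v) \<Rightarrow> ('e \<Rightarrow> 'v) \<Rightarrow> (nat \<Rightarrow> 'v) set set" where
  "ends V Ed al om = {end_of V Ed al om r | r. is_ray V Ed al om r}"

section \<open>Tree systems of metric compacta\<close>

definition mdiam :: "'a metric \<Rightarrow> 'a set \<Rightarrow> real" where
  "mdiam m S = Sup {mdist m x y | x y. x \<in> S \<and> y \<in> S}"

definition tree_system ::
  "'v set \<Rightarrow> 'e set \<Rightarrow> ('e \<Rightarrow> 'v) \<Rightarrow> ('e \<Rightarrow> 'v) \<Rightarrow> ('e \<Rightarrow> 'e) \<Rightarrow>
   ('v \<Rightarrow> 'a metric) \<Rightarrow> ('e \<Rightarrow> 'a set) \<Rightarrow> ('e \<Rightarrow> 'a \<Rightarrow> 'a) \<Rightarrow> bool" where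
  "tree_system V Ed al om rv K Sg ph \<longleftrightarrow>
     is_tree V Ed al om rv \<and>
     (\<forall>t\<in>V. compact_space (mtopology_of (K t))) \<and>
     (\<forall>e\<in>Ed. Sg e \<noteq> {} \<and> compactin (mtopology_of (K (al e))) (Sg e)) \<and>
     (\<forall>e\<in>Ed. homeomorphic_map (subtopology (mtopology_of (K (al e))) (Sg e))
                               (subtopology (mtopology_of (K (al (rv e)))) (Sg (rv e))) (ph e)) \<and>
     (\<forall>e\<in>Ed. \<forall>x\<in>Sg e. ph (rv e) (ph e x) = x) \<and>
     (\<forall>t\<in>V. \<forall>e\<in>Ed. \<forall>e'\<in>Ed. al e = t \<and> al e' = t \<and> e \<noteq> e' \<longrightarrow> Sg e \<inter> Sg e' = {}) \<and>
     (\<forall>t\<in>V. \<forall>\<epsilon>>0. finite {e \<in> Ed. al e = t \<and> mdiam (K t) (Sg e) \<ge> \<epsilon>})"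

section \<open>The limit\<close>

text \<open>Points of the limit: equivalence classes of the disjoint union (points of the
quotient) on the left, ends (sets of rays) on the right.\<close>
type_synonym ('v, 'a) lpt = "('v \<times> 'a) set + (nat \<Rightarrow> 'v) set"

definition glue :: "'e set \<Rightarrow> ('e \<Rightarrow> 'v) \<Rightarrow> ('e \<Rightarrow> 'v) \<Rightarrow> ('e \<Rightarrow> 'a set) \<Rightarrow> ('e \<Rightarrow> 'a \<Rightarrow> 'a)
     \<Rightarrow> (('v \<times> 'a) \<times> ('v \<times> 'a)) set" where
  "glue Ed al om Sg ph = {((al e, x), (om e, ph e x)) | e x. e \<in> Ed \<and> x \<in> Sg e}"

definition cls :: "'e set \<Rightarrow> ('e \<Rightarrow> 'v) \<Rightarrow> ('e \<Rightarrow> 'v) \<Rightarrow> ('e \<Rightarrow> 'a set) \<Rightarrow> ('e \<Rightarrow> 'a \<Rightarrow> 'a)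
     \<Rightarrow> 'v \<times> 'a \<Rightarrow> ('v \<times> 'a) set" where
  "cls Ed al om Sg ph p = ((glue Ed al om Sg ph \<union> (glue Ed al om Sg ph)\<inverse>)\<^sup>*) `` {p}"

definition disj_union :: "'v set \<Rightarrow> ('v \<Rightarrow> 'a topology) \<Rightarrow> ('v \<times> 'a) set" where
  "disj_union W K = {(t, x). t \<in> W \<and> x \<in> topspace (K t)}"

definition slice :: "('v \<times> 'a) set \<Rightarrow> 'v \<Rightarrow> 'a set" where
  "slice U t = {x. (t, x) \<in> U}"

text \<open>first_edge W e t: the shortest path from the subtree W to the vertex t starts with e.\<close>
definition first_edge :: "'e set \<Rightarrow> ('e \<Rightarrow> 'v) \<Rightarrow> ('e \<Rightarrow> 'v) \<Rightarrow> 'v set \<Rightarrow> 'e \<Rightarrow> 'v \<Rightarrow> bool" where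
  "first_edge Ed al om W e t \<longleftrightarrow> al e \<in> W \<and> (\<exists>es. walk Ed al om es \<and> es \<noteq> [] \<and> hd es = e \<and>
      om (last es) = t \<and> (\<forall>e'\<in>set es. om e' \<notin> W))"

text \<open>U is (the preimage in the disjoint union of) an open saturated subset of K_F,
where F is the finite subtree with vertex set W.\<close>
definition open_saturated ::
  "'v set \<Rightarrow> 'e set \<Rightarrow> ('e \<Rightarrow> 'v) \<Rightarrow> ('e \<Rightarrow> 'v) \<Rightarrow> ('v \<Rightarrow> 'a topology) \<Rightarrow> ('e \<Rightarrow> 'a set) \<Rightarrow>
   ('e \<Rightarrow> 'a \<Rightarrow> 'a) \<Rightarrow> 'v set \<Rightarrow> ('v \<times> 'a) set \<Rightarrow> bool" where
  "open_saturated V Ed al om K Sg ph W U \<longleftrightarrow>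
     U \<subseteq> disj_union W K \<and>
     (\<forall>t\<in>W. openin (K t) (slice U t)) \<and>
     (\<forall>e\<in>sub_edges Ed al om W. \<forall>x\<in>Sg e. (al e, x) \<in> U \<longleftrightarrow> (om e, ph e x) \<in> U) \<and>
     (\<forall>e\<in>Ed. al e \<in> W \<and> om e \<notin> W \<longrightarrow> Sg e \<subseteq> slice U (al e) \<or> Sg e \<inter> slice U (al e) = {})"

definition G_set ::
  "'v set \<Rightarrow> 'e set \<Rightarrow> ('e \<Rightarrow> 'v) \<Rightarrow> ('e \<Rightarrow> 'v) \<Rightarrow> ('v \<Rightarrow> 'a topology) \<Rightarrow> ('e \<Rightarrow> 'a set) \<Rightarrow>
   ('e \<Rightarrow> 'a \<Rightarrow> 'a) \<Rightarrow> 'v set \<Rightarrow> ('v \<times> 'a) set \<Rightarrow> ('v, 'a) lpt set" where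
  "G_set V Ed al om K Sg ph W U =
     Inl ` (cls Ed al om Sg ph ` U) \<union>
     Inl ` {cls Ed al om Sg ph (t, x) | t x. t \<in> V - W \<and> x \<in> topspace (K t) \<and>
              (\<exists>e\<in>Ed. al e \<in> W \<and> om e \<notin> W \<and> Sg e \<subseteq> slice U (al e) \<and> first_edge Ed al om W e t)} \<union>
     Inr ` {\<xi> \<in> ends V Ed al om. \<exists>r\<in>\<xi>. r 0 \<in> W \<and>
              (\<exists>e\<in>Ed. al e = r 0 \<and> om e = r 1 \<and> om e \<notin> W \<and> Sg e \<subseteq> slice U (al e))}"

definition lim_basis ::
  "'v set \<Rightarrow> 'e set \<Rightarrow> ('e \<Rightarrow> 'v) \<Rightarrow> ('e \<Rightarrow> 'v) \<Rightarrow> ('v \<Rightarrow> 'a topology) \<Rightarrow> ('e \<Rightarrow> 'a set) \<Rightarrow>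
   ('e \<Rightarrow> 'a \<Rightarrow> 'a) \<Rightarrow> ('v, 'a) lpt set set" where
  "lim_basis V Ed al om K Sg ph =
     {G_set V Ed al om K Sg ph W U | W U. finite W \<and> is_subtree V Ed al om W \<and>
        open_saturated V Ed al om K Sg ph W U}"

definition lim_points ::
  "'v set \<Rightarrow> 'e set \<Rightarrow> ('e \<Rightarrow> 'v) \<Rightarrow> ('e \<Rightarrow> 'v) \<Rightarrow> ('v \<Rightarrow> 'a topology) \<Rightarrow> ('e \<Rightarrow> 'a set) \<Rightarrow>
   ('e \<Rightarrow> 'a \<Rightarrow> 'a) \<Rightarrow> ('v, 'a) lpt set" where
  "lim_points V Ed al om K Sg ph =
     Inl ` (cls Ed al om Sg ph ` disj_union V K) \<union> Inr ` ends V Ed al om"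

text \<open>The limit lim Theta (as a topological space; the restriction to lim_points is
harmless since every basic set lies in it).\<close>
definition lim_top ::
  "'v set \<Rightarrow> 'e set \<Rightarrow> ('e \<Rightarrow> 'v) \<Rightarrow> ('e \<Rightarrow> 'v) \<Rightarrow> ('v \<Rightarrow> 'a topology) \<Rightarrow> ('e \<Rightarrow> 'a set) \<Rightarrow>
   ('e \<Rightarrow> 'a \<Rightarrow> 'a) \<Rightarrow> ('v, 'a) lpt topology" where
  "lim_top V Ed al om K Sg ph =
     subtopology (topology_generated_by (lim_basis V Ed al om K Sg ph)) (lim_points V Ed al om K Sg ph)"

section \<open>Consolidation\<close>

definition part :: "'v set set \<Rightarrow> 'v \<Rightarrow> 'v set" where
  "part P t = (THE S. S \<in> P \<and> t \<in> S)"

definition cons_edges :: "'e set \<Rightarrow> ('e \<Rightarrow> 'v) \<Rightarrow> ('e \<Rightarrow> 'v) \<Rightarrow> 'v set set \<Rightarrow> 'e set" where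
  "cons_edges Ed al om P = {e \<in> Ed. \<not> (\<exists>S\<in>P. al e \<in> S \<and> om e \<in> S)}"

definition cons_al :: "('e \<Rightarrow> 'v) \<Rightarrow> 'v set set \<Rightarrow> 'e \<Rightarrow> 'v set" where
  "cons_al al P e = part P (al e)"

definition cons_K :: "'e set \<Rightarrow> ('e \<Rightarrow> 'v) \<Rightarrow> ('e \<Rightarrow> 'v) \<Rightarrow> ('v \<Rightarrow> 'a topology) \<Rightarrow>
   ('e \<Rightarrow> 'a set) \<Rightarrow> ('e \<Rightarrow> 'a \<Rightarrow> 'a) \<Rightarrow> 'v set \<Rightarrow> ('v, 'a) lpt topology" where
  "cons_K Ed al om K Sg ph S = lim_top S (sub_edges Ed al om S) al om K Sg ph"

text \<open>The inclusion of K_t into K_S = lim Theta_S, for S the part containing t.\<close>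
definition cons_emb :: "'e set \<Rightarrow> ('e \<Rightarrow> 'v) \<Rightarrow> ('e \<Rightarrow> 'v) \<Rightarrow> ('e \<Rightarrow> 'a set) \<Rightarrow> ('e \<Rightarrow> 'a \<Rightarrow> 'a) \<Rightarrow>
   'v set set \<Rightarrow> 'v \<Rightarrow> 'a \<Rightarrow> ('v, 'a) lpt" where
  "cons_emb Ed al om Sg ph P t x = Inl (cls (sub_edges Ed al om (part P t)) al om Sg ph (t, x))"

definition cons_Sg :: "'e set \<Rightarrow> ('e \<Rightarrow> 'v) \<Rightarrow> ('e \<Rightarrow> 'v) \<Rightarrow> ('e \<Rightarrow> 'a set) \<Rightarrow> ('e \<Rightarrow> 'a \<Rightarrow> 'a) \<Rightarrow>
   'v set set \<Rightarrow> 'e \<Rightarrow> ('v, 'a) lpt set" where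
  "cons_Sg Ed al om Sg ph P e = cons_emb Ed al om Sg ph P (al e) ` Sg e"

definition cons_ph :: "'e set \<Rightarrow> ('e \<Rightarrow> 'v) \<Rightarrow> ('e \<Rightarrow> 'v) \<Rightarrow> ('e \<Rightarrow> 'a set) \<Rightarrow> ('e \<Rightarrow> 'a \<Rightarrow> 'a) \<Rightarrow>
   'v set set \<Rightarrow> 'e \<Rightarrow> ('v, 'a) lpt \<Rightarrow> ('v, 'a) lpt" where
  "cons_ph Ed al om Sg ph P e y =
     cons_emb Ed al om Sg ph P (om e)
       (ph e (SOME x. x \<in> Sg e \<and> cons_emb Ed al om Sg ph P (al e) x = y))"

section \<open>The canonical bijection lim Theta_Pi \<rightarrow> lim Theta\<close>

definition canon_pt :: "'v set \<Rightarrow> 'e set \<Rightarrow> ('e \<Rightarrow> 'v) \<Rightarrow> ('e \<Rightarrow> 'v) \<Rightarrow> ('e \<Rightarrow> 'a set) \<Rightarrow>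
   ('e \<Rightarrow> 'a \<Rightarrow> 'a) \<Rightarrow> 'v set \<times> ('v, 'a) lpt \<Rightarrow> ('v, 'a) lpt" where
  "canon_pt V Ed al om Sg ph p =
     (case snd p of
        Inl c \<Rightarrow> Inl (cls Ed al om Sg ph (SOME q. q \<in> c))
      | Inr \<xi> \<Rightarrow> Inr (end_of V Ed al om (SOME r. r \<in> \<xi>)))"

definition canon :: "'v set \<Rightarrow> 'e set \<Rightarrow> ('e \<Rightarrow> 'v) \<Rightarrow> ('e \<Rightarrow> 'v) \<Rightarrow> ('e \<Rightarrow> 'a set) \<Rightarrow>
   ('e \<Rightarrow> 'a \<Rightarrow> 'a) \<Rightarrow> ('v set, ('v, 'a) lpt) lpt \<Rightarrow> ('v, 'a) lpt" where
  "canon V Ed al om Sg ph z =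
     (case z of
        Inl C \<Rightarrow> canon_pt V Ed al om Sg ph (SOME p. p \<in> C)
      | Inr \<xi> \<Rightarrow> Inr (THE \<eta>. \<eta> \<in> ends V Ed al om \<and>
           (\<exists>R\<in>\<xi>. \<exists>r\<in>\<eta>. \<exists>m. strict_mono m \<and>
              (\<forall>i. \<exists>e\<in>Ed. al e \<in> R i \<and> om e \<in> R (Suc i) \<and>
                        r (m i) = al e \<and> r (Suc (m i)) = om e))))"

end

theory Submission
  imports Defs
begin

text \<open>Removing an edge splits a tree into two half-trees, and everything is phrased through them: the
half-tree \<open>side e\<close> beyond \<open>e\<close> decides path questions, ends correspond to consistent orientations of the
edges, and every decreasing sequence of half-trees comes from a ray. A class of the glueing relation has at
most two elements because the \<open>\<Sigma>\<^sub>e\<close> at one vertex are disjoint, so membership in a basic set \<open>G(U)\<close> is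
decided by \<open>U\<close> or by the unique edge through which a point leaves the finite subtree. A Koenig argument
along a ray of uncovered branches gives compactness of the limit; nullity makes the maximal saturated
subset of an open set open, which provides a countable family of open sets separating points, hence
metrizability. The \<open>\<Sigma>\<^sub>e\<close> are null in \<open>lim \<Theta>\<^sub>S\<close> because all but those based on a finite subtree lie in single
members of a given cover. The canonical map pulls the basic set of \<open>W\<close> back to a basic set of the image of
\<open>W\<close> in the consolidated tree, is injective, and has compact dense image.\<close>

section \<open>Oriented trees and half-trees\<close>

text \<open>A tree system needs metrics on its vertex spaces, whereas \<open>lim_top\<close> is only
  a topology. Each K_S is shown to be compact metrizable, and the consolidation is then treated for
  an arbitrary family \<open>KS\<close> of compatible metrics. Nullity survives this choice because
  a cover by small tame sets handles all but finitely many base vertices. The sets G(U) for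
  different finite subtrees are awkward to intersect, so the topology is handled through tame sets:
  beyond some finite subtree they contain each branch or miss it. Tame open sets form a base, and
  they carry the proofs of compactness, nullity and density. Both limits are compact and the target
  is Hausdorff, so a continuous bijection is enough. Continuity of the inverse is never examined,
  and surjectivity on ends comes from density, without sorting the rays of T into those that finally
  stay in one part and those that cross infinitely many. Half-trees of a subtree and of the
  consolidated tree are read off from those of T, and the same locale is instantiated for all
  three.\<close>

definition step :: "'e set \<Rightarrow> ('e \<Rightarrow> 'v) \<Rightarrow> ('e \<Rightarrow> 'v) \<Rightarrow> ('v \<times> 'v) set" where
  "step E al om = {(al e, om e) | e. e \<in> E}"

lemma stepI: "e \<in> E \<Longrightarrow> (al e, om e) \<in> step E al om"
  by (auto simp: step_def)

lemma step_mono: "E \<subseteq> E' \<Longrightarrow> step E al om \<subseteq> step E' al om"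
  by (auto simp: step_def)

lemma walk_Nil [simp]: "walk E al om []"
  by (simp add: walk_def)

lemma walk_Cons: "walk E al om (e # es) \<longleftrightarrow> e \<in> E \<and> walk E al om es \<and> (es \<noteq> [] \<longrightarrow> om e = al (hd es))"
proof -
  have "(\<forall>i. Suc i < length (e # es) \<longrightarrow> om ((e # es) ! i) = al ((e # es) ! Suc i)) \<longleftrightarrow>
      (\<forall>i. Suc i < length es \<longrightarrow> om (es ! i) = al (es ! Suc i)) \<and> (es \<noteq> [] \<longrightarrow> om e = al (hd es))"
    (is "?L \<longleftrightarrow> ?R")
  proof
    assume L: ?L
    have "om (es ! i) = al (es ! Suc i)" if "Suc i < length es" for i
      using L[rule_format, of "Suc i"] that by simp
    moreover have "om e = al (hd es)" if "es \<noteq> []"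
      using L[rule_format, of 0] that by (simp add: hd_conv_nth)
    ultimately show ?R by blast
  next
    assume R: ?R
    then show ?L
      by (auto simp: nth_Cons hd_conv_nth split: nat.split)
  qed
  then show ?thesis unfolding walk_def by auto
qed

lemma walk_snoc: "walk E al om (es @ [e]) \<longleftrightarrow> e \<in> E \<and> walk E al om es \<and> (es \<noteq> [] \<longrightarrow> om (last es) = al e)"
  by (induction es) (auto simp: walk_Cons hd_append)

lemma reduced_Nil [simp]: "reduced rv []"
  by (simp add: reduced_def)

lemma reduced_Cons: "reduced rv (e # es) \<longleftrightarrow> reduced rv es \<and> (es \<noteq> [] \<longrightarrow> hd es \<noteq> rv e)"
proof -
  have "(\<forall>i. Suc i < length (e # es) \<longrightarrow> (e # es) ! Suc i \<noteq> rv ((e # es) ! i)) \<longleftrightarrow>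
      (\<forall>i. Suc i < length es \<longrightarrow> es ! Suc i \<noteq> rv (es ! i)) \<and> (es \<noteq> [] \<longrightarrow> hd es \<noteq> rv e)"
    (is "?L \<longleftrightarrow> ?R")
  proof
    assume L: ?L
    have "es ! Suc i \<noteq> rv (es ! i)" if "Suc i < length es" for i
      using L[rule_format, of "Suc i"] that by simp
    moreover have "hd es \<noteq> rv e" if "es \<noteq> []"
      using L[rule_format, of 0] that by (simp add: hd_conv_nth)
    ultimately show ?R by blast
  next
    assume R: ?R
    then show ?L
      by (auto simp: nth_Cons hd_conv_nth split: nat.split)
  qed
  then show ?thesis unfolding reduced_def .
qed

lemma reduced_snoc: "reduced rv (es @ [e]) \<longleftrightarrow> reduced rv es \<and> (es \<noteq> [] \<longrightarrow> e \<noteq> rv (last es))"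
  by (induction es) (auto simp: reduced_Cons hd_append)

lemma walk_from_to_Nil: "walk_from_to E al om [] u v \<longleftrightarrow> u = v"
  by (simp add: walk_from_to_def)

lemma walk_from_to_Cons:
  "walk_from_to E al om (e # es) u v \<longleftrightarrow> e \<in> E \<and> al e = u \<and> walk_from_to E al om es (om e) v"
  by (cases es) (auto simp: walk_from_to_def walk_Cons)

text \<open>Turns the list-based walks of the definitions into reachability, so that path arguments
  become inductions over one edge at a time.\<close>

lemma ex_walk_iff: "(\<exists>es. walk_from_to E al om es u v) \<longleftrightarrow> (u, v) \<in> (step E al om)\<^sup>*"
proof
  assume "\<exists>es. walk_from_to E al om es u v"
  then obtain es where "walk_from_to E al om es u v" by blast
  then show "(u, v) \<in> (step E al om)\<^sup>*"
  proof (induction es arbitrary: u)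
    case Nil
    then show ?case by (simp add: walk_from_to_Nil)
  next
    case (Cons e es)
    then have "(om e, v) \<in> (step E al om)\<^sup>*" and "(u, om e) \<in> step E al om"
      by (auto simp: walk_from_to_Cons step_def)
    then show ?case by (rule converse_rtrancl_into_rtrancl[rotated])
  qed
next
  assume "(u, v) \<in> (step E al om)\<^sup>*"
  then show "\<exists>es. walk_from_to E al om es u v"
  proof (induction rule: converse_rtrancl_induct)
    case base
    show ?case by (rule exI[of _ "[]"]) (simp add: walk_from_to_Nil)
  next
    case (step u w)
    then obtain e es where "e \<in> E" "u = al e" "w = om e" "walk_from_to E al om es w v"
      by (auto simp: step_def)
    then have "walk_from_to E al om (e # es) u v" by (simp add: walk_from_to_Cons)
    then show ?case by blast
  qed
qed

text \<open>The walk is built backwards from its end. Prefixing \<open>e\<close> to a reduced walk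
  creates at most one backtracking, a leading \<open>rv e\<close>, and dropping that edge leaves a
  reduced walk from the start of \<open>e\<close>. \<open>E\<close> is any edge set closed under
  reversal, since the lemma is applied to \<open>Ed - {e, rv e}\<close>.\<close>

lemma ex_reduced_walk:
  assumes "(u, v) \<in> (step E al om)\<^sup>*"
    and "\<And>e. e \<in> E \<Longrightarrow> rv e \<in> E \<and> al (rv e) = om e \<and> om (rv e) = al e"
  shows "\<exists>es. walk_from_to E al om es u v \<and> reduced rv es"
  using assms(1)
proof (induction rule: converse_rtrancl_induct)
  case base
  show ?case by (rule exI[of _ "[]"]) (simp add: walk_from_to_Nil)
next
  case (step u w)
  then obtain e es where e: "e \<in> E" "u = al e" "w = om e"
    and es: "walk_from_to E al om es w v" "reduced rv es"
    by (auto simp: step_def)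
  show ?case
  proof (cases "es \<noteq> [] \<and> hd es = rv e")
    case True
    then obtain es' where es': "es = rv e # es'" by (metis list.collapse)
    then have "walk_from_to E al om es' u v" "reduced rv es'"
      using es e assms(2) by (auto simp: walk_from_to_Cons reduced_Cons)
    then show ?thesis by blast
  next
    case False
    then have "walk_from_to E al om (e # es) u v" "reduced rv (e # es)"
      using es e by (auto simp: walk_from_to_Cons reduced_Cons)
    then show ?thesis by blast
  qed
qed

definition conn :: "'e set \<Rightarrow> ('e \<Rightarrow> 'v) \<Rightarrow> ('e \<Rightarrow> 'v) \<Rightarrow> 'v set \<Rightarrow> bool" where
  "conn E al om C \<longleftrightarrow> (\<forall>u\<in>C. \<forall>v\<in>C. (u, v) \<in> (step (sub_edges E al om C) al om)\<^sup>*)"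

lemma is_subtree_iff: "is_subtree V E al om S \<longleftrightarrow> S \<noteq> {} \<and> S \<subseteq> V \<and> conn E al om S"
  by (simp add: is_subtree_def conn_def ex_walk_iff)

definition side :: "'e set \<Rightarrow> ('e \<Rightarrow> 'v) \<Rightarrow> ('e \<Rightarrow> 'v) \<Rightarrow> ('e \<Rightarrow> 'e) \<Rightarrow> 'e \<Rightarrow> 'v set" where
  "side E al om rv e = {v. (om e, v) \<in> (step (E - {e, rv e}) al om)\<^sup>*}"

locale tree =
  fixes V :: "'v set" and Ed :: "'e set" and al om :: "'e \<Rightarrow> 'v" and rv :: "'e \<Rightarrow> 'e"
  assumes is_tree: "is_tree V Ed al om rv"
begin

abbreviation sd :: "'e \<Rightarrow> 'v set" where "sd \<equiv> side Ed al om rv"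
abbreviation subtree :: "'v set \<Rightarrow> bool" where "subtree \<equiv> is_subtree V Ed al om"

definition N :: "'v set \<Rightarrow> 'e set" where
  "N W = {e \<in> Ed. al e \<in> W \<and> om e \<notin> W}"

lemma V_nonempty: "V \<noteq> {}" and countable_V: "countable V"
  using is_tree by (auto simp: is_tree_def)

lemma edge [simp]:
  assumes "e \<in> Ed"
  shows al_V: "al e \<in> V" and om_V: "om e \<in> V" and rv_Ed: "rv e \<in> Ed" and rv_neq: "rv e \<noteq> e"
    and rv_rv: "rv (rv e) = e" and al_rv: "al (rv e) = om e" and om_rv: "om (rv e) = al e"
proof -
  have *: "\<forall>e\<in>Ed. al e \<in> V \<and> om e \<in> V \<and> rv e \<in> Ed \<and> rv e \<noteq> e \<and> rv (rv e) = e \<and> al (rv e) = om e"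
    using is_tree by (simp add: is_tree_def)
  then show "al e \<in> V" "om e \<in> V" "rv e \<in> Ed" "rv e \<noteq> e" "rv (rv e) = e" "al (rv e) = om e"
    using assms by blast+
  then show "om (rv e) = al e" using * by metis
qed

lemma reachable: "u \<in> V \<Longrightarrow> v \<in> V \<Longrightarrow> (u, v) \<in> (step Ed al om)\<^sup>*"
  using is_tree by (simp add: is_tree_def ex_walk_iff)

lemma no_reduced_cycle: "walk Ed al om es \<Longrightarrow> es \<noteq> [] \<Longrightarrow> reduced rv es \<Longrightarrow> al (hd es) \<noteq> om (last es)"
  using is_tree by (simp add: is_tree_def)

lemma al_neq_om: "e \<in> Ed \<Longrightarrow> al e \<noteq> om e"
  using no_reduced_cycle[of "[e]"] by (simp add: walk_Cons reduced_Cons)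

lemma om_side [simp]: "om e \<in> sd e"
  by (simp add: side_def)

text \<open>Otherwise a reduced walk leads from \<open>om e\<close> back to \<open>al e\<close>
  without using \<open>e\<close> or \<open>rv e\<close>. Prefixing \<open>e\<close> keeps it reduced
  and closes it up, which a tree forbids.\<close>

lemma al_notin_side [simp]:
  assumes e: "e \<in> Ed"
  shows "al e \<notin> sd e"
proof
  assume "al e \<in> sd e"
  then have "(om e, al e) \<in> (step (Ed - {e, rv e}) al om)\<^sup>*" by (simp add: side_def)
  moreover have "\<And>f. f \<in> Ed - {e, rv e} \<Longrightarrow> rv f \<in> Ed - {e, rv e} \<and> al (rv f) = om f \<and> om (rv f) = al f"
    using e by (metis Diff_iff insert_iff empty_iff edge(3,5,6,7))
  ultimately obtain es where es: "walk_from_to (Ed - {e, rv e}) al om es (om e) (al e)" "reduced rv es"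
    using ex_reduced_walk[of "om e" "al e" "Ed - {e, rv e}" al om rv] by blast
  have "es \<noteq> []" using es(1) al_neq_om[of e] e by (auto simp: walk_from_to_Nil)
  then have *: "walk (Ed - {e, rv e}) al om es" "al (hd es) = om e" "om (last es) = al e"
    using es by (auto simp: walk_from_to_def)
  then have "walk Ed al om es" "hd es \<noteq> rv e"
    using \<open>es \<noteq> []\<close> by (auto simp: walk_def dest: hd_in_set)
  then have "walk Ed al om (e # es)" and "reduced rv (e # es)" and "om (last (e # es)) = al e"
    using e es * \<open>es \<noteq> []\<close> by (auto simp: walk_Cons reduced_Cons)
  then show False using no_reduced_cycle[of "e # es"] by simp
qed

text \<open>An edge \<open>f\<close> entering the half-tree is not \<open>rv e\<close>, which ends
  at \<open>al e\<close>. If it were not \<open>e\<close> either, its reverse would survive the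
  deletion of \<open>e\<close> and \<open>rv e\<close> and connect \<open>om f\<close> to
  \<open>al f\<close>.\<close>

lemma cross_in:
  assumes "e \<in> Ed" "f \<in> Ed" "al f \<notin> sd e" "om f \<in> sd e"
  shows "f = e"
proof (rule ccontr)
  assume "f \<noteq> e"
  moreover have "f \<noteq> rv e" using assms by (metis om_rv al_notin_side)
  ultimately have "rv f \<in> Ed - {e, rv e}" using assms by (metis Diff_iff insert_iff empty_iff edge(3,5))
  then have "(om f, al f) \<in> step (Ed - {e, rv e}) al om" using assms by (metis stepI al_rv om_rv)
  then show False using assms by (auto simp: side_def intro: rtrancl_into_rtrancl)
qed

lemma cross_out:
  assumes "e \<in> Ed" "f \<in> Ed" "al f \<in> sd e" "om f \<notin> sd e"
  shows "f = rv e"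
  using cross_in[of e "rv f"] assms by auto

lemma side_subset: "e \<in> Ed \<Longrightarrow> sd e \<subseteq> V"
proof
  fix v assume e: "e \<in> Ed" and "v \<in> sd e"
  then have "(om e, v) \<in> (step (Ed - {e, rv e}) al om)\<^sup>*" by (simp add: side_def)
  then show "v \<in> V" using e by induction (auto simp: step_def)
qed

text \<open>A path from \<open>om e\<close> changes half-tree only along \<open>e\<close> or
  \<open>rv e\<close>, which lead to \<open>om e\<close> and \<open>al e\<close>; this covers all
  vertices. For disjointness, a path that avoids both edges starts outside \<open>sd (rv e)\<close>
  and could enter it only along \<open>rv e\<close>.\<close>

lemma side_rv:
  assumes e: "e \<in> Ed"
  shows "sd (rv e) = V - sd e"
proof -
  have "v \<in> sd e \<or> v \<in> sd (rv e)" if "v \<in> V" for v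
  proof -
    have "(om e, v) \<in> (step Ed al om)\<^sup>*" using reachable e that by simp
    then show ?thesis
    proof (induction)
      case base
      then show ?case by simp
    next
      case (step v w)
      then obtain f where f: "f \<in> Ed" "v = al f" "w = om f" by (auto simp: step_def)
      then show ?case using step.IH cross_out[of e f] cross_out[of "rv e" f] e
        by (metis edge(3,5,7) om_side)
    qed
  qed
  moreover have "v \<notin> sd (rv e)" if v: "v \<in> sd e" for v
  proof
    assume w: "v \<in> sd (rv e)"
    have "(om e, v) \<in> (step (Ed - {e, rv e}) al om)\<^sup>*" using v by (simp add: side_def)
    then have "v \<notin> sd (rv e)"
    proof (induction)
      case base
      then show ?case using e al_notin_side[of "rv e"] by simp
    next
      case (step v w)
      then obtain f where f: "f \<in> Ed" "f \<noteq> e" "f \<noteq> rv e" "v = al f" "w = om f" by (auto simp: step_def)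
      then show ?case using step.IH cross_in[of "rv e" f] e by auto
    qed
    then show False using w by simp
  qed
  ultimately show ?thesis using side_subset[of "rv e"] e by auto
qed

lemma conn_step_sym:
  assumes "(u, v) \<in> (step (sub_edges Ed al om W) al om)\<^sup>*"
  shows "(v, u) \<in> (step (sub_edges Ed al om W) al om)\<^sup>*"
proof -
  let ?R = "step (sub_edges Ed al om W) al om"
  have "?R\<inverse> \<subseteq> ?R"
  proof
    fix p assume "p \<in> ?R\<inverse>"
    then obtain f where f: "f \<in> sub_edges Ed al om W" "p = (om f, al f)" by (auto simp: step_def)
    then have "rv f \<in> sub_edges Ed al om W" "p = (al (rv f), om (rv f))" by (auto simp: sub_edges_def)
    then show "p \<in> ?R" using stepI by metis
  qed
  then show ?thesis using assms by (metis rtrancl_converseI rtrancl_mono subsetD)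
qed

lemma conn_side: "e \<in> Ed \<Longrightarrow> conn Ed al om (sd e)"
proof -
  assume e: "e \<in> Ed"
  let ?R = "step (sub_edges Ed al om (sd e)) al om"
  have 1: "(om e, v) \<in> ?R\<^sup>*" if "v \<in> sd e" for v
  proof -
    have "(om e, v) \<in> (step (Ed - {e, rv e}) al om)\<^sup>*" using that by (simp add: side_def)
    then show ?thesis
    proof (induction)
      case base
      then show ?case by simp
    next
      case (step v w)
      then obtain f where f: "f \<in> Ed - {e, rv e}" "v = al f" "w = om f" by (auto simp: step_def)
      then have "f \<in> sub_edges Ed al om (sd e)"
        using step.hyps by (auto simp: sub_edges_def side_def intro: rtrancl_into_rtrancl)
      then have "(v, w) \<in> ?R" using f stepI by metis
      then show ?case using step.IH by (rule rtrancl_into_rtrancl[rotated])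
    qed
  qed
  have "(u, om e) \<in> ?R\<^sup>*" if "u \<in> sd e" for u
    using 1[OF that] by (rule conn_step_sym)
  then show ?thesis unfolding conn_def using 1 by (metis rtrancl_trans)
qed

text \<open>A walk inside \<open>C\<close> from \<open>u\<close> to \<open>v\<close> has to enter
  \<open>sd e\<close>, and by \<open>cross_in\<close> it does so along \<open>e\<close>
  itself.\<close>

lemma conn_cross:
  assumes "conn Ed al om C" "u \<in> C" "v \<in> C" "e \<in> Ed" "u \<notin> sd e" "v \<in> sd e"
  shows "al e \<in> C \<and> om e \<in> C"
proof -
  have "(u, v) \<in> (step (sub_edges Ed al om C) al om)\<^sup>*" using assms by (auto simp: conn_def)
  then have "v \<in> sd e \<longrightarrow> al e \<in> C \<and> om e \<in> C"
  proof induction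
    case base
    then show ?case using assms by simp
  next
    case (step v w)
    then show ?case using cross_in[of e] assms(4) by (auto simp: step_def sub_edges_def)
  qed
  then show ?thesis using assms by simp
qed

text \<open>Contrapositive of \<open>conn_cross\<close>. The resulting alternative, inside the
  half-tree or disjoint from it, replaces most path arguments from here on.\<close>

lemma conn_subset_side:
  assumes "conn Ed al om C" "e \<in> Ed" "al e \<notin> C \<or> om e \<notin> C" "u \<in> C" "u \<in> sd e"
  shows "C \<subseteq> sd e"
  using conn_cross[OF assms(1) _ assms(4,2) _ assms(5)] assms(3) by blast

lemma side_nest:
  assumes "e \<in> Ed" "f \<in> Ed" "f \<noteq> rv e" "al f \<in> sd e" "om e \<notin> sd f"
  shows "sd f \<subseteq> sd e"
  using conn_subset_side[OF conn_side[of f], of e "om f"] assms cross_out[of e f] by auto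

lemma edge_unique:
  assumes "e \<in> Ed" "f \<in> Ed" "al e = al f" "om e = om f"
  shows "e = f"
  using cross_in[of f e] assms al_notin_side[of f] om_side[of f] by auto

lemma edge_rvI:
  assumes "e \<in> Ed" "f \<in> Ed" "al e = om f" "om e = al f"
  shows "e = rv f"
  using edge_unique[of e "rv f"] assms by simp

section \<open>Exits of a subtree\<close>

lemma N_D: "e \<in> N W \<Longrightarrow> e \<in> Ed \<and> al e \<in> W \<and> om e \<notin> W"
  by (simp add: N_def)

lemma subtreeD:
  assumes "subtree W"
  shows "W \<noteq> {}" "W \<subseteq> V" "conn Ed al om W"
  using assms by (auto simp: is_subtree_iff)

lemma exit_disjoint:
  assumes "subtree W" "e \<in> N W"
  shows "W \<inter> sd e = {}"
proof (rule ccontr)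
  assume "W \<inter> sd e \<noteq> {}"
  then obtain u where "u \<in> W" "u \<in> sd e" by blast
  then have "W \<subseteq> sd e" using conn_subset_side[of W e u] assms subtreeD(3) N_D by blast
  then show False using assms N_D[OF assms(2)] al_notin_side by blast
qed

text \<open>On a path from \<open>W\<close> to \<open>t\<close>, a vertex outside \<open>W\<close>
  lies beyond some exit; the half-tree of that exit can be left only along the reversed exit, which
  ends in \<open>W\<close>.\<close>

lemma exit_ex:
  assumes "subtree W" "t \<in> V" "t \<notin> W"
  shows "\<exists>e\<in>N W. t \<in> sd e"
proof -
  obtain w where w: "w \<in> W" using assms subtreeD(1) by blast
  then have "(w, t) \<in> (step Ed al om)\<^sup>*" using reachable assms subtreeD(2) by blast
  then have "t \<in> W \<or> (\<exists>e\<in>N W. t \<in> sd e)"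
  proof induction
    case base
    then show ?case using w by simp
  next
    case (step v v')
    then obtain f where f: "f \<in> Ed" "v = al f" "v' = om f" by (auto simp: step_def)
    show ?case
    proof (cases "v \<in> W")
      case True
      then show ?thesis using f om_side[of f] by (auto simp: N_def)
    next
      case False
      then obtain e where e: "e \<in> N W" "v \<in> sd e" using step.IH by blast
      then show ?thesis using cross_out[of e f] f N_D[of e] om_rv[of e] by metis
    qed
  qed
  then show ?thesis using assms by simp
qed

text \<open>\<open>sd f\<close> misses \<open>al e\<close>, so meeting \<open>sd e\<close> puts it
  inside \<open>sd e\<close>. Then \<open>f\<close> enters \<open>sd e\<close> from a vertex of
  \<open>W\<close>, and \<open>cross_in\<close> identifies the two exits.\<close>

lemma exit_unique:
  assumes W: "subtree W" and N: "e \<in> N W" "f \<in> N W" and t: "t \<in> sd e" "t \<in> sd f"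
  shows "e = f"
proof -
  have e: "e \<in> Ed" using N_D[OF N(1)] by blast
  have e2: "al e \<in> W" using N_D[OF N(1)] by blast
  have f: "f \<in> Ed" using N_D[OF N(2)] by blast
  have f2: "al f \<in> W" using N_D[OF N(2)] by blast
  have d1: "W \<inter> sd f = {}" using exit_disjoint[OF W N(2)] .
  have d2: "W \<inter> sd e = {}" using exit_disjoint[OF W N(1)] .
  have n: "al e \<notin> sd f" using d1 e2 by blast
  have "sd f \<subseteq> sd e"
    using conn_subset_side[OF conn_side[OF f] e _ t(2) t(1)] n by blast
  then have o: "om f \<in> sd e" using om_side by (rule subsetD)
  have "al f \<notin> sd e" using d2 f2 by blast
  then have "f = e" using cross_in[OF e f] o by simp
  then show ?thesis by simp
qed

lemma exit_superset:
  assumes W: "subtree W" and f: "f \<in> Ed" "sd f \<inter> W = {}"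
  shows "\<exists>e\<in>N W. sd f \<subseteq> sd e"
proof -
  have "om f \<notin> W" using f(2) om_side[of f] by blast
  then obtain e where e: "e \<in> N W" "om f \<in> sd e" using exit_ex[OF W, of "om f"] f(1) by auto
  then have "sd f \<subseteq> sd e"
    using conn_subset_side[OF conn_side[of f], of e "om f"] f N_D[OF e(1)] om_side by blast
  then show ?thesis using e by blast
qed

text \<open>Moving the second vertex along an edge \<open>f\<close> can add only \<open>f\<close> to
  the separating edges. This finiteness is what makes rays escape from every vertex.\<close>

lemma finite_separating:
  assumes "u \<in> V" "v \<in> V"
  shows "finite {e \<in> Ed. u \<notin> sd e \<and> v \<in> sd e}"
proof -
  have "(u, v) \<in> (step Ed al om)\<^sup>*" using reachable assms by blast
  then show ?thesis
  proof induction
    case base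
    then show ?case by simp
  next
    case (step v w)
    then obtain f where f: "f \<in> Ed" "v = al f" "w = om f" by (auto simp: step_def)
    then have "{e \<in> Ed. u \<notin> sd e \<and> w \<in> sd e} \<subseteq> insert f {e \<in> Ed. u \<notin> sd e \<and> v \<in> sd e}"
      using cross_in by blast
    then show ?case using step.IH finite_subset by blast
  qed
qed

lemma subtree_singleton: "v \<in> V \<Longrightarrow> subtree {v}"
  by (auto simp: is_subtree_iff conn_def)

lemma subtree_insert:
  assumes W: "subtree W" and f: "f \<in> Ed" "al f \<in> W"
  shows "subtree (insert (om f) W)"
proof -
  let ?W = "insert (om f) W"
  let ?R = "(step (sub_edges Ed al om ?W) al om)\<^sup>*"
  have mono: "(step (sub_edges Ed al om W) al om)\<^sup>* \<subseteq> ?R"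
    by (intro rtrancl_mono step_mono) (auto simp: sub_edges_def)
  have "(al f, v) \<in> ?R" if "v \<in> ?W" for v
  proof (cases "v \<in> W")
    case True
    then show ?thesis using subtreeD(3)[OF W] mono f by (auto simp: conn_def)
  next
    case False
    then have "v = om f" using that by simp
    moreover have "f \<in> sub_edges Ed al om ?W" using f by (simp add: sub_edges_def)
    ultimately have "(al f, v) \<in> step (sub_edges Ed al om ?W) al om" using stepI by simp
    then show ?thesis by (rule r_into_rtrancl)
  qed
  then have "conn Ed al om ?W" 
    unfolding conn_def by (metis conn_step_sym rtrancl_trans)
  then show ?thesis using W f by (auto simp: is_subtree_iff)
qed

lemma ex_finite_subtree:
  assumes "finite A" "A \<subseteq> V"
  shows "\<exists>W. finite W \<and> subtree W \<and> A \<subseteq> W"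
  using assms
proof (induction A)
  case empty
  then show ?case using V_nonempty subtree_singleton by (metis empty_subsetI ex_in_conv finite.emptyI finite_insert)
next
  case (insert a A)
  then obtain W where W: "finite W" "subtree W" "A \<subseteq> W" by blast
  obtain w where w: "w \<in> W" using W subtreeD(1) by blast
  then have "(w, a) \<in> (step Ed al om)\<^sup>*" using reachable insert.prems W subtreeD(2) by blast
  then have "\<exists>W'. finite W' \<and> subtree W' \<and> W \<subseteq> W' \<and> a \<in> W'"
  proof induction
    case base
    then show ?case using W w by blast
  next
    case (step v v')
    then obtain f W' where f: "f \<in> Ed" "v = al f" "v' = om f"
      and W': "finite W'" "subtree W'" "W \<subseteq> W'" "v \<in> W'"
      by (auto simp: step_def)
    then show ?case using subtree_insert[of W' f] by (intro exI[of _ "insert v' W'"]) auto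
  qed
  then show ?case using W by (metis insert_subset order_trans)
qed

text \<open>The definition asks for a walk that avoids \<open>W\<close> after its first edge. Such a
  walk cannot leave \<open>sd e\<close>, because the sole way out ends at \<open>al e\<close>, a
  vertex of \<open>W\<close>.\<close>

lemma first_edge_iff:
  assumes W: "subtree W" and e: "e \<in> N W"
  shows "first_edge Ed al om W e t \<longleftrightarrow> t \<in> sd e"
proof
  assume "first_edge Ed al om W e t"
  then obtain es where es: "walk Ed al om es" "es \<noteq> []" "hd es = e" "om (last es) = t" "\<forall>e'\<in>set es. om e' \<notin> W"
    by (auto simp: first_edge_def)
  have "om (last es) \<in> sd e" using es(1,2,3,5)
  proof (induction es rule: rev_induct)
    case Nil
    then show ?case by simp
  next
    case (snoc f es)
    show ?case
    proof (cases "es = []")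
      case True
      then show ?thesis using snoc om_side by simp
    next
      case False
      then have "al f \<in> sd e" "f \<in> Ed" "om f \<notin> W" using snoc by (auto simp: walk_snoc)
      then show ?thesis using cross_out[of e f] N_D[OF e] om_rv[of e] by (cases "om f \<in> sd e") auto
    qed
  qed
  then show "t \<in> sd e" using es by simp
next
  assume "t \<in> sd e"
  then have "(om e, t) \<in> (step (Ed - {e, rv e}) al om)\<^sup>*" by (simp add: side_def)
  then have "\<exists>es. walk Ed al om es \<and> es \<noteq> [] \<and> hd es = e \<and> om (last es) = t \<and> (\<forall>e'\<in>set es. om e' \<notin> W)"
  proof induction
    case base
    then show ?case using N_D[OF e] by (intro exI[of _ "[e]"]) (simp add: walk_Cons)
  next
    case (step v w)
    then obtain es f where f: "f \<in> Ed" "v = al f" "w = om f"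
      and es: "walk Ed al om es" "es \<noteq> []" "hd es = e" "om (last es) = v" "\<forall>e'\<in>set es. om e' \<notin> W"
      by (auto simp: step_def)
    have "(om e, w) \<in> (step (Ed - {e, rv e}) al om)\<^sup>*"
      using step.hyps by (rule rtrancl_into_rtrancl)
    then have "w \<in> sd e" by (simp add: side_def)
    then have "w \<notin> W" using exit_disjoint[OF W e] by blast
    then show ?case using f es by (intro exI[of _ "es @ [f]"]) (auto simp: walk_snoc)
  qed
  then show "first_edge Ed al om W e t" using N_D[OF e] by (simp add: first_edge_def)
qed

end

section \<open>Rays and ends\<close>

text \<open>The edges with this property form the orientation of the tree determined by the end of
  \<open>r\<close>; by \<open>toward_iff\<close> it picks exactly one edge of each pair
  \<open>e\<close>, \<open>rv e\<close>.\<close>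

definition toward :: "'e set \<Rightarrow> ('e \<Rightarrow> 'v) \<Rightarrow> ('e \<Rightarrow> 'v) \<Rightarrow> ('e \<Rightarrow> 'e) \<Rightarrow> 'e \<Rightarrow> (nat \<Rightarrow> 'v) \<Rightarrow> bool" where
  "toward E al om rv e r \<longleftrightarrow> (\<exists>n. \<forall>m\<ge>n. r m \<in> side E al om rv e)"

context tree
begin

abbreviation ray :: "(nat \<Rightarrow> 'v) \<Rightarrow> bool" where "ray \<equiv> is_ray V Ed al om"
abbreviation tow :: "'e \<Rightarrow> (nat \<Rightarrow> 'v) \<Rightarrow> bool" where "tow \<equiv> toward Ed al om rv"
abbreviation end_pt :: "(nat \<Rightarrow> 'v) \<Rightarrow> (nat \<Rightarrow> 'v) set" where "end_pt \<equiv> end_of V Ed al om"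

definition redge :: "(nat \<Rightarrow> 'v) \<Rightarrow> nat \<Rightarrow> 'e" where
  "redge r n = (SOME e. e \<in> Ed \<and> al e = r n \<and> om e = r (Suc n))"

text \<open>Consecutive edges of a chain may be far apart in the tree. Hence the edges of T crossed
  by a ray of the consolidated tree form a chain too (\<open>chain_C_redge\<close>).\<close>

definition chain :: "(nat \<Rightarrow> 'e) \<Rightarrow> bool" where
  "chain f \<longleftrightarrow> (\<forall>n. f n \<in> Ed \<and> sd (f (Suc n)) \<subset> sd (f n))"

lemma ray_V: "ray r \<Longrightarrow> r n \<in> V"
  by (simp add: is_ray_def)

lemma ray_no_return: "ray r \<Longrightarrow> r (Suc (Suc n)) \<noteq> r n"
  by (simp add: is_ray_def)

lemma redge:
  assumes "ray r"
  shows "redge r n \<in> Ed" "al (redge r n) = r n" "om (redge r n) = r (Suc n)"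
proof -
  have "\<exists>e. e \<in> Ed \<and> al e = r n \<and> om e = r (Suc n)" using assms by (auto simp: is_ray_def)
  then have "redge r n \<in> Ed \<and> al (redge r n) = r n \<and> om (redge r n) = r (Suc n)"
    unfolding redge_def by (rule someI_ex)
  then show "redge r n \<in> Ed" "al (redge r n) = r n" "om (redge r n) = r (Suc n)" by simp_all
qed

lemma redge_eqI:
  assumes "ray r" "e \<in> Ed" "al e = r n" "om e = r (Suc n)"
  shows "redge r n = e"
  using edge_unique[of "redge r n" e] redge[OF assms(1), of n] assms by simp

lemma redge_nest:
  assumes "ray r"
  shows "sd (redge r (Suc n)) \<subseteq> sd (redge r n)"
proof (rule side_nest)
  note * = redge[OF assms, of n] redge[OF assms, of "Suc n"]
  show "redge r n \<in> Ed" "redge r (Suc n) \<in> Ed" using * by simp_all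
  show "redge r (Suc n) \<noteq> rv (redge r n)"
    using * ray_no_return[OF assms, of n] om_rv[of "redge r n"] by metis
  show "al (redge r (Suc n)) \<in> sd (redge r n)" using * om_side[of "redge r n"] by simp
  show "om (redge r n) \<notin> sd (redge r (Suc n))" using * al_notin_side[of "redge r (Suc n)"] by simp
qed

lemma chain_redge:
  assumes "ray r"
  shows "chain (redge r)"
  unfolding chain_def
proof (intro allI conjI)
  fix n
  note * = redge[OF assms, of n] redge[OF assms, of "Suc n"]
  show "redge r n \<in> Ed" using * by simp
  have "r (Suc n) \<in> sd (redge r n)" using * om_side[of "redge r n"] by simp
  moreover have "r (Suc n) \<notin> sd (redge r (Suc n))" using * al_notin_side[of "redge r (Suc n)"] by simp
  ultimately show "sd (redge r (Suc n)) \<subset> sd (redge r n)" using redge_nest[OF assms, of n] by auto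
qed

lemma chain_Ed: "chain f \<Longrightarrow> f n \<in> Ed"
  by (simp add: chain_def)

lemma chain_mono:
  assumes "chain f" "m \<le> n"
  shows "sd (f n) \<subseteq> sd (f m)"
  using assms(2)
proof (induction rule: dec_induct)
  case base
  then show ?case by simp
next
  case (step k)
  then show ?case using assms(1) unfolding chain_def by blast
qed

lemma chain_strict:
  assumes "chain f" "m < n"
  shows "sd (f n) \<subset> sd (f m)"
proof -
  have "sd (f n) \<subseteq> sd (f (Suc m))" using assms by (intro chain_mono) auto
  then show ?thesis using assms(1) unfolding chain_def by blast
qed

lemma inj_chain: "chain f \<Longrightarrow> inj f"
  by (metis chain_strict injI linorder_neqE_nat psubset_eq)

text \<open>The vertex \<open>al (f 0)\<close> lies in no half-tree of the chain, so every
  \<open>f m\<close> with \<open>v\<close> beyond it separates \<open>al (f 0)\<close> from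
  \<open>v\<close>. There are finitely many such edges, and \<open>f\<close> is injective.\<close>

lemma chain_escape:
  assumes f: "chain f" and v: "v \<in> V"
  shows "\<exists>n. \<forall>m\<ge>n. v \<notin> sd (f m)"
proof -
  let ?w = "al (f 0)"
  have f0: "f 0 \<in> Ed" using f by (rule chain_Ed)
  have w: "?w \<notin> sd (f m)" for m using chain_mono[OF f, of 0 m] al_notin_side[OF f0] by blast
  have "finite {e \<in> Ed. ?w \<notin> sd e \<and> v \<in> sd e}" using finite_separating[of ?w v] v f0 by simp
  then have "finite (f -` {e \<in> Ed. ?w \<notin> sd e \<and> v \<in> sd e})"
    by (rule finite_vimageI) (rule inj_chain[OF f])
  then have "finite {m. v \<in> sd (f m)}"
    by (rule finite_subset[rotated]) (use w chain_Ed[OF f] in auto)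
  then obtain n where "\<forall>m\<in>{m. v \<in> sd (f m)}. m < n" using finite_nat_set_iff_bounded by metis
  then show ?thesis by (intro exI[of _ n]) (auto simp: not_less[symmetric])
qed

lemma chain_escape_finite:
  assumes f: "chain f" and A: "finite A" "A \<subseteq> V"
  shows "\<exists>n. \<forall>m\<ge>n. sd (f m) \<inter> A = {}"
  using A
proof (induction A)
  case empty
  then show ?case by simp
next
  case (insert a A)
  then obtain n where n: "\<forall>m\<ge>n. sd (f m) \<inter> A = {}" by auto
  obtain n' where n': "\<forall>m\<ge>n'. a \<notin> sd (f m)" using chain_escape[OF f, of a] insert by auto
  show ?case by (rule exI[of _ "max n n'"]) (use n n' in auto)
qed

lemma ray_after:
  assumes r: "ray r" and e: "e \<in> Ed" "al e = r n" "om e = r (Suc n)" and m: "n < m"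
  shows "r m \<in> sd e"
proof -
  obtain k where k: "m = Suc (n + k)" using m less_imp_Suc_add by blast
  have "sd (redge r (n + k)) \<subseteq> sd (redge r n)" using chain_mono[OF chain_redge[OF r]] by simp
  moreover have "r m \<in> sd (redge r (n + k))"
    using redge(3)[OF r, of "n + k"] om_side[of "redge r (n + k)"] k by simp
  ultimately show ?thesis using redge_eqI[OF r e] by auto
qed

lemma ray_before:
  assumes r: "ray r" and m: "m \<le> n"
  shows "r m \<notin> sd (redge r n)"
proof -
  have "sd (redge r n) \<subseteq> sd (redge r m)" using chain_mono[OF chain_redge[OF r] m] .
  moreover have "r m \<notin> sd (redge r m)" using redge[OF r, of m] al_notin_side[of "redge r m"] by simp
  ultimately show ?thesis by blast
qed

lemma ray_neq:
  assumes "ray r" "m < n"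
  shows "r m \<noteq> r n"
  using ray_after[OF assms(1) redge(1-3)[OF assms(1), of m] assms(2)] ray_before[OF assms(1) order_refl, of m]
  by auto

lemma ray_inj: "ray r \<Longrightarrow> r m = r n \<longleftrightarrow> m = n"
  using ray_neq[of r m n] ray_neq[of r n m] by (metis linorder_neqE_nat)

lemma toward_cross:
  assumes r: "ray r" and e: "e \<in> Ed" and n: "r n \<notin> sd e" "r k \<in> sd e" "n \<le> k"
  shows "\<exists>m\<ge>n. r m = al e \<and> r (Suc m) = om e"
  using n(3,2)
proof (induction rule: dec_induct)
  case base
  then show ?case using n by simp
next
  case (step j)
  show ?case
  proof (cases "r j \<in> sd e")
    case True
    then show ?thesis using step by blast
  next
    case False
    then have "redge r j = e" using cross_in[OF e redge(1)[OF r, of j]] redge(2,3)[OF r, of j] step by simp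
    then show ?thesis using redge(2,3)[OF r, of j] step by auto
  qed
qed

text \<open>A ray that visits \<open>sd e\<close> infinitely often and is outside at some time
  crosses \<open>e\<close> later, and after crossing \<open>e\<close> it never comes back.\<close>

lemma toward_iff:
  assumes r: "ray r" and e: "e \<in> Ed"
  shows "tow e r \<longleftrightarrow> \<not> tow (rv e) r"
proof
  assume t: "tow e r"
  show "\<not> tow (rv e) r"
  proof
    assume "tow (rv e) r"
    then obtain n n' where "\<forall>m\<ge>n. r m \<in> sd e" "\<forall>m\<ge>n'. r m \<in> sd (rv e)"
      using t by (auto simp: toward_def)
    then have "r (max n n') \<in> sd e \<and> r (max n n') \<in> sd (rv e)" by auto
    then show False unfolding side_rv[OF e] by blast
  qed
next
  assume "\<not> tow (rv e) r"
  then have *: "\<exists>m\<ge>n. r m \<in> sd e" for n using side_rv[OF e] ray_V[OF r] by (auto simp: toward_def)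
  show "tow e r"
  proof (rule ccontr)
    assume "\<not> tow e r"
    then obtain n where n: "r n \<notin> sd e" by (auto simp: toward_def)
    obtain k where "n \<le> k" "r k \<in> sd e" using * by blast
    then obtain m where "r m = al e" "r (Suc m) = om e" using toward_cross[OF r e n] by blast
    then have "\<forall>j\<ge>Suc m. r j \<in> sd e" using ray_after[OF r e, of m] by auto
    then show False using \<open>\<not> tow e r\<close> unfolding toward_def by blast
  qed
qed

lemma towardI: "ray r \<Longrightarrow> e \<in> Ed \<Longrightarrow> r m = al e \<Longrightarrow> r (Suc m) = om e \<Longrightarrow> tow e r"
  unfolding toward_def using ray_after[of r e m] by (intro exI[of _ "Suc m"]) auto

lemma toward_redge: "ray r \<Longrightarrow> tow (redge r n) r"
  using towardI[of r "redge r n" n] redge[of r n] by simp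

lemma toward_mono: "tow e r \<Longrightarrow> sd e \<subseteq> sd f \<Longrightarrow> tow f r"
  unfolding toward_def by blast

lemma toward_not_disjoint:
  assumes "tow e r" "tow f r"
  shows "sd e \<inter> sd f \<noteq> {}"
proof -
  obtain n n' where "\<forall>m\<ge>n. r m \<in> sd e" "\<forall>m\<ge>n'. r m \<in> sd f" using assms unfolding toward_def by blast
  then have "r (max n n') \<in> sd e \<and> r (max n n') \<in> sd f" by auto
  then show ?thesis by blast
qed

lemma toward_crosses:
  assumes r: "ray r" and e: "e \<in> Ed" "r n \<notin> sd e" "tow e r"
  shows "\<exists>m\<ge>n. r m = al e \<and> r (Suc m) = om e"
proof -
  obtain k where k: "\<forall>m\<ge>k. r m \<in> sd e" using e(3) by (auto simp: toward_def)
  then have "r (max n k) \<in> sd e" by simp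
  then show ?thesis using toward_cross[OF r e(1,2), of "max n k"] by simp
qed

text \<open>Once the chain has escaped \<open>al e\<close>, its connected half-trees cannot straddle
  \<open>e\<close>.\<close>

lemma chain_side_cases:
  assumes f: "chain f" and e: "e \<in> Ed"
  shows "\<exists>n. \<forall>m\<ge>n. sd (f m) \<subseteq> sd e \<or> sd (f m) \<inter> sd e = {}"
proof -
  obtain n where n: "\<forall>m\<ge>n. al e \<notin> sd (f m)" using chain_escape[OF f, of "al e"] e by auto
  have "sd (f m) \<subseteq> sd e \<or> sd (f m) \<inter> sd e = {}" if "n \<le> m" for m
    using conn_subset_side[OF conn_side[OF chain_Ed[OF f, of m]] e] n that by blast
  then show ?thesis by blast
qed

lemma chain_orient:
  assumes f: "chain f" and r: "\<And>n. tow (f n) r" "\<And>n. tow (f n) r'" and e: "e \<in> Ed" "tow e r"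
  shows "tow e r'"
proof -
  obtain n where n: "sd (f n) \<subseteq> sd e \<or> sd (f n) \<inter> sd e = {}" using chain_side_cases[OF f e(1)] by auto
  then have "sd (f n) \<subseteq> sd e" using toward_not_disjoint[OF r(1)[of n] e(2)] by blast
  then show ?thesis using toward_mono r(2) by blast
qed

text \<open>Converts half-trees into rays, with a free choice of the starting vertex; every ray
  needed later is produced here.\<close>

lemma chain_ray:
  assumes f: "chain f" and v: "v \<in> V"
  shows "\<exists>r. ray r \<and> r 0 = v \<and> (\<forall>n. tow (f n) r)"
proof -
  \<comment> \<open>The edge at \<open>u\<close> with a half-tree of the chain beyond it; it exists
    because the chain eventually escapes \<open>u\<close>.\<close>
  define nxt where "nxt u = (SOME e. e \<in> Ed \<and> al e = u \<and> (\<exists>n. sd (f n) \<subseteq> sd e))" for u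
  have nxt: "nxt u \<in> Ed \<and> al (nxt u) = u \<and> (\<exists>n. sd (f n) \<subseteq> sd (nxt u))" if u: "u \<in> V" for u
  proof -
    obtain n where n: "u \<notin> sd (f n)" using chain_escape[OF f u] by auto
    then obtain e where "e \<in> N {u}" "sd (f n) \<subseteq> sd e"
      using exit_superset[OF subtree_singleton[OF u] chain_Ed[OF f, of n]] by auto
    then have "e \<in> Ed \<and> al e = u \<and> (\<exists>n. sd (f n) \<subseteq> sd e)" using N_D[of e "{u}"] by auto
    then show ?thesis unfolding nxt_def by (rule someI)
  qed
  define r where "r = rec_nat v (\<lambda>_ u. om (nxt u))"
  have r0: "r 0 = v" and rS: "\<And>n. r (Suc n) = om (nxt (r n))" by (simp_all add: r_def)
  have rV: "r n \<in> V" for n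
  proof (induction n)
    case 0
    then show ?case using r0 v by simp
  next
    case (Suc n)
    then show ?case using rS nxt[of "r n"] by simp
  qed
  have ray: "ray r"
    unfolding is_ray_def
  proof (intro allI conjI)
    fix n
    let ?e = "nxt (r n)" and ?g = "nxt (r (Suc n))"
    note ne = nxt[OF rV[of n]] and ng = nxt[OF rV[of "Suc n"]]
    show "r n \<in> V" by (rule rV)
    show "\<exists>e\<in>Ed. al e = r n \<and> om e = r (Suc n)" using ne rS by metis
    show "r (Suc (Suc n)) \<noteq> r n"
    proof
      assume "r (Suc (Suc n)) = r n"
      then have g: "?g = rv ?e" using edge_rvI[of ?g ?e] ne ng rS by simp
      \<comment> \<open>Backtracking would put late half-trees of the chain both into
        \<open>sd ?e\<close> and into its complement.\<close>
      obtain i j where "sd (f i) \<subseteq> sd ?e" "sd (f j) \<subseteq> sd ?g" using ne ng by blast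
      then have "om (f (max i j)) \<in> sd ?e \<inter> sd ?g"
        using chain_mono[OF f, of i "max i j"] chain_mono[OF f, of j "max i j"] 
        by (meson IntI max.cobounded1 max.cobounded2 om_side subsetD)
      then show False using side_rv[of ?e] ne g by simp
    qed
  qed
  have re: "redge r k = nxt (r k)" for k
    using redge_eqI[OF ray, of "nxt (r k)" k] nxt[OF rV[of k]] rS by simp
  have "tow (f n) r" for n
  proof -
    \<comment> \<open>Half-trees of the ray are eventually inside or disjoint from
      \<open>sd (f n)\<close>. Disjointness is impossible, since each of them contains a half-tree
      of the chain.\<close>
    obtain k where k: "sd (redge r k) \<subseteq> sd (f n) \<or> sd (redge r k) \<inter> sd (f n) = {}"
      using chain_side_cases[OF chain_redge[OF ray] chain_Ed[OF f, of n]] by auto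
    obtain m where m: "sd (f m) \<subseteq> sd (redge r k)" using nxt[OF rV[of k]] re[of k] by auto
    have "om (f (max m n)) \<in> sd (redge r k) \<inter> sd (f n)"
      using m chain_mono[OF f, of m "max m n"] chain_mono[OF f, of n "max m n"] om_side[of "f (max m n)"] by (meson IntI max.cobounded1 max.cobounded2 subsetD)
    then have "sd (redge r k) \<subseteq> sd (f n)" using k by blast
    then show ?thesis using toward_mono[OF toward_redge[OF ray, of k]] by blast
  qed
  then show ?thesis using ray r0 by blast
qed

section \<open>Ends as orientations of the edges\<close>

lemma ray_equiv_imp_toward:
  assumes "ray_equiv r r'" "tow e r"
  shows "tow e r'"
proof -
  obtain k j where kj: "\<And>n. r (n + k) = r' (n + j)" using assms(1) by (auto simp: ray_equiv_def)
  obtain n where n: "\<forall>m\<ge>n. r m \<in> sd e" using assms(2) by (auto simp: toward_def)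
  have "r' m \<in> sd e" if "m \<ge> n + j" for m
  proof -
    have "r' m = r ((m - j) + k)" using kj[of "m - j"] that by simp
    then show ?thesis using n that by simp
  qed
  then show ?thesis unfolding toward_def by blast
qed

text \<open>From some index on, every edge of \<open>r\<close> is also crossed by \<open>r'\<close>,
  and as \<open>r'\<close> repeats no vertex these crossings are consecutive. Inclusion of the
  orientations in one direction suffices, because each picks one edge of every pair.\<close>

lemma ray_equiv_iff:
  assumes r: "ray r" and r': "ray r'"
  shows "ray_equiv r r' \<longleftrightarrow> (\<forall>e\<in>Ed. tow e r \<longrightarrow> tow e r')"
proof
  assume "ray_equiv r r'"
  then show "\<forall>e\<in>Ed. tow e r \<longrightarrow> tow e r'" using ray_equiv_imp_toward by blast
next
  assume *: "\<forall>e\<in>Ed. tow e r \<longrightarrow> tow e r'"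
  note c = chain_redge[OF r]
  \<comment> \<open>From \<open>n\<close> on, \<open>r' 0\<close> lies outside the half-trees, so
    \<open>r'\<close> must cross the edges of \<open>r\<close> in order to be directed toward
    them.\<close>
  obtain n where n: "\<forall>m\<ge>n. r' 0 \<notin> sd (redge r m)" using chain_escape[OF c ray_V[OF r', of 0]] by blast
  have ex: "\<exists>k. r' k = r m \<and> r' (Suc k) = r (Suc m)" if "m \<ge> n" for m
    using toward_crosses[OF r' redge(1)[OF r, of m], of 0] n that * toward_redge[OF r, of m] redge[OF r, of m]
    by auto
  obtain k where k: "r' k = r n" using ex[of n] by auto
  have "r' (k + i) = r (n + i)" for i
  proof (induction i)
    case 0
    then show ?case using k by simp
  next
    case (Suc i)
    obtain j where j: "r' j = r (n + i)" "r' (Suc j) = r (Suc (n + i))" using ex[of "n + i"] by auto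
    then have "j = k + i" using Suc ray_inj[OF r', of j "k + i"] by simp
    then show ?case using j by simp
  qed
  then show "ray_equiv r r'" unfolding ray_equiv_def by (metis add.commute)
qed

lemma ray_equiv_chain:
  assumes "ray r" "ray r'" "chain f" "\<And>n. tow (f n) r" "\<And>n. tow (f n) r'"
  shows "ray_equiv r r'"
  using ray_equiv_iff[OF assms(1,2)] chain_orient[OF assms(3-5)] by blast

lemma ray_equiv_refl: "ray_equiv r r"
  unfolding ray_equiv_def by auto

lemma ray_equiv_sym: "ray_equiv r r' \<Longrightarrow> ray_equiv r' r"
  unfolding ray_equiv_def by metis

lemma ray_equiv_trans:
  assumes "ray r" "ray r'" "ray r''" "ray_equiv r r'" "ray_equiv r' r''"
  shows "ray_equiv r r''"
  using assms by (simp add: ray_equiv_iff)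

lemma end_pt_eq_iff:
  assumes "ray r" "ray r'"
  shows "end_pt r = end_pt r' \<longleftrightarrow> ray_equiv r r'"
proof
  assume "end_pt r = end_pt r'"
  moreover have "r' \<in> end_pt r'" using assms by (simp add: end_of_def ray_equiv_refl)
  ultimately have "r' \<in> end_pt r" by simp
  then show "ray_equiv r r'" by (simp add: end_of_def)
next
  assume eq: "ray_equiv r r'"
  have "ray_equiv r s \<longleftrightarrow> ray_equiv r' s" if "ray s" for s
    using ray_equiv_trans[OF assms(1,2) that eq]
      ray_equiv_trans[OF assms(2,1) that ray_equiv_sym[OF eq]] by blast
  then show "end_pt r = end_pt r'" unfolding end_of_def by blast
qed

lemma in_end_pt: "r' \<in> end_pt r \<longleftrightarrow> ray r' \<and> ray_equiv r r'"
  by (simp add: end_of_def)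

lemma ends_iff: "\<xi> \<in> ends V Ed al om \<longleftrightarrow> (\<exists>r. ray r \<and> \<xi> = end_pt r)"
  by (auto simp: ends_def)

lemma ray_exit_ex:
  assumes W: "finite W" "subtree W" and r: "ray r"
  shows "\<exists>e\<in>N W. tow e r"
proof -
  obtain n where n: "sd (redge r n) \<inter> W = {}"
    using chain_escape_finite[OF chain_redge[OF r] W(1) subtreeD(2)[OF W(2)]] by auto
  obtain e where "e \<in> N W" "sd (redge r n) \<subseteq> sd e" using exit_superset[OF W(2) redge(1)[OF r] n] by blast
  then show ?thesis using toward_mono[OF toward_redge[OF r, of n]] by blast
qed

lemma ray_exit_unique:
  assumes "subtree W" "e \<in> N W" "f \<in> N W" "tow e r" "tow f r"
  shows "e = f"
  using exit_unique[OF assms(1-3)] toward_not_disjoint[OF assms(4,5)] by blast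

text \<open>Translates the clause of \<open>G_set\<close> about ends, which asks for a
  representative leaving \<open>W\<close> at once, into a statement about the orientation of any
  representative.\<close>

lemma end_through_iff:
  assumes W: "subtree W" and r: "ray r"
  shows "(\<exists>r'\<in>end_pt r. r' 0 \<in> W \<and> (\<exists>e\<in>Ed. al e = r' 0 \<and> om e = r' 1 \<and> om e \<notin> W \<and> Q e)) \<longleftrightarrow>
    (\<exists>e\<in>N W. Q e \<and> tow e r)" (is "?L \<longleftrightarrow> ?R")
proof
  assume ?L
  then obtain r' e where r': "ray r'" "ray_equiv r r'" "r' 0 \<in> W"
    and e: "e \<in> Ed" "al e = r' 0" "om e = r' 1" "om e \<notin> W" "Q e"
    by (auto simp: in_end_pt)
  then have "tow e r'" using towardI[of r' e 0] by simp
  then have "tow e r" using r' ray_equiv_sym ray_equiv_imp_toward by blast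
  moreover have "e \<in> N W" using e r' by (simp add: N_def)
  ultimately show ?R using e by blast
next
  assume ?R
  then obtain e where e: "e \<in> N W" "Q e" "tow e r" by blast
  then have e': "e \<in> Ed" "al e \<in> W" "om e \<notin> W" using N_D[of e W] by simp_all
  obtain r' where r': "ray r'" "r' 0 = al e" "\<And>n. tow (redge r n) r'"
    using chain_ray[OF chain_redge[OF r], of "al e"] e' by auto
  have eq: "ray_equiv r r'"
    using ray_equiv_chain[OF r r'(1) chain_redge[OF r]] toward_redge[OF r] r'(3) by blast
  have "tow e r'" using ray_equiv_imp_toward[OF eq e(3)] .
  then obtain m where m: "r' m = al e" "r' (Suc m) = om e"
    using toward_crosses[OF r'(1) e'(1), of 0] r'(2) e'(1) by auto
  \<comment> \<open>The ray restarted at \<open>al e\<close> visits that vertex only at time 0, so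
    it leaves through \<open>e\<close> immediately.\<close>
  then have "m = 0" using ray_inj[OF r'(1), of m 0] r'(2) by simp
  then show ?L using m e e' r' eq by (intro bexI[of _ r']) (auto simp: in_end_pt)
qed

end

section \<open>Compact metrizable spaces\<close>

text \<open>Finite intersections of the given sets form a base. For \<open>x\<close> in an open
  \<open>U\<close>, finitely many of the sets \<open>h y\<close> cover the compact complement of
  \<open>U\<close>, and the intersection of the matching \<open>g y\<close> is a neighbourhood of
  \<open>x\<close> disjoint from them.\<close>

lemma countably_separated_imp_second_countable:
  assumes X: "compact_space X" and G: "countable \<G>" "\<And>G. G \<in> \<G> \<Longrightarrow> openin X G"
    and sep: "\<And>x y. x \<in> topspace X \<Longrightarrow> y \<in> topspace X \<Longrightarrow> x \<noteq> y \<Longrightarrow>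
      \<exists>G\<in>\<G>. \<exists>H\<in>\<G>. x \<in> G \<and> y \<in> H \<and> disjnt G H"
  shows "second_countable X"
  unfolding second_countable_def
proof (intro exI conjI allI impI ballI)
  let ?B = "(\<lambda>F. topspace X \<inter> \<Inter>F) ` {F. finite F \<and> F \<subseteq> \<G>}"
  show "countable ?B" using countable_Collect_finite_subset[OF G(1)] by (rule countable_image)
  have *: "openin X (topspace X \<inter> \<Inter>F)" if "finite F" "F \<subseteq> \<G>" for F
    using that
  proof (induction F)
    case empty
    then show ?case by simp
  next
    case (insert A F)
    then have "openin X A" "openin X (topspace X \<inter> \<Inter>F)" using G(2) by blast+
    then have "openin X (A \<inter> (topspace X \<inter> \<Inter>F))" by (rule openin_Int)
    moreover have "topspace X \<inter> \<Inter>(insert A F) = A \<inter> (topspace X \<inter> \<Inter>F)" by auto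
    ultimately show ?case by simp
  qed
  then show "openin X B" if "B \<in> ?B" for B using that by auto
  show "\<exists>B\<in>?B. x \<in> B \<and> B \<subseteq> U" if U: "openin X U \<and> x \<in> U" for U x
  proof -
    have x: "x \<in> topspace X" using U openin_subset by blast
    let ?C = "topspace X - U"
    have "compactin X ?C" using U X by (intro closedin_compact_space) auto
    moreover have "\<exists>G H. G \<in> \<G> \<and> H \<in> \<G> \<and> x \<in> G \<and> y \<in> H \<and> disjnt G H" if "y \<in> ?C" for y
      using sep[OF x, of y] that U by blast
    then obtain g h where gh: "\<And>y. y \<in> ?C \<Longrightarrow> g y \<in> \<G> \<and> h y \<in> \<G> \<and> x \<in> g y \<and> y \<in> h y \<and> disjnt (g y) (h y)"
      by metis
    ultimately obtain F where F: "finite F" "F \<subseteq> h ` ?C" "?C \<subseteq> \<Union>F"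
      using G(2) unfolding compactin_def by (elim conjE allE[of _ "h ` ?C"]) auto
    then obtain D where D: "finite D" "D \<subseteq> ?C" "F = h ` D" by (meson finite_subset_image)
    have "topspace X \<inter> \<Inter>(g ` D) \<subseteq> U"
    proof
      fix z assume z: "z \<in> topspace X \<inter> \<Inter>(g ` D)"
      show "z \<in> U"
      proof (rule ccontr)
        assume "z \<notin> U"
        then obtain y where "y \<in> D" "z \<in> h y" using z F D by blast
        then show False using z gh[of y] D by (auto simp: disjnt_iff)
      qed
    qed
    moreover have "x \<in> topspace X \<inter> \<Inter>(g ` D)" using x gh D by blast
    moreover have "topspace X \<inter> \<Inter>(g ` D) \<in> ?B" using D gh by blast
    ultimately show ?thesis by (metis (no_types, lifting))
  qed
qed

text \<open>Urysohn metrization: one Urysohn function for each pair of base members with disjoint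
  closures gives a continuous injection into a countable power of the reals, which is an embedding
  by compactness.\<close>

lemma compact_Hausdorff_second_countable_imp_metrizable:
  assumes X: "compact_space X" "Hausdorff_space X" "second_countable X"
  shows "metrizable_space X"
proof -
  obtain \<B> where \<B>: "countable \<B> \<and> (\<forall>V\<in>\<B>. openin X V) \<and>
      (\<forall>U x. openin X U \<and> x \<in> U \<longrightarrow> (\<exists>V\<in>\<B>. x \<in> V \<and> V \<subseteq> U))"
    using X(3) unfolding second_countable_def by (elim exE)
  then have B: "countable \<B>" "\<And>B. B \<in> \<B> \<Longrightarrow> openin X B" by simp_all
  have base: "\<exists>B\<in>\<B>. x \<in> B \<and> B \<subseteq> U" if "openin X U" "x \<in> U" for U x
    using \<B> that by simp
  have normal: "normal_space X" using X compact_Hausdorff_or_regular_imp_normal_space by blast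
  have nb: "\<exists>B\<in>\<B>. x \<in> B \<and> X closure_of B \<subseteq> U" if U: "openin X U" "x \<in> U" for U x
  proof -
    have "closedin X {x}" using U X openin_subset by (intro closedin_Hausdorff_singleton) auto
    then obtain V where V: "openin X V" "{x} \<subseteq> V" "X closure_of V \<subseteq> U"
      using normal U unfolding normal_space_alt by (metis empty_subsetI insert_subset)
    then obtain B where B': "B \<in> \<B>" "x \<in> B" "B \<subseteq> V" using base[OF V(1), of x] by auto
    have "X closure_of B \<subseteq> U" using closure_of_mono[OF B'(3), of X] V(3) by (rule order_trans)
    then show ?thesis using B' by (intro bexI[of _ B] conjI)
  qed
  define P where "P = {p \<in> \<B> \<times> \<B>. disjnt (X closure_of (fst p)) (X closure_of (snd p))}"
  have "countable P" unfolding P_def using B(1) by (intro countable_subset[OF _ countable_SIGMA[of \<B> "\<lambda>_. \<B>"]]) auto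
  have "\<exists>f. continuous_map X euclideanreal f \<and> f ` (X closure_of (fst p)) \<subseteq> {0} \<and> f ` (X closure_of (snd p)) \<subseteq> {1}"
    if "p \<in> P" for p
  proof -
    have "disjnt (X closure_of (fst p)) (X closure_of (snd p))" using that by (simp add: P_def)
    then obtain f where f: "continuous_map X (top_of_set {0..1::real}) f"
      "f ` (X closure_of (fst p)) \<subseteq> {0}" "f ` (X closure_of (snd p)) \<subseteq> {1}"
      using Urysohn_lemma[OF normal closedin_closure_of closedin_closure_of, of "fst p" "snd p" 0 1] by auto
    moreover have "continuous_map X euclideanreal f" using f(1) continuous_map_in_subtopology by blast
    ultimately show ?thesis by blast
  qed
  then obtain f where f: "\<And>p. p \<in> P \<Longrightarrow> continuous_map X euclideanreal (f p) \<and>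
      f p ` (X closure_of (fst p)) \<subseteq> {0} \<and> f p ` (X closure_of (snd p)) \<subseteq> {1}"
    by metis
  define h where "h x = (\<lambda>p\<in>P. f p x)" for x
  let ?Y = "product_topology (\<lambda>_. euclideanreal) P"
  have h: "continuous_map X ?Y h"
    unfolding continuous_map_componentwise h_def using f by (auto simp: extensional_def)
  have inj: "inj_on h (topspace X)"
  proof (rule inj_onI, rule ccontr)
    fix x y assume xy: "x \<in> topspace X" "y \<in> topspace X" "h x = h y" "x \<noteq> y"
    then obtain U V where U: "openin X U" "openin X V" "x \<in> U" "y \<in> V" "disjnt U V"
      using X(2) unfolding Hausdorff_space_def by blast
    obtain A where A: "A \<in> \<B>" "x \<in> A" "X closure_of A \<subseteq> U" using nb U by blast
    obtain C where C: "C \<in> \<B>" "y \<in> C" "X closure_of C \<subseteq> V" using nb U by blast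
    have p: "(A, C) \<in> P" using A C U by (auto simp: P_def disjnt_iff)
    have "x \<in> X closure_of A" "y \<in> X closure_of C"
      using A C xy B(2) by (meson closure_of_subset openin_subset subsetD)+
    then have "f (A, C) x = 0" "f (A, C) y = 1" using f[OF p] by auto
    moreover have "f (A, C) x = f (A, C) y" using xy(3) p unfolding h_def by (metis restrict_apply')
    ultimately show False by simp
  qed
  have "Hausdorff_space ?Y" by (simp add: Hausdorff_space_product_topology)
  then have "embedding_map X ?Y h" using h X(1) inj continuous_imp_embedding_map by blast
  then have "X homeomorphic_space (subtopology ?Y (h ` topspace X))" by (rule embedding_map_imp_homeomorphic_space)
  moreover have "metrizable_space ?Y"
    using \<open>countable P\<close> by (simp add: metrizable_space_product_topology metrizable_space_euclidean countable_Collect)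
  ultimately show ?thesis using homeomorphic_metrizable_space metrizable_space_subtopology by blast
qed

section \<open>Compact metric spaces: separating families and diameters\<close>

lemma mtopology_of_exists:
  assumes "metrizable_space X"
  shows "\<exists>m. mtopology_of m = X"
  using assms unfolding metrizable_space_def by (metis Metric_space.mtopology_of)

lemma compact_metric_second_countable:
  assumes "compact_space (mtopology_of m)"
  shows "second_countable (mtopology_of m)"
proof -
  interpret Metric_space "mspace m" "mdist m" by (rule Metric_space_mspace_mdist)
  have top: "mtopology_of m = mtopology" by (simp add: mtopology_of_def)
  have "mtotally_bounded (mspace m)" using assms compact_space_eq_mcomplete_mtotally_bounded by (simp add: top)
  then have "\<exists>K. finite K \<and> mspace m \<subseteq> (\<Union>x\<in>K. mball x (inverse (Suc n)))" for n
    unfolding mtotally_bounded_def by (metis inverse_positive_iff_positive of_nat_0_less_iff zero_less_Suc)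
  then obtain k where k: "\<And>n. finite (k n)" "\<And>n. mspace m \<subseteq> (\<Union>x\<in>k n. mball x (inverse (Suc n)))" by metis
  let ?B = "\<Union>n. (\<lambda>x. mball x (inverse (Suc n))) ` k n"
  have "countable ?B" using k(1) by (auto intro: countable_finite)
  moreover have "\<exists>B\<in>?B. x \<in> B \<and> B \<subseteq> U" if U: "openin mtopology U" "x \<in> U" for U x
  proof -
    have x: "x \<in> mspace m" using U openin_subset by fastforce
    obtain r where r: "r > 0" "mball x r \<subseteq> U" using U openin_mtopology by blast
    \<comment> \<open>A ball of radius below \<open>r / 2\<close> that contains \<open>x\<close>
      stays inside \<open>mball x r\<close>.\<close>
    obtain n where n: "inverse (Suc n) < r / 2" using reals_Archimedean[of "r / 2"] r by auto
    obtain c where c: "c \<in> k n" "x \<in> mball c (inverse (Suc n))" using k(2)[of n] x by blast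
    have "mball c (inverse (Suc n)) \<subseteq> mball x r"
    proof
      fix z assume z: "z \<in> mball c (inverse (Suc n))"
      have "mdist m x z \<le> mdist m x c + mdist m c z" using z c x by (intro triangle) auto
      then show "z \<in> mball x r" using z c x n by (auto simp: commute)
    qed
    then show ?thesis using c r by blast
  qed
  ultimately show ?thesis unfolding second_countable_def top
    by (intro exI[of _ ?B]) auto
qed

text \<open>Closed sets have to be separated, not just points, because the sets to be separated in a
  vertex space will be fibres of points of the limit. Hence finite unions of base members, fitted
  between a closed set and a neighbourhood of it by compactness.\<close>

lemma second_countable_separating_family:
  assumes X: "compact_space X" "Hausdorff_space X" "second_countable X"
  shows "\<exists>\<B>. countable \<B> \<and> (\<forall>B\<in>\<B>. openin X B) \<and> (\<forall>A C. closedin X A \<and> closedin X C \<and> disjnt A C \<longrightarrow>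
    (\<exists>B\<in>\<B>. \<exists>D\<in>\<B>. A \<subseteq> B \<and> C \<subseteq> D \<and> disjnt B D))"
proof -
  obtain \<B> where \<B>: "countable \<B> \<and> (\<forall>V\<in>\<B>. openin X V) \<and>
      (\<forall>U x. openin X U \<and> x \<in> U \<longrightarrow> (\<exists>V\<in>\<B>. x \<in> V \<and> V \<subseteq> U))"
    using X(3) unfolding second_countable_def by (elim exE)
  then have B: "countable \<B>" "\<And>B. B \<in> \<B> \<Longrightarrow> openin X B" by simp_all
  have base: "\<exists>B\<in>\<B>. x \<in> B \<and> B \<subseteq> U" if "openin X U" "x \<in> U" for U x
    using \<B> that by simp
  let ?D = "Union ` {F. finite F \<and> F \<subseteq> \<B>}"
  have between: "\<exists>B\<in>?D. A \<subseteq> B \<and> B \<subseteq> U" if A: "closedin X A" "openin X U" "A \<subseteq> U" for A U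
  proof -
    have "compactin X A" using A X closedin_compact_space by blast
    moreover have "A \<subseteq> \<Union>{B \<in> \<B>. B \<subseteq> U}" using base[OF A(2)] A(3) by blast
    ultimately obtain F where "finite F" "F \<subseteq> {B \<in> \<B>. B \<subseteq> U}" "A \<subseteq> \<Union>F"
      using B(2) unfolding compactin_def by (elim conjE allE[of _ "{B \<in> \<B>. B \<subseteq> U}"]) auto
    then show ?thesis by blast
  qed
  show ?thesis
  proof (intro exI[of _ ?D] conjI allI impI ballI)
    show "countable ?D" using countable_Collect_finite_subset[OF B(1)] by (rule countable_image)
    show "openin X B" if "B \<in> ?D" for B using that B(2) by auto
    fix A C assume AC: "closedin X A \<and> closedin X C \<and> disjnt A C"
    have "normal_space X" using X compact_Hausdorff_or_regular_imp_normal_space by blast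
    then have "\<exists>U V. openin X U \<and> openin X V \<and> A \<subseteq> U \<and> C \<subseteq> V \<and> disjnt U V"
      using AC unfolding normal_space_def by (elim allE[of _ A] allE[of _ C] impE)
    then obtain U V where UV: "openin X U" "openin X V" "A \<subseteq> U" "C \<subseteq> V" "disjnt U V"
      by (elim exE conjE)
    obtain B where B': "B \<in> ?D" "A \<subseteq> B" "B \<subseteq> U" using between[of A U] AC UV by auto
    obtain D where D': "D \<in> ?D" "C \<subseteq> D" "D \<subseteq> V" using between[of C V] AC UV by auto
    have "disjnt B D" using UV(5) B'(3) D'(3) by (meson disjnt_subset1 disjnt_subset2)
    then show "\<exists>B\<in>?D. \<exists>D\<in>?D. A \<subseteq> B \<and> C \<subseteq> D \<and> disjnt B D"
      using B' D' by (intro bexI[of _ B] bexI[of _ D] conjI)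
  qed
qed

lemma mdist_le_mdiam:
  assumes "compactin (mtopology_of m) S" "x \<in> S" "y \<in> S"
  shows "mdist m x y \<le> mdiam m S"
proof -
  interpret Metric_space "mspace m" "mdist m" by (rule Metric_space_mspace_mdist)
  have "mbounded S" using assms(1) compactin_imp_mbounded by (simp add: mtopology_of_def)
  then obtain B where "\<forall>x\<in>S. \<forall>y\<in>S. mdist m x y \<le> B" by (auto simp: mbounded_alt)
  then have "bdd_above {mdist m x y | x y. x \<in> S \<and> y \<in> S}" by (intro bdd_aboveI[of _ B]) auto
  then show ?thesis unfolding mdiam_def using assms(2,3) by (intro cSup_upper) auto
qed

lemma mdiam_le:
  assumes "S \<noteq> {}" "\<And>x y. x \<in> S \<Longrightarrow> y \<in> S \<Longrightarrow> mdist m x y \<le> c"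
  shows "mdiam m S \<le> c"
proof -
  obtain x where "x \<in> S" using assms(1) by blast
  then have "{mdist m x y | x y. x \<in> S \<and> y \<in> S} \<noteq> {}" by blast
  then show ?thesis unfolding mdiam_def by (rule cSup_least) (use assms(2) in auto)
qed

text \<open>Upper semicontinuity of the decomposition into the members of a null family and points.\<close>
lemma closedin_null_saturation:
  assumes C: "closedin (mtopology_of m) C"
    and A: "\<And>e. e \<in> E \<Longrightarrow> compactin (mtopology_of m) (A e)" "\<And>e. e \<in> E \<Longrightarrow> A e \<inter> C \<noteq> {}"
    and null: "\<And>\<epsilon>. \<epsilon> > 0 \<Longrightarrow> finite {e \<in> E. mdiam m (A e) \<ge> \<epsilon>}"
  shows "closedin (mtopology_of m) (C \<union> (\<Union>e\<in>E. A e))"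
proof -
  interpret Metric_space "mspace m" "mdist m" by (rule Metric_space_mspace_mdist)
  have top: "mtopology_of m = mtopology" by (simp add: mtopology_of_def)
  have AM: "A e \<subseteq> mspace m" if "e \<in> E" for e using compactin_subset_topspace[OF A(1)[OF that]] by simp
  have CM: "C \<subseteq> mspace m" using C closedin_subset by fastforce
  show ?thesis unfolding top closedin_metric
  proof (intro conjI allI impI)
    show "C \<union> (\<Union>e\<in>E. A e) \<subseteq> mspace m" using AM CM by blast
    fix y assume y: "y \<in> mspace m - (C \<union> (\<Union>e\<in>E. A e))"
    then obtain r where r: "r > 0" "disjnt C (mball y r)" using C unfolding top closedin_metric by blast
    \<comment> \<open>Only finitely many members are this large, and their union is closed. A
      smaller member within \<open>r / 2\<close> of \<open>y\<close> would bring a point of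
      \<open>C\<close> within \<open>r\<close> of \<open>y\<close>.\<close>
    let ?E = "{e \<in> E. mdiam m (A e) \<ge> r / 2}"
    have "closedin mtopology (\<Union>e\<in>?E. A e)"
      using null[of "r / 2"] r A(1) compactin_imp_closedin[of mtopology] Hausdorff_space_mtopology
      unfolding top by (intro closedin_Union) auto
    then obtain s where s: "s > 0" "disjnt (\<Union>e\<in>?E. A e) (mball y s)"
      using y unfolding closedin_metric by blast
    have "disjnt (C \<union> (\<Union>e\<in>E. A e)) (mball y (min s (r / 2)))"
      unfolding disjnt_iff
    proof (intro allI notI)
      fix z assume z: "z \<in> C \<union> (\<Union>e\<in>E. A e) \<and> z \<in> mball y (min s (r / 2))"
      then have zr: "z \<in> mball y (r / 2)" "z \<in> mball y s" by auto
      then have "z \<in> mball y r" using r by auto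
      then have "z \<notin> C" using r by (auto simp: disjnt_iff)
      then obtain e where e: "e \<in> E" "z \<in> A e" using z by blast
      have "e \<notin> ?E" using s zr e unfolding disjnt_iff by blast
      then have small: "mdiam m (A e) < r / 2" using e by simp
      obtain c where c: "c \<in> A e" "c \<in> C" using A(2)[OF e(1)] by blast
      have "mdist m z c < r / 2" using mdist_le_mdiam[OF A(1)[OF e(1)] e(2) c(1)] small by simp
      moreover have "mdist m y c \<le> mdist m y z + mdist m z c" using zr c CM by (intro triangle) auto
      ultimately have "c \<in> mball y r" using zr c CM by auto
      then show False using c r by (auto simp: disjnt_iff)
    qed
    then show "\<exists>r>0. disjnt (C \<union> (\<Union>e\<in>E. A e)) (mball y r)" using s r by (intro exI[of _ "min s (r / 2)"]) auto
  qed
qed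

section \<open>The limit of a tree system\<close>

locale tree_sys =
  fixes V :: "'v set" and Ed :: "'e set" and al om :: "'e \<Rightarrow> 'v" and rv :: "'e \<Rightarrow> 'e"
    and K :: "'v \<Rightarrow> 'a metric" and Sg :: "'e \<Rightarrow> 'a set" and ph :: "'e \<Rightarrow> 'a \<Rightarrow> 'a"
  assumes system: "tree_system V Ed al om rv K Sg ph"
begin

sublocale tree V Ed al om rv
  using system by unfold_locales (simp add: tree_system_def)

abbreviation Kt :: "'v \<Rightarrow> 'a topology" where "Kt t \<equiv> mtopology_of (K t)"
abbreviation cl :: "'v \<times> 'a \<Rightarrow> ('v \<times> 'a) set" where "cl \<equiv> cls Ed al om Sg ph"
abbreviation lim :: "('v, 'a) lpt topology" where "lim \<equiv> lim_top V Ed al om Kt Sg ph"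
abbreviation pts :: "('v, 'a) lpt set" where "pts \<equiv> lim_points V Ed al om Kt Sg ph"
abbreviation osat :: "'v set \<Rightarrow> ('v \<times> 'a) set \<Rightarrow> bool" where "osat \<equiv> open_saturated V Ed al om Kt Sg ph"
abbreviation G :: "'v set \<Rightarrow> ('v \<times> 'a) set \<Rightarrow> ('v, 'a) lpt set" where "G \<equiv> G_set V Ed al om Kt Sg ph"
abbreviation basis :: "('v, 'a) lpt set set" where "basis \<equiv> lim_basis V Ed al om Kt Sg ph"

definition pt :: "'v \<Rightarrow> 'a \<Rightarrow> ('v, 'a) lpt" where "pt t x = Inl (cl (t, x))"

lemma compact_K: "t \<in> V \<Longrightarrow> compact_space (Kt t)"
  using system by (simp add: tree_system_def)

lemma Sg_nonempty: "e \<in> Ed \<Longrightarrow> Sg e \<noteq> {}"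
  using system by (simp add: tree_system_def)

lemma Sg_compact: "e \<in> Ed \<Longrightarrow> compactin (Kt (al e)) (Sg e)"
  using system by (simp add: tree_system_def)

lemma Sg_subset: "e \<in> Ed \<Longrightarrow> Sg e \<subseteq> mspace (K (al e))"
  using compactin_subset_topspace[OF Sg_compact] by simp

lemma Hausdorff_K: "Hausdorff_space (Kt t)"
  by (simp add: mtopology_of_def Metric_space.Hausdorff_space_mtopology Metric_space_mspace_mdist)

lemma Sg_closed: "e \<in> Ed \<Longrightarrow> closedin (Kt (al e)) (Sg e)"
  using compactin_imp_closedin[OF Hausdorff_K Sg_compact] .

lemma ph_homeomorphic: "e \<in> Ed \<Longrightarrow>
    homeomorphic_map (subtopology (Kt (al e)) (Sg e)) (subtopology (Kt (om e)) (Sg (rv e))) (ph e)"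
  using system by (simp add: tree_system_def)

lemma ph_image: "e \<in> Ed \<Longrightarrow> ph e ` Sg e = Sg (rv e)"
  using homeomorphic_imp_surjective_map[OF ph_homeomorphic[of e]] Sg_subset[of e] Sg_subset[of "rv e"]
  by (simp add: Int_absorb1)

lemma ph_Sg: "e \<in> Ed \<Longrightarrow> x \<in> Sg e \<Longrightarrow> ph e x \<in> Sg (rv e)"
  using ph_image by blast

lemma ph_rv: "e \<in> Ed \<Longrightarrow> x \<in> Sg e \<Longrightarrow> ph (rv e) (ph e x) = x"
  using system by (simp add: tree_system_def)

lemma ph_mspace: "e \<in> Ed \<Longrightarrow> x \<in> Sg e \<Longrightarrow> ph e x \<in> mspace (K (om e))"
  using ph_Sg[of e x] Sg_subset[of "rv e"] by auto

lemma Sg_unique: "e \<in> Ed \<Longrightarrow> f \<in> Ed \<Longrightarrow> al e = al f \<Longrightarrow> x \<in> Sg e \<Longrightarrow> x \<in> Sg f \<Longrightarrow> e = f"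
proof (rule ccontr)
  assume *: "e \<in> Ed" "f \<in> Ed" "al e = al f" "x \<in> Sg e" "x \<in> Sg f" "e \<noteq> f"
  have "\<forall>t\<in>V. \<forall>e\<in>Ed. \<forall>e'\<in>Ed. al e = t \<and> al e' = t \<and> e \<noteq> e' \<longrightarrow> Sg e \<inter> Sg e' = {}"
    using system by (simp add: tree_system_def)
  then have "Sg e \<inter> Sg f = {}" using * al_V[of f] by metis
  then show False using * by blast
qed

lemma Sg_null: "t \<in> V \<Longrightarrow> \<epsilon> > 0 \<Longrightarrow> finite {e \<in> Ed. al e = t \<and> mdiam (K t) (Sg e) \<ge> \<epsilon>}"
  using system by (simp add: tree_system_def)

section \<open>Classes of the glueing relation\<close>

lemma converse_glue: "(glue Ed al om Sg ph)\<inverse> = glue Ed al om Sg ph"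
proof -
  have "(q, p) \<in> glue Ed al om Sg ph" if pq: "(p, q) \<in> glue Ed al om Sg ph" for p q
  proof -
    obtain e x where e: "e \<in> Ed" "x \<in> Sg e" "p = (al e, x)" "q = (om e, ph e x)"
      using pq unfolding glue_def by auto
    then have "q = (al (rv e), ph e x)" "p = (om (rv e), ph (rv e) (ph e x))"
      using ph_rv[of e x] by simp_all
    then show ?thesis using ph_Sg[OF e(1,2)] rv_Ed[OF e(1)] unfolding glue_def by blast
  qed
  then show ?thesis by auto
qed

lemma cl_mem_iff: "(s, y) \<in> cl (t, x) \<longleftrightarrow>
    (s, y) = (t, x) \<or> (\<exists>e\<in>Ed. al e = t \<and> om e = s \<and> x \<in> Sg e \<and> y = ph e x)" (is "?L \<longleftrightarrow> ?R")
proof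
  assume ?R
  then have "(s, y) = (t, x) \<or> ((t, x), (s, y)) \<in> glue Ed al om Sg ph" by (auto simp: glue_def)
  then show ?L by (auto simp: cls_def)
next
  assume ?L
  then have "((t, x), (s, y)) \<in> (glue Ed al om Sg ph)\<^sup>*" by (simp add: cls_def converse_glue)
  then show ?R
  proof (induction "(s, y)" arbitrary: s y rule: rtrancl_induct)
    case base
    then show ?case by simp
  next
    case (step z)
    obtain s' y' where z: "z = (s', y')" by (cases z)
    obtain e where e: "e \<in> Ed" "y' \<in> Sg e" "s' = al e" "s = om e" "y = ph e y'"
      using step.hyps(2) z by (auto simp: glue_def)
    consider "(s', y') = (t, x)" | f where "f \<in> Ed" "al f = t" "om f = s'" "x \<in> Sg f" "y' = ph f x"
      using step.hyps(3)[OF z] by auto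
    then show ?case
    proof cases
      case 1
      then show ?thesis using e by auto
    next
      case 2
      \<comment> \<open>The intermediate point lies in both \<open>Sg (rv f)\<close> and
        \<open>Sg e\<close>, so the second glueing undoes the first.\<close>
      then have "rv f = e" using Sg_unique[of "rv f" e y'] ph_Sg[of f x] e by simp
      then show ?thesis using 2 e ph_rv[of f x] by auto
    qed
  qed
qed

lemma cl_eq_iff: "cl p = cl q \<longleftrightarrow> q \<in> cl p"
proof -
  let ?R = "(glue Ed al om Sg ph)\<^sup>*"
  have c: "cl a = ?R `` {a}" for a by (simp add: cls_def converse_glue)
  have s: "sym ?R" by (rule sym_rtrancl) (simp add: sym_conv_converse_eq converse_glue)
  show ?thesis
  proof
    assume "cl p = cl q"
    then show "q \<in> cl p" unfolding c by blast
  next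
    assume "q \<in> cl p"
    then have pq: "(p, q) \<in> ?R" by (simp add: c)
    then have qp: "(q, p) \<in> ?R" using s by (rule symD[rotated])
    show "cl p = cl q" unfolding c
    proof (intro set_eqI iffI)
      fix z
      show "z \<in> ?R `` {q}" if "z \<in> ?R `` {p}" using that rtrancl_trans[OF qp] by simp
      show "z \<in> ?R `` {p}" if "z \<in> ?R `` {q}" using that rtrancl_trans[OF pq] by simp
    qed
  qed
qed

lemma pt_eq_iff: "pt t x = pt s y \<longleftrightarrow>
    (s = t \<and> y = x) \<or> (\<exists>e\<in>Ed. al e = t \<and> om e = s \<and> x \<in> Sg e \<and> y = ph e x)"
  by (simp add: pt_def cl_eq_iff cl_mem_iff)

lemma pt_glue: "e \<in> Ed \<Longrightarrow> x \<in> Sg e \<Longrightarrow> pt (al e) x = pt (om e) (ph e x)"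
  using pt_eq_iff by blast

lemma pt_inj: "pt t x = pt t y \<Longrightarrow> x = y"
  using pt_eq_iff[of t x t y] al_neq_om by metis

lemma pts_cases:
  assumes "p \<in> pts"
  obtains t x where "t \<in> V" "x \<in> mspace (K t)" "p = pt t x" | r where "ray r" "p = Inr (end_pt r)"
  using assms by (auto simp: lim_points_def disj_union_def pt_def ends_iff)

lemma pt_in_pts: "t \<in> V \<Longrightarrow> x \<in> mspace (K t) \<Longrightarrow> pt t x \<in> pts"
  by (auto simp: lim_points_def disj_union_def pt_def)

lemma end_in_pts: "ray r \<Longrightarrow> Inr (end_pt r) \<in> pts"
  unfolding lim_points_def using ends_iff by blast

lemma osat_subset: "osat W U \<Longrightarrow> (t, x) \<in> U \<Longrightarrow> t \<in> W \<and> x \<in> mspace (K t)"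
  unfolding open_saturated_def disj_union_def by auto

lemma osat_glue: "osat W U \<Longrightarrow> e \<in> Ed \<Longrightarrow> al e \<in> W \<Longrightarrow> om e \<in> W \<Longrightarrow> x \<in> Sg e \<Longrightarrow>
    (al e, x) \<in> U \<longleftrightarrow> (om e, ph e x) \<in> U"
  by (auto simp: open_saturated_def sub_edges_def)

lemma osat_exit: "osat W U \<Longrightarrow> e \<in> N W \<Longrightarrow> x \<in> Sg e \<Longrightarrow> (al e, x) \<in> U \<Longrightarrow> Sg e \<subseteq> slice U (al e)"
  by (auto simp: open_saturated_def N_def slice_def)

text \<open>\<open>G_set\<close> is a set of classes, so a class might be in it because of another
  representative. The right-hand side is therefore shown to be invariant under glueing.\<close>

lemma pt_in_G_iff:
  assumes W: "subtree W" and U: "osat W U" and t: "t \<in> V" "x \<in> mspace (K t)"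
  shows "pt t x \<in> G W U \<longleftrightarrow> (t, x) \<in> U \<or> (\<exists>e\<in>N W. Sg e \<subseteq> slice U (al e) \<and> t \<in> sd e)"
proof -
  define R where "R s y \<longleftrightarrow> (s, y) \<in> U \<or> (\<exists>e\<in>N W. Sg e \<subseteq> slice U (al e) \<and> s \<in> sd e)" for s y
  have inv: "R (om g) (ph g y)" if g: "g \<in> Ed" "y \<in> Sg g" and R: "R (al g) y" for g y
  proof (cases "(al g, y) \<in> U")
    case True
    then have a: "al g \<in> W" using osat_subset[OF U] by blast
    show ?thesis
    proof (cases "om g \<in> W")
      case om: True
      then show ?thesis using osat_glue[OF U g(1) a om g(2)] True by (simp add: R_def)
    next
      case False
      then have "g \<in> N W" using a g by (simp add: N_def)
      then show ?thesis using osat_exit[OF U _ g(2) True] om_side[of g] unfolding R_def by blast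
    qed
  next
    case False
    then obtain e where e: "e \<in> N W" "Sg e \<subseteq> slice U (al e)" "al g \<in> sd e" using R by (auto simp: R_def)
    show ?thesis
    proof (cases "om g \<in> sd e")
      case True
      then show ?thesis using e unfolding R_def by blast
    next
      case False
      \<comment> \<open>The glueing leads from a branch back into \<open>W\<close>; it ends in
        \<open>Sg e\<close>, which is contained in the slice of \<open>U\<close>.\<close>
      then have "g = rv e" using cross_out[of e g] e g N_D[OF e(1)] by simp
      then have "om g = al e" "ph g y \<in> Sg e" using N_D[OF e(1)] ph_Sg[OF g] by simp_all
      then show ?thesis using e(2) by (auto simp: R_def slice_def)
    qed
  qed
  have tr: "R t x" if "cl (s, y) = cl (t, x)" "R s y" for s y
    using that inv pt_eq_iff[of s y t x] by (auto simp: pt_def)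
  have "pt t x \<in> G W U \<longleftrightarrow> R t x"
  proof
    assume "pt t x \<in> G W U"
    then consider p where "p \<in> U" "cl (t, x) = cl p"
      | s y e where "s \<in> V - W" "cl (t, x) = cl (s, y)" "e \<in> N W" "Sg e \<subseteq> slice U (al e)"
        "first_edge Ed al om W e s"
      unfolding G_set_def pt_def N_def by auto
    then show "R t x"
    proof cases
      case 1
      then show ?thesis using tr[of "fst p" "snd p"] by (simp add: R_def)
    next
      case 2
      then have "R s y" using first_edge_iff[OF W 2(3)] by (auto simp: R_def)
      then show ?thesis using tr[of s y] 2 by simp
    qed
  next
    assume R: "R t x"
    show "pt t x \<in> G W U"
    proof (cases "(t, x) \<in> U")
      case True
      then show ?thesis by (auto simp: G_set_def pt_def)
    next
      case False
      then obtain e where e: "e \<in> N W" "Sg e \<subseteq> slice U (al e)" "t \<in> sd e" using R by (auto simp: R_def)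
      then have "t \<in> V - W" using exit_disjoint[OF W e(1)] t by blast
      moreover have "e \<in> Ed \<and> al e \<in> W \<and> om e \<notin> W \<and> Sg e \<subseteq> slice U (al e) \<and> first_edge Ed al om W e t"
        using e first_edge_iff[OF W e(1)] N_D[OF e(1)] by simp
      ultimately have "cl (t, x) \<in> {cl (t, x) | t x. t \<in> V - W \<and> x \<in> topspace (Kt t) \<and>
              (\<exists>e\<in>Ed. al e \<in> W \<and> om e \<notin> W \<and> Sg e \<subseteq> slice U (al e) \<and> first_edge Ed al om W e t)}"
        using t by auto
      then show ?thesis unfolding G_set_def pt_def by (rule UnI1[OF UnI2[OF imageI]])
    qed
  qed
  then show ?thesis by (simp add: R_def)
qed

lemma end_in_G_iff:
  assumes W: "subtree W" and r: "ray r"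
  shows "Inr (end_pt r) \<in> G W U \<longleftrightarrow> (\<exists>e\<in>N W. Sg e \<subseteq> slice U (al e) \<and> tow e r)"
proof -
  have e: "end_pt r \<in> ends V Ed al om" using r ends_iff by blast
  have *: "Inr x \<in> Inl ` A \<union> Inl ` B \<union> Inr ` C \<longleftrightarrow> x \<in> C" for x :: "(nat \<Rightarrow> 'v) set" and A B :: "('v \<times> 'a) set set" and C
    by auto
  have "Inr (end_pt r) \<in> G W U \<longleftrightarrow> (\<exists>r'\<in>end_pt r. r' 0 \<in> W \<and>
              (\<exists>e\<in>Ed. al e = r' 0 \<and> om e = r' 1 \<and> om e \<notin> W \<and> Sg e \<subseteq> slice U (al e)))"
    using e by (simp only: G_set_def * mem_Collect_eq simp_thms)
  then show ?thesis using end_through_iff[OF W r, of "\<lambda>e. Sg e \<subseteq> slice U (al e)"] by simp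
qed

lemma G_subset_pts:
  assumes "subtree W" "osat W U"
  shows "G W U \<subseteq> pts"
proof -
  have "U \<subseteq> disj_union V Kt"
    using assms(2) subtreeD(2)[OF assms(1)] unfolding open_saturated_def disj_union_def by auto
  then show ?thesis unfolding G_set_def lim_points_def disj_union_def by auto
qed

lemma osat_UNIV: "subtree W \<Longrightarrow> osat W (disj_union W Kt)"
  using Sg_subset ph_mspace openin_topspace[of "Kt _"] by (auto simp: open_saturated_def disj_union_def slice_def sub_edges_def)

lemma G_UNIV:
  assumes W: "finite W" "subtree W"
  shows "G W (disj_union W Kt) = pts"
proof
  show "G W (disj_union W Kt) \<subseteq> pts" using G_subset_pts[OF W(2) osat_UNIV[OF W(2)]] .
  have all: "Sg e \<subseteq> slice (disj_union W Kt) (al e)" if "e \<in> N W" for e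
    using Sg_subset N_D[OF that] by (auto simp: slice_def disj_union_def)
  show "pts \<subseteq> G W (disj_union W Kt)"
  proof
    fix p assume "p \<in> pts"
    then show "p \<in> G W (disj_union W Kt)"
    proof (cases rule: pts_cases)
      case (1 t x)
      then show ?thesis using pt_in_G_iff[OF W(2) osat_UNIV[OF W(2)] 1(1,2)] exit_ex[OF W(2) 1(1)] all
        by (cases "t \<in> W") (auto simp: disj_union_def)
    next
      case (2 r)
      then show ?thesis using end_in_G_iff[OF W(2) 2(1)] ray_exit_ex[OF W 2(1)] all by auto
    qed
  qed
qed

lemma Union_basis: "\<Union>basis = pts"
proof
  show "\<Union>basis \<subseteq> pts" unfolding lim_basis_def using G_subset_pts by blast
  obtain W where W: "finite W" "subtree W" using ex_finite_subtree[of "{}"] by auto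
  then have "G W (disj_union W Kt) \<in> basis" unfolding lim_basis_def using osat_UNIV by blast
  then show "pts \<subseteq> \<Union>basis" using G_UNIV[OF W] by blast
qed

lemma lim_eq: "lim = topology_generated_by basis"
  unfolding lim_top_def using Union_basis subtopology_topspace[of "topology_generated_by basis"] by simp

lemma topspace_lim [simp]: "topspace lim = pts"
  by (simp add: lim_eq Union_basis)

lemma openin_G: "finite W \<Longrightarrow> subtree W \<Longrightarrow> osat W U \<Longrightarrow> openin lim (G W U)"
  unfolding lim_eq by (rule topology_generated_by_Basis) (auto simp: lim_basis_def)

section \<open>Branches and tame sets\<close>

definition branch :: "'e \<Rightarrow> ('v, 'a) lpt set" where
  "branch e = {pt t x | t x. t \<in> sd e \<and> x \<in> mspace (K t)} \<union> {Inr (end_pt r) | r. ray r \<and> tow e r}"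

text \<open>All that compactness and nullity use about neighbourhoods. Unlike the form
  \<open>G_set\<close>, it passes to intersections as soon as \<open>W\<close> is enlarged to a
  common subtree.\<close>

definition tame :: "'v set \<Rightarrow> ('v, 'a) lpt set \<Rightarrow> bool" where
  "tame W A \<longleftrightarrow> (\<forall>e\<in>Ed. sd e \<inter> W = {} \<longrightarrow> branch e \<subseteq> A \<or> branch e \<inter> A = {})"

lemma pt_in_branch: "t \<in> sd e \<Longrightarrow> x \<in> mspace (K t) \<Longrightarrow> pt t x \<in> branch e"
  unfolding branch_def by blast

text \<open>The copy of \<open>Sg e\<close> at \<open>al e\<close> is glued to one at
  \<open>om e\<close>, so a branch meets the vertex space in front of it. Through this contact a set
  containing the vertex space meets the branches attached to it.\<close>

lemma Sg_in_branch: "e \<in> Ed \<Longrightarrow> x \<in> Sg e \<Longrightarrow> pt (al e) x \<in> branch e"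
  using pt_glue[of e x] pt_in_branch[of "om e" e "ph e x"] ph_mspace[of e x] by simp

lemma end_in_branch: "ray r \<Longrightarrow> tow e r \<Longrightarrow> Inr (end_pt r) \<in> branch e"
  unfolding branch_def by blast

lemma branch_mono: "sd e \<subseteq> sd f \<Longrightarrow> branch e \<subseteq> branch f"
  unfolding branch_def using toward_mono by blast

lemma branch_cases:
  assumes "p \<in> branch e"
  obtains t x where "t \<in> sd e" "x \<in> mspace (K t)" "p = pt t x" | r where "ray r" "tow e r" "p = Inr (end_pt r)"
  using assms by (auto simp: branch_def)

lemma end_in_branch_iff:
  assumes "ray r"
  shows "Inr (end_pt r) \<in> branch e \<longleftrightarrow> tow e r"
proof
  assume "Inr (end_pt r) \<in> branch e"
  then obtain r' where "ray r'" "tow e r'" "end_pt r = end_pt r'" by (auto simp: branch_def pt_def)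
  then show "tow e r" using end_pt_eq_iff[of r r'] assms ray_equiv_sym ray_equiv_imp_toward by blast
qed (simp add: assms end_in_branch)

lemma tame_mono: "tame W A \<Longrightarrow> W \<subseteq> W' \<Longrightarrow> tame W' A"
  unfolding tame_def by blast

text \<open>Every point of the branch has a representative or a direction beyond \<open>e\<close>,
  where \<open>U\<close> has no points, and \<open>e\<close> is the only exit it lies beyond. Its
  membership thus depends on \<open>e\<close> alone.\<close>

lemma exit_branch_G:
  assumes W: "subtree W" and U: "osat W U" and e: "e \<in> N W"
  shows "if Sg e \<subseteq> slice U (al e) then branch e \<subseteq> G W U else branch e \<inter> G W U = {}"
proof -
  have "p \<in> G W U \<longleftrightarrow> Sg e \<subseteq> slice U (al e)" if "p \<in> branch e" for p
    using that
  proof (cases rule: branch_cases)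
    case (1 t x)
    have "t \<in> V" "t \<notin> W" using 1(1) exit_disjoint[OF W e] side_subset[of e] N_D[OF e] by auto
    then have "(t, x) \<notin> U" using osat_subset[OF U] by blast
    then have "p \<in> G W U \<longleftrightarrow> (\<exists>f\<in>N W. Sg f \<subseteq> slice U (al f) \<and> t \<in> sd f)"
      using pt_in_G_iff[OF W U \<open>t \<in> V\<close> 1(2)] 1(3) by simp
    also have "\<dots> \<longleftrightarrow> Sg e \<subseteq> slice U (al e)"
      using exit_unique[OF W e _ 1(1)] e 1(1) by metis
    finally show ?thesis .
  next
    case (2 r)
    then have "p \<in> G W U \<longleftrightarrow> (\<exists>f\<in>N W. Sg f \<subseteq> slice U (al f) \<and> tow f r)"
      using end_in_G_iff[OF W 2(1)] by simp
    also have "\<dots> \<longleftrightarrow> Sg e \<subseteq> slice U (al e)"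
      using ray_exit_unique[OF W e _ 2(2)] e 2(2) by metis
    finally show ?thesis .
  qed
  then show ?thesis by auto
qed

lemma tame_G:
  assumes W: "subtree W" and U: "osat W U"
  shows "tame W (G W U)"
  unfolding tame_def
proof (intro ballI impI)
  fix e assume e: "e \<in> Ed" "sd e \<inter> W = {}"
  obtain f where f: "f \<in> N W" "sd e \<subseteq> sd f" using exit_superset[OF W e] by blast
  then show "branch e \<subseteq> G W U \<or> branch e \<inter> G W U = {}"
    using exit_branch_G[OF W U f(1)] branch_mono[OF f(2)] by (auto split: if_splits)
qed

text \<open>\<open>lim_top\<close> is defined as a generated topology, so an open set is analysed by
  induction on its generation. Finite intersections are harmless because two finite subtrees lie in
  a common one.\<close>

lemma tame_base:
  assumes "openin lim A" "p \<in> A"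
  shows "\<exists>B W. openin lim B \<and> finite W \<and> subtree W \<and> tame W B \<and> p \<in> B \<and> B \<subseteq> A"
proof -
  have "generate_topology_on basis A" using assms(1) by (simp add: lim_eq openin_topology_generated_by_iff)
  then show ?thesis using assms(2)
  proof (induction)
    case Empty
    then show ?case by simp
  next
    case (Int A C)
    obtain B W where B: "openin lim B" "finite W" "subtree W" "tame W B" "p \<in> B" "B \<subseteq> A"
      using Int.IH(1) Int.prems by auto
    obtain B' W' where B': "openin lim B'" "finite W'" "subtree W'" "tame W' B'" "p \<in> B'" "B' \<subseteq> C"
      using Int.IH(2) Int.prems by auto
    obtain Z where Z: "finite Z" "subtree Z" "W \<union> W' \<subseteq> Z"
      using ex_finite_subtree[of "W \<union> W'"] B B' subtreeD(2) by auto
    have "tame Z B" "tame Z B'" using tame_mono[OF B(4)] tame_mono[OF B'(4)] Z(3) by auto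
    then have "tame Z (B \<inter> B')" unfolding tame_def by blast
    then show ?case using B B' Z openin_Int[OF B(1) B'(1)] by (intro exI[of _ "B \<inter> B'"] exI[of _ Z]) auto
  next
    case (UN \<A>)
    then obtain A where "A \<in> \<A>" "p \<in> A" by blast
    then show ?case using UN.IH[of A] by (meson Union_upper order_trans)
  next
    case (Basis A)
    then obtain W U where "finite W" "subtree W" "osat W U" "A = G W U" by (auto simp: lim_basis_def)
    then show ?case using tame_G[of W U] openin_G[of W U] Basis by (intro exI[of _ A] exI[of _ W]) simp
  qed
qed

text \<open>The preimage of a basic set is a slice of \<open>U\<close> if \<open>t\<close> is in
  \<open>W\<close>; otherwise all of \<open>Kt t\<close> lies beyond one exit and is contained or
  missed as a whole.\<close>

lemma continuous_pt:
  assumes t: "t \<in> V"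
  shows "continuous_map (Kt t) lim (pt t)"
  unfolding lim_eq
proof (rule continuous_on_generated_topo)
  show "pt t ` topspace (Kt t) \<subseteq> \<Union>basis" using pt_in_pts[OF t] by (auto simp: Union_basis)
  fix A assume "A \<in> basis"
  then obtain W U where W: "finite W" "subtree W" and U: "osat W U" and A: "A = G W U"
    by (auto simp: lim_basis_def)
  show "openin (Kt t) (pt t -` A \<inter> topspace (Kt t))"
  proof (cases "t \<in> W")
    case True
    have "e \<in> N W \<Longrightarrow> t \<notin> sd e" for e using exit_disjoint[OF W(2)] True by blast
    then have "pt t -` A \<inter> topspace (Kt t) = slice U t"
      using pt_in_G_iff[OF W(2) U t] osat_subset[OF U] by (auto simp: A slice_def)
    then show ?thesis using U True by (simp add: open_saturated_def)
  next
    case False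
    then have "(t, x) \<notin> U" for x using osat_subset[OF U] by blast
    then have "pt t -` A \<inter> topspace (Kt t) =
        (if \<exists>e\<in>N W. Sg e \<subseteq> slice U (al e) \<and> t \<in> sd e then topspace (Kt t) else {})"
      using pt_in_G_iff[OF W(2) U t] by (auto simp: A)
    then show ?thesis by (metis openin_empty openin_topspace)
  qed
qed

end

section \<open>Compactness and metrizability of the limit\<close>

context tree_sys
begin

lemma pts_split:
  assumes v: "v \<in> V" and p: "p \<in> pts"
  shows "p \<in> pt v ` mspace (K v) \<or> (\<exists>e\<in>N {v}. p \<in> branch e)"
  using p
proof (cases rule: pts_cases)
  case (1 t x)
  show ?thesis
  proof (cases "t = v")
    case True
    then show ?thesis using 1 by blast
  next
    case False
    then obtain e where "e \<in> N {v}" "t \<in> sd e" using exit_ex[OF subtree_singleton[OF v] 1(1)] by auto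
    then show ?thesis using pt_in_branch 1 by blast
  qed
next
  case (2 r)
  then obtain e where "e \<in> N {v}" "tow e r" using ray_exit_ex[OF _ subtree_singleton[OF v] 2(1)] by auto
  then show ?thesis using end_in_branch 2 by blast
qed

lemma branch_split:
  assumes e: "e \<in> Ed" and p: "p \<in> branch e"
  shows "p \<in> pt (om e) ` mspace (K (om e)) \<or> (\<exists>f\<in>N {om e}. f \<noteq> rv e \<and> p \<in> branch f)"
  using p
proof (cases rule: branch_cases)
  case (1 t x)
  have tV: "t \<in> V" using side_subset[OF e] 1 by blast
  show ?thesis
  proof (cases "t = om e")
    case True
    then show ?thesis using 1 by blast
  next
    case False
    then obtain f where f: "f \<in> N {om e}" "t \<in> sd f"
      using exit_ex[OF subtree_singleton[of "om e"] tV] e by auto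
    moreover have "f \<noteq> rv e" using f(2) 1(1) side_rv[OF e] by blast
    ultimately show ?thesis using pt_in_branch 1 by blast
  qed
next
  case (2 r)
  then obtain f where f: "f \<in> N {om e}" "tow f r"
    using ray_exit_ex[OF _ subtree_singleton[of "om e"] 2(1)] e by auto
  moreover have "f \<noteq> rv e" using f(2) 2(2) toward_iff[OF 2(1) e] by blast
  ultimately show ?thesis using end_in_branch 2 by blast
qed

lemma finite_exits_meeting:
  assumes v: "v \<in> V" and W: "finite W" "W \<subseteq> V"
  shows "finite {e \<in> N {v}. sd e \<inter> W \<noteq> {}}"
proof -
  have "{e \<in> N {v}. sd e \<inter> W \<noteq> {}} \<subseteq> (\<Union>w\<in>W. {e \<in> Ed. v \<notin> sd e \<and> w \<in> sd e})"
    unfolding N_def using al_notin_side by auto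
  then show ?thesis using finite_separating[OF v] W by (meson finite_UN_I finite_subset subsetD)
qed

text \<open>If some open cover by tame sets had no finite subcover, then neither would some branch at each
  vertex, and following these bad branches gives a ray whose end cannot be covered.\<close>
lemma compact_lim: "compact_space lim"
  unfolding compact_space_alt
proof (intro allI impI)
  fix \<U> assume \<U>: "(\<forall>U\<in>\<U>. openin lim U) \<and> topspace lim \<subseteq> \<Union>\<U>"
  \<comment> \<open>The cover is refined to tame sets, so that a member containing one point of a
    far branch contains the whole branch.\<close>
  define \<T> where "\<T> = {B. openin lim B \<and> (\<exists>W. finite W \<and> subtree W \<and> tame W B) \<and> (\<exists>U\<in>\<U>. B \<subseteq> U)}"
  have cover: "\<exists>B\<in>\<T>. p \<in> B" if p: "p \<in> pts" for p
  proof -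
    obtain U where U: "U \<in> \<U>" "p \<in> U" "openin lim U" using \<U> p by auto
    obtain B W where "openin lim B" "finite W" "subtree W" "tame W B" "p \<in> B" "B \<subseteq> U"
      using tame_base[OF U(3,2)] by (elim exE conjE)
    then have "B \<in> \<T>" unfolding \<T>_def using U by blast
    then show ?thesis using \<open>p \<in> B\<close> by blast
  qed
  define fc where "fc A \<longleftrightarrow> (\<exists>F. finite F \<and> F \<subseteq> \<T> \<and> A \<subseteq> \<Union>F)" for A
  have fc_mono: "fc A \<Longrightarrow> A' \<subseteq> A \<Longrightarrow> fc A'" for A A' unfolding fc_def by (meson order_trans)
  have fc_UN: "fc (\<Union>i\<in>I. A i)" if "finite I" "\<And>i. i \<in> I \<Longrightarrow> fc (A i)" for I and A :: "'e \<Rightarrow> _"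
    using that
  proof (induction I)
    case empty
    then show ?case unfolding fc_def by (intro exI[of _ "{}"]) simp
  next
    case (insert i I)
    then obtain F F' where "finite F" "F \<subseteq> \<T>" "A i \<subseteq> \<Union>F" "finite F'" "F' \<subseteq> \<T>" "(\<Union>i\<in>I. A i) \<subseteq> \<Union>F'"
      unfolding fc_def by (metis insertI1 insert_iff)
    then show ?case unfolding fc_def by (intro exI[of _ "F \<union> F'"]) auto
  qed
  have star: "fc (pt v ` mspace (K v) \<union> (\<Union>e\<in>E. branch e))"
    if v: "v \<in> V" and E: "E \<subseteq> N {v}" "\<And>e. e \<in> E \<Longrightarrow> fc (branch e)" for v E
  proof -
    have "compactin lim (pt v ` topspace (Kt v))"
      using image_compactin[OF _ continuous_pt[OF v]] compact_K[OF v] by (simp add: compact_space_def)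
    moreover have "pt v ` topspace (Kt v) \<subseteq> \<Union>\<T>" using cover pt_in_pts[OF v] by fastforce
    ultimately have "\<exists>F. finite F \<and> F \<subseteq> \<T> \<and> pt v ` topspace (Kt v) \<subseteq> \<Union>F"
      unfolding compactin_def by (elim conjE allE[of _ \<T>] impE) (auto simp: \<T>_def)
    then obtain F where F: "finite F" "F \<subseteq> \<T>" "pt v ` mspace (K v) \<subseteq> \<Union>F" by auto
    then have "\<forall>B\<in>F. \<exists>W. finite W \<and> subtree W \<and> tame W B" unfolding \<T>_def by blast
    then obtain w where w: "\<And>B. B \<in> F \<Longrightarrow> finite (w B) \<and> subtree (w B) \<and> tame (w B) B" by metis
    define W where "W = (\<Union>B\<in>F. w B)"
    have W: "finite W" "W \<subseteq> V" unfolding W_def using F(1) w subtreeD(2) by blast+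
    \<comment> \<open>A branch avoiding \<open>W\<close> still meets the image of \<open>K v\<close>
      in its copy of \<open>Sg e\<close>, hence meets a member of \<open>F\<close>, and tameness
      puts all of it there. Only the finitely many branches whose half-tree meets \<open>W\<close>
      remain.\<close>
    have far: "branch e \<subseteq> \<Union>F" if e: "e \<in> N {v}" "sd e \<inter> W = {}" for e
    proof -
      have e': "e \<in> Ed" "al e = v" using N_D[OF e(1)] by simp_all
      obtain x where x: "x \<in> Sg e" using Sg_nonempty[OF e'(1)] by blast
      then have "x \<in> mspace (K v)" using Sg_subset[OF e'(1)] e' by auto
      then obtain B where B: "B \<in> F" "pt v x \<in> B" using F(3) by blast
      moreover have "pt v x \<in> branch e" using Sg_in_branch[OF e'(1) x] e' by simp
      moreover have "sd e \<inter> w B = {}" using e(2) B unfolding W_def by blast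
      ultimately show ?thesis using w[OF B(1)] e'(1) unfolding tame_def by blast
    qed
    let ?E = "{e \<in> E. sd e \<inter> W \<noteq> {}}"
    have "finite ?E" using finite_exits_meeting[OF v W] by (rule finite_subset[rotated]) (use E in blast)
    then have "fc (\<Union>e\<in>?E. branch e)" using E(2) by (intro fc_UN) auto
    then obtain F' where F': "finite F'" "F' \<subseteq> \<T>" "(\<Union>e\<in>?E. branch e) \<subseteq> \<Union>F'" unfolding fc_def by blast
    have "(\<Union>e\<in>E. branch e) \<subseteq> \<Union>F \<union> \<Union>F'"
    proof (rule UN_least)
      fix e assume "e \<in> E"
      then show "branch e \<subseteq> \<Union>F \<union> \<Union>F'" using far[of e] E(1) F'(3) by (cases "sd e \<inter> W = {}") blast+
    qed
    then show ?thesis unfolding fc_def using F F' by (intro exI[of _ "F \<union> F'"]) auto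
  qed
  have "fc pts"
  proof (rule ccontr)
    assume bad: "\<not> fc pts"
    obtain v where v: "v \<in> V" using V_nonempty by blast
    have "\<exists>e\<in>N {v}. \<not> fc (branch e)"
    proof (rule ccontr)
      assume "\<not> ?thesis"
      then have "fc (pt v ` mspace (K v) \<union> (\<Union>e\<in>N {v}. branch e))" using star[OF v subset_refl] by blast
      then have "fc pts" by (rule fc_mono) (use pts_split[OF v] in blast)
      then show False using bad by simp
    qed
    then obtain e0 where e0: "e0 \<in> Ed \<and> \<not> fc (branch e0)" using N_D by blast
    have step: "\<exists>f. (f \<in> Ed \<and> \<not> fc (branch f)) \<and> al f = om e \<and> f \<noteq> rv e"
      if e: "e \<in> Ed \<and> \<not> fc (branch e)" for e
    proof (rule ccontr)
      assume no: "\<not> ?thesis"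
      let ?E = "N {om e} - {rv e}"
      have "fc (branch f)" if "f \<in> ?E" for f using no N_D[of f "{om e}"] that by auto
      then have "fc (pt (om e) ` mspace (K (om e)) \<union> (\<Union>f\<in>?E. branch f))"
        using e by (intro star) auto
      then have "fc (branch e)" by (rule fc_mono) (use branch_split[of e] e in blast)
      then show False using e by simp
    qed
    obtain f where f: "\<And>n. f n \<in> Ed \<and> \<not> fc (branch (f n))"
      "\<And>n. al (f (Suc n)) = om (f n) \<and> f (Suc n) \<noteq> rv (f n)"
      using dependent_nat_choice[of "\<lambda>_ e. e \<in> Ed \<and> \<not> fc (branch e)"
          "\<lambda>_ e f. al f = om e \<and> f \<noteq> rv e"] e0 step by metis
    have chain: "chain f"
      unfolding chain_def
    proof (intro allI conjI)
      fix n
      show "f n \<in> Ed" using f(1) by blast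
      have "sd (f (Suc n)) \<subseteq> sd (f n)"
        using f(1)[of n] f(1)[of "Suc n"] f(2)[of n] om_side[of "f n"] al_notin_side[of "f (Suc n)"]
        by (intro side_nest) simp_all
      moreover have "al (f (Suc n)) \<in> sd (f n)" using f(2)[of n] om_side[of "f n"] by simp
      moreover have "al (f (Suc n)) \<notin> sd (f (Suc n))" using f(1)[of "Suc n"] al_notin_side by blast
      ultimately show "sd (f (Suc n)) \<subset> sd (f n)" by blast
    qed
    obtain r where r: "ray r" "\<And>n. tow (f n) r" using chain_ray[OF chain v] by blast
    \<comment> \<open>A tame neighbourhood of the end of the bad ray swallows a late branch of the
      chain, which is then covered by a single set.\<close>
    obtain B where B: "B \<in> \<T>" "Inr (end_pt r) \<in> B" using cover[OF end_in_pts[OF r(1)]] by blast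
    then obtain W where W: "finite W" "subtree W" "tame W B" unfolding \<T>_def by blast
    obtain n where "sd (f n) \<inter> W = {}" using chain_escape_finite[OF chain W(1) subtreeD(2)[OF W(2)]] by blast
    then have "branch (f n) \<subseteq> B"
      using W(3) B(2) end_in_branch[OF r(1) r(2)[of n]] f(1)[of n] unfolding tame_def by blast
    then have "fc (branch (f n))" unfolding fc_def using B(1) by (intro exI[of _ "{B}"]) simp
    then show False using f(1) by blast
  qed
  then obtain F where F: "finite F" "F \<subseteq> \<T>" "pts \<subseteq> \<Union>F" unfolding fc_def by blast
  then have "\<forall>B\<in>F. \<exists>U\<in>\<U>. B \<subseteq> U" unfolding \<T>_def by blast
  then obtain u where u: "\<And>B. B \<in> F \<Longrightarrow> u B \<in> \<U> \<and> B \<subseteq> u B" by metis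
  have "topspace lim \<subseteq> \<Union>(u ` F)" using F(3) u by fastforce
  moreover have "finite (u ` F)" "u ` F \<subseteq> \<U>" using F(1) u by blast+
  ultimately show "\<exists>F. finite F \<and> F \<subseteq> \<U> \<and> topspace lim \<subseteq> \<Union>F" by blast
qed

text \<open>The largest subset with slices inside \<open>A\<close> that respects the glueing inside
  \<open>W\<close> and contains or misses \<open>Sg e\<close> for each exit
  \<open>e\<close>.\<close>

definition core :: "'v set \<Rightarrow> ('v \<Rightarrow> 'a set) \<Rightarrow> ('v \<times> 'a) set" where
  "core W A = {(t, x). t \<in> W \<and> x \<in> A t \<and>
     (\<forall>e\<in>Ed. al e = t \<and> x \<in> Sg e \<longrightarrow> (if om e \<in> W then ph e x \<in> A (om e) else Sg e \<subseteq> A t))}"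

lemma core_iff: "(t, x) \<in> core W A \<longleftrightarrow> t \<in> W \<and> x \<in> A t \<and>
     (\<forall>e\<in>Ed. al e = t \<and> x \<in> Sg e \<longrightarrow> (if om e \<in> W then ph e x \<in> A (om e) else Sg e \<subseteq> A t))"
  by (simp add: core_def)

lemma core_Sg_iff:
  assumes "e \<in> Ed" "x \<in> Sg e"
  shows "(al e, x) \<in> core W A \<longleftrightarrow>
    al e \<in> W \<and> x \<in> A (al e) \<and> (if om e \<in> W then ph e x \<in> A (om e) else Sg e \<subseteq> A (al e))"
proof -
  have "f = e" if "f \<in> Ed" "al f = al e" "x \<in> Sg f" for f using Sg_unique[of f e x] that assms by blast
  then show ?thesis unfolding core_iff using assms by metis
qed

text \<open>The complement is a union of closed sets: the complement of \<open>A t\<close> enlarged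
  by the sets \<open>Sg e\<close> of exits that stick out of \<open>A t\<close>, closed by nullity
  although there may be infinitely many, and the pullbacks along edges inside
  \<open>W\<close>.\<close>

lemma openin_core_slice:
  assumes W: "finite W" "W \<subseteq> V" and A: "\<And>t. t \<in> W \<Longrightarrow> openin (Kt t) (A t)" and t: "t \<in> W"
  shows "openin (Kt t) (slice (core W A) t)"
proof -
  let ?C = "topspace (Kt t) - A t"
  let ?E = "{e \<in> Ed. al e = t \<and> om e \<notin> W \<and> \<not> Sg e \<subseteq> A t}"
  let ?I = "{e \<in> Ed. al e = t \<and> om e \<in> W}"
  let ?D = "\<lambda>e. {x \<in> Sg e. ph e x \<in> topspace (Kt (om e)) - A (om e)}"
  have tV: "t \<in> V" using t W by blast
  have "closedin (Kt t) (?C \<union> (\<Union>e\<in>?E. Sg e))"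
  proof (rule closedin_null_saturation)
    show "closedin (Kt t) ?C" using A[OF t] by blast
    show "compactin (Kt t) (Sg e)" if "e \<in> ?E" for e using Sg_compact that by auto
    show "Sg e \<inter> ?C \<noteq> {}" if "e \<in> ?E" for e using Sg_subset[of e] that by auto
    show "finite {e \<in> ?E. \<epsilon> \<le> mdiam (K t) (Sg e)}" if "\<epsilon> > 0" for \<epsilon>
      by (rule finite_subset[OF _ Sg_null[OF tV that]]) blast
  qed
  moreover have "closedin (Kt t) (\<Union>e\<in>?I. ?D e)"
  proof (rule closedin_Union)
    \<comment> \<open>Edges at \<open>t\<close> are determined by their other end, so only finitely
      many stay inside \<open>W\<close>.\<close>
    have "inj_on om ?I"
    proof (rule inj_onI)
      fix e f assume "e \<in> ?I" "f \<in> ?I" "om e = om f"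
      then show "e = f" using edge_unique[of e f] by simp
    qed
    moreover have "finite (om ` ?I)" by (rule finite_subset[OF _ W(1)]) blast
    ultimately have "finite ?I" by (rule finite_imageD[rotated])
    then show "finite (?D ` ?I)" by simp
    fix S assume "S \<in> ?D ` ?I"
    then obtain e where e: "e \<in> Ed" "al e = t" "om e \<in> W" "S = ?D e" by blast
    have "continuous_map (subtopology (Kt t) (Sg e)) (Kt (om e)) (ph e)"
      using homeomorphic_imp_continuous_map[OF ph_homeomorphic[OF e(1)]] e(2) continuous_map_in_subtopology by blast
    moreover have "closedin (Kt (om e)) (topspace (Kt (om e)) - A (om e))" using A[OF e(3)] by blast
    ultimately have "closedin (subtopology (Kt t) (Sg e))
        {x \<in> topspace (subtopology (Kt t) (Sg e)). ph e x \<in> topspace (Kt (om e)) - A (om e)}"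
      by (rule closedin_continuous_map_preimage)
    moreover have "topspace (subtopology (Kt t) (Sg e)) = Sg e" using Sg_subset[OF e(1)] e(2) by auto
    ultimately have "closedin (subtopology (Kt t) (Sg e)) S" using e(4) by (simp only:)
    then show "closedin (Kt t) S" using Sg_closed[OF e(1)] e(2) closedin_trans_full by blast
  qed
  ultimately have "closedin (Kt t) ((?C \<union> (\<Union>e\<in>?E. Sg e)) \<union> (\<Union>e\<in>?I. ?D e))" by (rule closedin_Un)
  then have "openin (Kt t) (topspace (Kt t) - ((?C \<union> (\<Union>e\<in>?E. Sg e)) \<union> (\<Union>e\<in>?I. ?D e)))" by blast
  moreover have "topspace (Kt t) - ((?C \<union> (\<Union>e\<in>?E. Sg e)) \<union> (\<Union>e\<in>?I. ?D e)) = slice (core W A) t"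
  proof (rule set_eqI)
    fix x
    have "x \<in> topspace (Kt t)" if "x \<in> A t" using openin_subset[OF A[OF t]] that by blast
    moreover have "ph e x \<in> topspace (Kt (om e))" if "e \<in> ?I" "x \<in> Sg e" for e using ph_mspace that by simp
    ultimately show "x \<in> topspace (Kt t) - ((?C \<union> (\<Union>e\<in>?E. Sg e)) \<union> (\<Union>e\<in>?I. ?D e)) \<longleftrightarrow> x \<in> slice (core W A) t"
      using t unfolding slice_def mem_Collect_eq core_iff by auto
  qed
  ultimately show ?thesis by simp
qed

lemma osat_core:
  assumes W: "finite W" "W \<subseteq> V" and A: "\<And>t. t \<in> W \<Longrightarrow> openin (Kt t) (A t)"
  shows "osat W (core W A)"
  unfolding open_saturated_def
proof (intro conjI ballI impI)
  show "core W A \<subseteq> disj_union W Kt"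
    using openin_subset[OF A] unfolding disj_union_def core_def by blast
  show "openin (Kt t) (slice (core W A) t)" if "t \<in> W" for t using openin_core_slice[OF W A that] .
  show "(al e, x) \<in> core W A \<longleftrightarrow> (om e, ph e x) \<in> core W A"
    if "e \<in> sub_edges Ed al om W" "x \<in> Sg e" for e x
  proof -
    have e: "e \<in> Ed" "al e \<in> W" "om e \<in> W" using that by (auto simp: sub_edges_def)
    show ?thesis
      using core_Sg_iff[OF e(1) that(2)] core_Sg_iff[OF rv_Ed[OF e(1)] ph_Sg[OF e(1) that(2)]] e ph_rv[OF e(1) that(2)]
      by auto
  qed
  show "Sg e \<subseteq> slice (core W A) (al e) \<or> Sg e \<inter> slice (core W A) (al e) = {}"
    if "e \<in> Ed" "al e \<in> W \<and> om e \<notin> W" for e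
    using core_Sg_iff[OF that(1)] that(2) by (cases "Sg e \<subseteq> A (al e)") (auto simp: slice_def)
qed

text \<open>The fibre of \<open>p\<close> under the map collapsing every branch off \<open>W\<close>.\<close>
definition fibre :: "'v set \<Rightarrow> ('v, 'a) lpt \<Rightarrow> 'v \<Rightarrow> 'a set" where
  "fibre W p t = {x \<in> mspace (K t). pt t x = p \<or> (\<exists>e\<in>N W. al e = t \<and> x \<in> Sg e \<and> p \<in> branch e)}"

text \<open>Nothing representing \<open>p\<close> is lost in passing from \<open>A\<close> to the
  core: a glued partner of a representative again lies in the fibre, and if a representative lies in
  \<open>Sg e\<close> for an exit \<open>e\<close>, then all of \<open>Sg e\<close> belongs to the
  fibre.\<close>

lemma in_G_core:
  assumes W: "finite W" "subtree W" and A: "\<And>t. t \<in> W \<Longrightarrow> openin (Kt t) (A t) \<and> fibre W p t \<subseteq> A t"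
    and p: "p \<in> pts"
  shows "p \<in> G W (core W A)"
proof -
  have sat: "osat W (core W A)" using osat_core[OF W(1) subtreeD(2)[OF W(2)]] A by blast
  have ex: "Sg e \<subseteq> slice (core W A) (al e)" if e: "e \<in> N W" "p \<in> branch e" for e
  proof -
    have e': "e \<in> Ed" "al e \<in> W" "om e \<notin> W" using N_D[OF e(1)] by simp_all
    have "Sg e \<subseteq> fibre W p (al e)" unfolding fibre_def using e e' Sg_subset by blast
    then have "Sg e \<subseteq> A (al e)" using A[OF e'(2)] by blast
    then show ?thesis using core_Sg_iff[OF e'(1)] e' by (auto simp: slice_def)
  qed
  show ?thesis using p
  proof (cases rule: pts_cases)
    case (1 t x)
    show ?thesis
    proof (cases "t \<in> W")
      case True
      have "x \<in> fibre W p t" using 1 by (simp add: fibre_def)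
      then have "x \<in> A t" using A[OF True] by blast
      moreover have "if om e \<in> W then ph e x \<in> A (om e) else Sg e \<subseteq> A t"
        if e: "e \<in> Ed" "al e = t" "x \<in> Sg e" for e
      proof (cases "om e \<in> W")
        case om: True
        have "ph e x \<in> fibre W p (om e)" unfolding fibre_def using 1 e pt_glue[of e x] ph_mspace[of e x] by simp
        then show ?thesis using A[OF om] om by auto
      next
        case False
        then have eN: "e \<in> N W" using e True by (simp add: N_def)
        have "p \<in> branch e" using Sg_in_branch[OF e(1,3)] 1(3) e(2) by simp
        then have "Sg e \<subseteq> fibre W p t" using eN e Sg_subset[OF e(1)] unfolding fibre_def by blast
        then show ?thesis using A[OF True] False by auto
      qed
      ultimately have "(t, x) \<in> core W A" using True unfolding core_iff by blast
      then show ?thesis using pt_in_G_iff[OF W(2) sat 1(1,2)] 1(3) by blast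
    next
      case False
      then obtain e where "e \<in> N W" "t \<in> sd e" using exit_ex[OF W(2) 1(1)] by blast
      then show ?thesis using ex[of e] pt_in_branch[of t e x] pt_in_G_iff[OF W(2) sat 1(1,2)] 1 by blast
    qed
  next
    case (2 r)
    then obtain e where "e \<in> N W" "tow e r" using ray_exit_ex[OF W 2(1)] by blast
    then show ?thesis using ex[of e] end_in_branch[OF 2(1)] end_in_G_iff[OF W(2) 2(1)] 2(2) by blast
  qed
qed

text \<open>A common point would be glued along an edge from \<open>sd e\<close> into
  \<open>sd f\<close>. The only way out of \<open>sd e\<close> leads to \<open>al e\<close>, which
  is in \<open>W\<close> and so not in \<open>sd f\<close>.\<close>

lemma branch_Int_exits:
  assumes W: "subtree W" and e: "e \<in> N W" "f \<in> N W" and p: "p \<in> branch e" "p \<in> branch f"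
  shows "e = f"
proof (rule ccontr)
  assume ne: "e \<noteq> f"
  have E: "e \<in> Ed" "al e \<in> W" "f \<in> Ed" "al f \<in> W" using e N_D by blast+
  show False using p(1)
  proof (cases rule: branch_cases)
    case (1 t x)
    obtain s y where s: "s \<in> sd f" "p = pt s y"
      using p(2) 1(3) by (cases rule: branch_cases) (auto simp: pt_def)
    then have "pt t x = pt s y" using 1 by simp
    moreover have "s \<noteq> t" using exit_unique[OF W e 1(1)] s ne by blast
    ultimately obtain g where g: "g \<in> Ed" "al g = t" "om g = s" using pt_eq_iff by metis
    have "s \<notin> sd e" using exit_unique[OF W e _ s(1)] ne by blast
    then have "g = rv e" using cross_out[OF E(1) g(1)] g 1 by simp
    then have "s = al e" using g E by simp
    then show False using exit_disjoint[OF W e(2)] s(1) E by blast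
  next
    case (2 r)
    then have "tow f r" using p(2) end_in_branch_iff by simp
    then show False using ray_exit_unique[OF W e 2(2)] ne by blast
  qed
qed

text \<open>At one vertex a fibre consists of at most one point together with at most one set
  \<open>Sg e\<close>.\<close>

lemma closedin_fibre:
  assumes W: "subtree W" and t: "t \<in> W"
  shows "closedin (Kt t) (fibre W p t)"
proof -
  let ?E = "{e \<in> N W. al e = t \<and> p \<in> branch e}"
  have eq: "fibre W p t = {x \<in> mspace (K t). pt t x = p} \<union> (\<Union>e\<in>?E. Sg e)"
    unfolding fibre_def using Sg_subset N_D by blast
  have "closedin (Kt t) {x \<in> mspace (K t). pt t x = p}"
  proof (cases "\<exists>x\<in>mspace (K t). pt t x = p")
    case True
    then obtain x where x: "x \<in> mspace (K t)" "pt t x = p" by blast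
    then have "{x \<in> mspace (K t). pt t x = p} = {x}" using pt_inj by blast
    then show ?thesis using closedin_Hausdorff_singleton[OF Hausdorff_K, of x t] x by simp
  next
    case False
    then have "{x \<in> mspace (K t). pt t x = p} = {}" by blast
    then show ?thesis by (metis closedin_empty)
  qed
  moreover have "closedin (Kt t) (\<Union>e\<in>?E. Sg e)"
  proof (cases "?E = {}")
    case True
    then show ?thesis by (metis UN_empty closedin_empty)
  next
    case False
    then obtain e where e: "e \<in> ?E" by blast
    then have "?E = {e}" using branch_Int_exits[OF W] by blast
    then have "(\<Union>e\<in>?E. Sg e) = Sg e" by simp
    moreover have "closedin (Kt t) (Sg e)" using Sg_closed[of e] e N_D[of e W] by auto
    ultimately show ?thesis by simp
  qed
  ultimately show ?thesis unfolding eq by (rule closedin_Un)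
qed

text \<open>\<open>A\<close> collects the vertices, at most two, over which the point has a
  representative.\<close>

lemma pt_notin_branch:
  assumes "x \<in> mspace (K t)"
  shows "\<exists>A. finite A \<and> A \<subseteq> insert t V \<and> (\<forall>e. sd e \<inter> A = {} \<longrightarrow> pt t x \<notin> branch e)"
proof -
  let ?A = "insert t {om e | e. e \<in> Ed \<and> al e = t \<and> x \<in> Sg e}"
  have "finite {om e | e. e \<in> Ed \<and> al e = t \<and> x \<in> Sg e}"
  proof (cases "\<exists>e\<in>Ed. al e = t \<and> x \<in> Sg e")
    case True
    then obtain e where e: "e \<in> Ed" "al e = t" "x \<in> Sg e" by blast
    have "f = e" if "f \<in> Ed" "al f = t" "x \<in> Sg f" for f using Sg_unique[of f e x] e that by simp
    then have "{om e | e. e \<in> Ed \<and> al e = t \<and> x \<in> Sg e} \<subseteq> {om e}" by blast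
    then show ?thesis by (rule finite_subset) simp
  next
    case False
    then have "{om e | e. e \<in> Ed \<and> al e = t \<and> x \<in> Sg e} = {}" by blast
    then show ?thesis by (metis finite.emptyI)
  qed
  then have "finite ?A" by simp
  moreover have "?A \<subseteq> insert t V" by auto
  moreover have "pt t x \<notin> branch e" if e: "sd e \<inter> ?A = {}" for e
  proof
    assume "pt t x \<in> branch e"
    then obtain s y where s: "s \<in> sd e" "pt t x = pt s y"
      by (cases rule: branch_cases) (auto simp: pt_def)
    then have "s = t \<or> (\<exists>e\<in>Ed. al e = t \<and> om e = s \<and> x \<in> Sg e)" using pt_eq_iff[of t x s y] by blast
    then have "s \<in> ?A" by blast
    then show False using e s by blast
  qed
  ultimately show ?thesis by (intro exI[of _ ?A]) simp
qed

text \<open>If one of the points is not an end, \<open>W\<close> contains the vertices carrying it,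
  and then it lies in no exit branch. For two ends, \<open>W\<close> contains an edge that they
  orient differently.\<close>

lemma ex_separating_subtree:
  assumes p: "p \<in> pts" and q: "q \<in> pts" and ne: "p \<noteq> q"
  shows "\<exists>W. finite W \<and> subtree W \<and> (\<forall>e\<in>N W. p \<notin> branch e \<or> q \<notin> branch e)"
proof -
  have *: "\<exists>W. finite W \<and> subtree W \<and> (\<forall>e\<in>N W. pt t x \<notin> branch e)"
    if t: "t \<in> V" "x \<in> mspace (K t)" for t x
  proof -
    obtain A where A: "finite A" "A \<subseteq> insert t V" "\<And>e. sd e \<inter> A = {} \<Longrightarrow> pt t x \<notin> branch e"
      using pt_notin_branch[OF t(2)] by blast
    then obtain W where W: "finite W" "subtree W" "A \<subseteq> W" using ex_finite_subtree[of A] t by blast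
    then have "pt t x \<notin> branch e" if "e \<in> N W" for e using exit_disjoint[OF W(2) that] A(3)[of e] by blast
    then show ?thesis using W by blast
  qed
  show ?thesis using p
  proof (cases rule: pts_cases)
    case (1 t x)
    then show ?thesis using *[OF 1(1,2)] by blast
  next
    case r: (2 r)
    show ?thesis using q
    proof (cases rule: pts_cases)
      case (1 t x)
      then show ?thesis using *[OF 1(1,2)] by blast
    next
      case r': (2 r')
      have "\<not> ray_equiv r r'" using end_pt_eq_iff[OF r(1) r'(1)] ne r r' by blast
      then obtain f where f: "f \<in> Ed" "tow f r" "\<not> tow f r'" using ray_equiv_iff[OF r(1) r'(1)] by blast
      obtain W where W: "finite W" "subtree W" "{al f, om f} \<subseteq> W"
        using ex_finite_subtree[of "{al f, om f}"] f by auto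
      have "\<not> (tow e r \<and> tow e r')" if e: "e \<in> N W" for e
      proof
        assume t: "tow e r \<and> tow e r'"
        have "al f \<notin> sd e" using exit_disjoint[OF W(2) e] W(3) by blast
        then have "sd e \<subseteq> sd f \<or> sd e \<inter> sd f = {}"
          using conn_subset_side[OF conn_side[of e] f(1)] N_D[OF e] by blast
        then show False using toward_not_disjoint t f toward_mono by blast
      qed
      then show ?thesis using W r r' end_in_branch_iff by (intro exI[of _ W]) simp
    qed
  qed
qed

text \<open>Since \<open>Sg e\<close> is nonempty, disjoint sets cannot both contain it; thus no
  exit is absorbed by both.\<close>

lemma G_disjoint:
  assumes W: "subtree W" and U: "osat W U" "osat W U'" and dis: "U \<inter> U' = {}"
  shows "disjnt (G W U) (G W U')"
  unfolding disjnt_iff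
proof (intro allI notI)
  fix p assume p: "p \<in> G W U \<and> p \<in> G W U'"
  have "p \<in> pts" using p G_subset_pts[OF W U(1)] by blast
  have no: False if "e \<in> N W" "Sg e \<subseteq> slice U (al e)" "Sg e \<subseteq> slice U' (al e)" for e
    using Sg_nonempty[of e] N_D[OF that(1)] that dis by (auto simp: slice_def)
  from \<open>p \<in> pts\<close> show False
  proof (cases rule: pts_cases)
    case (1 t x)
    have "t \<notin> sd e" if "(t, x) \<in> U \<or> (t, x) \<in> U'" "e \<in> N W" for e
      using that osat_subset[OF U(1)] osat_subset[OF U(2)] exit_disjoint[OF W that(2)] by blast
    then obtain e f where "e \<in> N W" "Sg e \<subseteq> slice U (al e)" "t \<in> sd e" "f \<in> N W" "Sg f \<subseteq> slice U' (al f)" "t \<in> sd f"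
      using p pt_in_G_iff[OF W U(1) 1(1,2)] pt_in_G_iff[OF W U(2) 1(1,2)] 1(3) dis by blast
    then show False using no exit_unique[OF W] by blast
  next
    case (2 r)
    then obtain e f where "e \<in> N W" "Sg e \<subseteq> slice U (al e)" "tow e r" "f \<in> N W" "Sg f \<subseteq> slice U' (al f)" "tow f r"
      using p end_in_G_iff[OF W 2(1)] by blast
    then show False using no ray_exit_unique[OF W] by blast
  qed
qed

text \<open>The family consists of the basic sets of cores \<open>core W A\<close> with
  \<open>A\<close> chosen, vertex by vertex, from countable families separating closed sets. It is
  countable because \<open>V\<close> has countably many finite subsets and each \<open>W\<close> is
  finite.\<close>

lemma countably_separated_lim:
  "\<exists>\<G>. countable \<G> \<and> (\<forall>A\<in>\<G>. openin lim A) \<and>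
     (\<forall>p\<in>pts. \<forall>q\<in>pts. p \<noteq> q \<longrightarrow> (\<exists>A\<in>\<G>. \<exists>B\<in>\<G>. p \<in> A \<and> q \<in> B \<and> disjnt A B))"
proof -
  have "\<forall>t\<in>V. \<exists>\<B>. countable \<B> \<and> (\<forall>B\<in>\<B>. openin (Kt t) B) \<and>
      (\<forall>A C. closedin (Kt t) A \<and> closedin (Kt t) C \<and> disjnt A C \<longrightarrow>
        (\<exists>B\<in>\<B>. \<exists>D\<in>\<B>. A \<subseteq> B \<and> C \<subseteq> D \<and> disjnt B D))"
    using second_countable_separating_family[OF compact_K Hausdorff_K compact_metric_second_countable[OF compact_K]] by blast
  then obtain \<B> where B: "\<And>t. t \<in> V \<Longrightarrow> countable (\<B> t)" "\<And>t B. t \<in> V \<Longrightarrow> B \<in> \<B> t \<Longrightarrow> openin (Kt t) B"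
    and sep: "\<And>t A C. t \<in> V \<Longrightarrow> closedin (Kt t) A \<Longrightarrow> closedin (Kt t) C \<Longrightarrow> disjnt A C \<Longrightarrow>
        \<exists>B\<in>\<B> t. \<exists>D\<in>\<B> t. A \<subseteq> B \<and> C \<subseteq> D \<and> disjnt B D"
    by metis
  let ?G = "\<Union>W\<in>{W. finite W \<and> W \<subseteq> V \<and> subtree W}. (\<lambda>A. G W (core W A)) ` (PiE W \<B>)"
  have op: "openin (Kt t) (A t)" if "subtree W" "A \<in> PiE W \<B>" "t \<in> W" for W A t
    using B(2)[of t "A t"] subtreeD(2)[OF that(1)] that by (auto simp: PiE_iff)
  have "countable {W. finite W \<and> W \<subseteq> V}" using countable_V by (rule countable_Collect_finite_subset)
  then have "countable {W. finite W \<and> W \<subseteq> V \<and> subtree W}" by (rule countable_subset[rotated]) blast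
  moreover have "countable (PiE W \<B>)" if "finite W" "W \<subseteq> V" for W
    using that B(1) by (intro countable_PiE) auto
  ultimately have "countable ?G" by (intro countable_UN countable_image) auto
  moreover have "openin lim A" if "A \<in> ?G" for A
    using that openin_G osat_core op by auto
  moreover have "\<exists>A\<in>?G. \<exists>B\<in>?G. p \<in> A \<and> q \<in> B \<and> disjnt A B" if pq: "p \<in> pts" "q \<in> pts" "p \<noteq> q" for p q
  proof -
    obtain W where W: "finite W" "subtree W" and WN: "\<And>e. e \<in> N W \<Longrightarrow> p \<notin> branch e \<or> q \<notin> branch e"
      using ex_separating_subtree[OF pq] by blast
    \<comment> \<open>A common element lies in at most one \<open>Sg e\<close>, and then in
      \<open>branch e\<close>; so either \<open>p = q\<close>, or one exit branch would contain both
      points.\<close>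
    have dis: "disjnt (fibre W p t) (fibre W q t)" for t
      unfolding disjnt_iff
    proof (intro allI notI)
      fix x assume x: "x \<in> fibre W p t \<and> x \<in> fibre W q t"
      have *: "pt t x \<in> branch e" if "e \<in> N W" "al e = t" "x \<in> Sg e" for e
        using Sg_in_branch[of e x] N_D[OF that(1)] that by auto
      have "e = f" if "e \<in> N W" "al e = t" "x \<in> Sg e" "f \<in> N W" "al f = t" "x \<in> Sg f" for e f
        using Sg_unique[of e f x] N_D[OF that(1)] N_D[OF that(4)] that by simp
      then show False using x WN pq(3) * unfolding fibre_def by blast
    qed
    then have "\<exists>B D. B \<in> \<B> t \<and> D \<in> \<B> t \<and> fibre W p t \<subseteq> B \<and> fibre W q t \<subseteq> D \<and> disjnt B D"
      if t: "t \<in> W" for t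
      using sep[OF subsetD[OF subtreeD(2)[OF W(2)] t] closedin_fibre[OF W(2) t, of p] closedin_fibre[OF W(2) t, of q]]
      by blast
    then obtain A D where AD: "\<And>t. t \<in> W \<Longrightarrow> A t \<in> \<B> t \<and> D t \<in> \<B> t \<and> fibre W p t \<subseteq> A t \<and> fibre W q t \<subseteq> D t \<and> disjnt (A t) (D t)"
      by metis
    let ?A = "restrict A W" and ?D = "restrict D W"
    have mem: "?A \<in> PiE W \<B>" "?D \<in> PiE W \<B>" using AD by auto
    note sub = subtreeD(2)[OF W(2)]
    have sat: "osat W (core W ?A)" "osat W (core W ?D)"
      by (rule osat_core[OF W(1) sub op[OF W(2) mem(1)]], assumption)
        (rule osat_core[OF W(1) sub op[OF W(2) mem(2)]], assumption)
    have "p \<in> G W (core W ?A)" using in_G_core[OF W _ pq(1), of ?A] op[OF W(2) mem(1)] AD by simp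
    moreover have "q \<in> G W (core W ?D)" using in_G_core[OF W _ pq(2), of ?D] op[OF W(2) mem(2)] AD by simp
    moreover have "core W ?A \<inter> core W ?D = {}" using AD by (fastforce simp: core_iff disjnt_iff)
    then have "disjnt (G W (core W ?A)) (G W (core W ?D))" using G_disjoint[OF W(2) sat] by blast
    moreover have "G W (core W ?A) \<in> ?G" "G W (core W ?D) \<in> ?G" using W sub mem by blast+
    ultimately show ?thesis by (intro bexI[of _ "G W (core W ?A)"] bexI[of _ "G W (core W ?D)"]) simp_all
  qed
  ultimately show ?thesis by (intro exI[of _ ?G] conjI ballI impI)
qed

lemma Hausdorff_lim: "Hausdorff_space lim"
  unfolding Hausdorff_space_def using countably_separated_lim by (metis topspace_lim)

lemma metrizable_lim: "metrizable_space lim"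
proof -
  obtain \<G> where "countable \<G>" "\<And>A. A \<in> \<G> \<Longrightarrow> openin lim A"
     "\<And>p q. p \<in> pts \<Longrightarrow> q \<in> pts \<Longrightarrow> p \<noteq> q \<Longrightarrow> \<exists>A\<in>\<G>. \<exists>B\<in>\<G>. p \<in> A \<and> q \<in> B \<and> disjnt A B"
    using countably_separated_lim by metis
  then have "second_countable lim"
    using countably_separated_imp_second_countable[OF compact_lim, of \<G>] by simp
  then show ?thesis using compact_Hausdorff_second_countable_imp_metrizable compact_lim Hausdorff_lim by blast
qed

end

section \<open>Restriction to subtrees\<close>

context tree
begin

text \<open>A reduced walk is geodesic: its successive half-trees are nested. Consequently it lies
  in every connected set containing its ends, which is how \<open>conn_Int\<close> uses it.\<close>

lemma reduced_walk_separates: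
  assumes "walk_from_to Ed al om es u v" "reduced rv es" "f \<in> set es"
  shows "u \<notin> sd f \<and> v \<in> sd f"
  using assms
proof (induction es arbitrary: u f)
  case Nil
  then show ?case by simp
next
  case (Cons e es)
  have e: "e \<in> Ed" "al e = u" and es: "walk_from_to Ed al om es (om e) v" and red: "reduced rv es"
    using Cons.prems by (auto simp: walk_from_to_Cons reduced_Cons)
  have IH: "om e \<notin> sd f \<and> v \<in> sd f" if "f \<in> set es" for f using Cons.IH[OF es red that] .
  have Ed: "f \<in> Ed" if "f \<in> set es" for f using es that by (auto simp: walk_from_to_def walk_def)
  have ve: "v \<in> sd e"
  proof (cases es)
    case Nil
    then show ?thesis using es om_side[of e] by (simp add: walk_from_to_Nil)
  next
    case (Cons h hs)
    have h: "h \<in> set es" "h \<noteq> rv e" "al h = om e"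
      using Cons Cons.prems es by (auto simp: reduced_Cons walk_from_to_Cons)
    have "sd h \<subseteq> sd e" using side_nest[OF e(1) Ed[OF h(1)] h(2)] h(3) om_side[of e] IH[OF h(1)] by simp
    then show ?thesis using IH[OF h(1)] by blast
  qed
  show ?case
  proof (cases "f = e")
    case True
    then show ?thesis using ve e al_notin_side by auto
  next
    case False
    then have f: "f \<in> set es" using Cons.prems by simp
    have "al e \<notin> sd f"
    proof
      assume "al e \<in> sd f"
      then have "rv e = f" using cross_in[OF Ed[OF f] rv_Ed[OF e(1)]] IH[OF f] e by simp
      then show False using IH[OF f] ve side_rv[OF e(1)] by blast
    qed
    then show ?thesis using IH[OF f] e by simp
  qed
qed

lemma conn_Int:
  assumes A: "conn Ed al om A" "A \<subseteq> V" and B: "conn Ed al om B"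
  shows "conn Ed al om (A \<inter> B)"
  unfolding conn_def
proof (intro ballI)
  fix u v assume u: "u \<in> A \<inter> B" and v: "v \<in> A \<inter> B"
  have "(u, v) \<in> (step Ed al om)\<^sup>*" using reachable u v A(2) by blast
  then have "\<exists>es. walk_from_to Ed al om es u v \<and> reduced rv es"
    by (rule ex_reduced_walk) simp
  then obtain es where es: "walk_from_to Ed al om es u v" "reduced rv es" by blast
  have "set es \<subseteq> sub_edges Ed al om (A \<inter> B)"
  proof
    fix f assume f: "f \<in> set es"
    then have "f \<in> Ed" using es(1) by (auto simp: walk_from_to_def walk_def)
    moreover have "u \<notin> sd f" "v \<in> sd f" using reduced_walk_separates[OF es f] by simp_all
    ultimately show "f \<in> sub_edges Ed al om (A \<inter> B)"
      using conn_cross[OF A(1), of u v f] conn_cross[OF B, of u v f] u v by (simp add: sub_edges_def)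
  qed
  then have "walk_from_to (sub_edges Ed al om (A \<inter> B)) al om es u v"
    using es(1) by (auto simp: walk_from_to_def walk_def)
  then show "(u, v) \<in> (step (sub_edges Ed al om (A \<inter> B)) al om)\<^sup>*" using ex_walk_iff by metis
qed

lemma sub_edges_sub_edges: "W \<subseteq> S \<Longrightarrow> sub_edges (sub_edges Ed al om S) al om W = sub_edges Ed al om W"
  by (auto simp: sub_edges_def)

lemma is_tree_subtree:
  assumes S: "subtree S"
  shows "is_tree S (sub_edges Ed al om S) al om rv"
  unfolding is_tree_def
proof (intro conjI ballI allI impI)
  show "S \<noteq> {}" using subtreeD(1)[OF S] .
  show "countable S" using countable_subset[OF subtreeD(2)[OF S] countable_V] .
  show "\<exists>es. walk_from_to (sub_edges Ed al om S) al om es u v" if "u \<in> S" "v \<in> S" for u v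
    using S that unfolding is_subtree_def by blast
  fix es assume "walk (sub_edges Ed al om S) al om es \<and> es \<noteq> [] \<and> reduced rv es"
  then show "al (hd es) \<noteq> om (last es)"
    using no_reduced_cycle[of es] by (auto simp: walk_def sub_edges_def)
qed (auto simp: sub_edges_def)

text \<open>Fewer edges give smaller half-trees, for \<open>e\<close> as well as for
  \<open>rv e\<close>. Since the two half-trees of the subtree must still cover \<open>S\<close>,
  both inclusions are equalities on \<open>S\<close>.\<close>

lemma side_subtree:
  assumes S: "subtree S" and e: "e \<in> sub_edges Ed al om S"
  shows "side (sub_edges Ed al om S) al om rv e = sd e \<inter> S"
proof -
  interpret S: tree S "sub_edges Ed al om S" al om rv by (rule tree.intro) (rule is_tree_subtree[OF S])
  note S.edge [simp del]
  have sub: "S.sd f \<subseteq> sd f" for f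
  proof -
    have "(step (sub_edges Ed al om S - {f, rv f}) al om)\<^sup>* \<subseteq> (step (Ed - {f, rv f}) al om)\<^sup>*"
      by (rule rtrancl_mono[OF step_mono]) (auto simp: sub_edges_def)
    then show ?thesis unfolding side_def by (intro Collect_mono impI) (rule subsetD)
  qed
  have eE: "e \<in> Ed" using e by (simp add: sub_edges_def)
  show ?thesis
  proof
    show "S.sd e \<subseteq> sd e \<inter> S" using sub S.side_subset[OF e] by blast
    show "sd e \<inter> S \<subseteq> S.sd e"
    proof
      fix v assume v: "v \<in> sd e \<inter> S"
      then have "v \<notin> S.sd (rv e)" using sub[of "rv e"] side_rv[OF eE] by blast
      then show "v \<in> S.sd e" using S.side_rv[OF e] v by blast
    qed
  qed
qed

lemma ray_subtree:
  assumes S: "subtree S" and r: "is_ray S (sub_edges Ed al om S) al om r"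
  shows "ray r" "r n \<in> S"
  using r subtreeD(2)[OF S] unfolding is_ray_def sub_edges_def by blast+

lemma toward_subtree:
  assumes S: "subtree S" and e: "e \<in> sub_edges Ed al om S" and r: "\<And>n. r n \<in> S"
  shows "toward (sub_edges Ed al om S) al om rv e r \<longleftrightarrow> tow e r"
  unfolding toward_def side_subtree[OF S e] using r by blast

end

lemma compactin_cover:
  assumes "compactin X A" "\<And>U. U \<in> \<U> \<Longrightarrow> openin X U" "A \<subseteq> \<Union>\<U>"
  shows "\<exists>F. finite F \<and> F \<subseteq> \<U> \<and> A \<subseteq> \<Union>F"
  using assms unfolding compactin_def by (elim conjE allE[of _ \<U>] impE) auto

context tree_sys
begin

section \<open>The limit over a subtree\<close>

lemma tree_system_subtree:
  assumes S: "subtree S"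
  shows "tree_system S (sub_edges Ed al om S) al om rv K Sg ph"
  unfolding tree_system_def
proof (intro conjI ballI allI impI)
  show "is_tree S (sub_edges Ed al om S) al om rv" by (rule is_tree_subtree[OF S])
  show "compact_space (Kt t)" if "t \<in> S" for t using compact_K subtreeD(2)[OF S] that by blast
  fix e assume "e \<in> sub_edges Ed al om S"
  then have e: "e \<in> Ed" by (simp add: sub_edges_def)
  show "Sg e \<noteq> {}" using Sg_nonempty[OF e] .
  show "compactin (Kt (al e)) (Sg e)" using Sg_compact[OF e] .
  show "homeomorphic_map (subtopology (Kt (al e)) (Sg e)) (subtopology (Kt (al (rv e))) (Sg (rv e))) (ph e)"
    using ph_homeomorphic[OF e] e by simp
  show "ph (rv e) (ph e x) = x" if "x \<in> Sg e" for x using ph_rv[OF e that] .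
next
  fix t e f assume ef: "e \<in> sub_edges Ed al om S" "f \<in> sub_edges Ed al om S" "al e = t \<and> al f = t \<and> e \<noteq> f"
  then show "Sg e \<inter> Sg f = {}" using Sg_unique[of e f] by (auto simp: sub_edges_def)
next
  fix t \<epsilon> assume "t \<in> S" "\<epsilon> > (0::real)"
  then have "finite {e \<in> Ed. al e = t \<and> mdiam (K t) (Sg e) \<ge> \<epsilon>}" using Sg_null subtreeD(2)[OF S] by blast
  then show "finite {e \<in> sub_edges Ed al om S. al e = t \<and> mdiam (K t) (Sg e) \<ge> \<epsilon>}"
    by (rule finite_subset[rotated]) (auto simp: sub_edges_def)
qed

lemma tree_sys_subtree: "subtree S \<Longrightarrow> tree_sys S (sub_edges Ed al om S) al om rv K Sg ph"
  using tree_system_subtree by unfold_locales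

text \<open>The map \<open>lim \<Theta>\<^sub>S \<rightarrow> lim \<Theta>\<close> for a subtree \<open>S\<close>; its definition does not depend on \<open>S\<close>.\<close>
definition emb :: "('v, 'a) lpt \<Rightarrow> ('v, 'a) lpt" where
  "emb y = (case y of Inl c \<Rightarrow> Inl (cl (SOME q. q \<in> c)) | Inr \<xi> \<Rightarrow> Inr (end_pt (SOME r. r \<in> \<xi>)))"

lemma canon_pt_eq_emb: "canon_pt V Ed al om Sg ph p = emb (snd p)"
  by (simp add: canon_pt_def emb_def)

text \<open>The choice inside \<open>emb\<close> is harmless: the class formed in \<open>S\<close>
  is contained in the class formed in T.\<close>

lemma emb_pt:
  shows "emb (Inl (cls (sub_edges Ed al om S) al om Sg ph (t, x))) = pt t x"
proof -
  let ?c = "cls (sub_edges Ed al om S) al om Sg ph (t, x)"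
  let ?q = "SOME q. q \<in> ?c"
  have "glue (sub_edges Ed al om S) al om Sg ph \<subseteq> glue Ed al om Sg ph"
    by (auto simp: glue_def sub_edges_def)
  then have "(glue (sub_edges Ed al om S) al om Sg ph \<union> (glue (sub_edges Ed al om S) al om Sg ph)\<inverse>)\<^sup>*
      \<subseteq> (glue Ed al om Sg ph \<union> (glue Ed al om Sg ph)\<inverse>)\<^sup>*"
    by (intro rtrancl_mono) auto
  then have "?c \<subseteq> cl (t, x)" unfolding cls_def by blast
  moreover have "(t, x) \<in> ?c" by (simp add: cls_def)
  then have "?q \<in> ?c" by (rule someI)
  ultimately have "cl (t, x) = cl ?q" using cl_eq_iff by blast
  then show ?thesis by (simp add: emb_def pt_def)
qed

lemma emb_end:
  assumes S: "subtree S" and r: "is_ray S (sub_edges Ed al om S) al om r"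
  shows "emb (Inr (end_of S (sub_edges Ed al om S) al om r)) = Inr (end_pt r)"
proof -
  let ?\<xi> = "end_of S (sub_edges Ed al om S) al om r"
  let ?r = "SOME r. r \<in> ?\<xi>"
  have "r \<in> ?\<xi>" using r by (simp add: end_of_def ray_equiv_refl)
  then have "?r \<in> ?\<xi>" by (rule someI[of "\<lambda>r. r \<in> ?\<xi>"])
  then have "is_ray S (sub_edges Ed al om S) al om ?r" "ray_equiv r ?r" by (simp_all add: end_of_def)
  then have "end_pt ?r = end_pt r" using end_pt_eq_iff[OF ray_subtree(1)[OF S r] ray_subtree(1)[OF S]] by metis
  then show ?thesis by (simp add: emb_def)
qed

lemma emb_in_branch:
  assumes S: "subtree S" "S \<subseteq> sd e" and y: "y \<in> lim_points S (sub_edges Ed al om S) al om Kt Sg ph"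
  shows "emb y \<in> branch e"
proof -
  interpret S: tree_sys S "sub_edges Ed al om S" al om rv K Sg ph by (rule tree_sys_subtree[OF S(1)])
  note S.edge [simp del]
  show ?thesis using y
  proof (cases rule: S.pts_cases)
    case (1 t x)
    then show ?thesis using emb_pt[of S t x] pt_in_branch[of t e x] S(2) by (auto simp: S.pt_def)
  next
    case (2 r)
    have "tow e r" using ray_subtree(2)[OF S(1) 2(1)] S(2) unfolding toward_def by blast
    then show ?thesis using emb_end[OF S(1) 2(1)] end_in_branch[OF ray_subtree(1)[OF S(1) 2(1)]] 2(2) by simp
  qed
qed

text \<open>If \<open>W\<close> misses \<open>S\<close>, then \<open>S\<close> lies beyond one exit
  of \<open>W\<close>, and the preimage is everything or empty. Otherwise the preimage is the basic
  set of the restriction of \<open>U\<close> to \<open>W \<inter> S\<close>, a subtree by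
  \<open>conn_Int\<close>.\<close>

lemma continuous_emb:
  assumes S: "subtree S"
  shows "continuous_map (lim_top S (sub_edges Ed al om S) al om Kt Sg ph) lim emb"
proof -
  interpret S: tree_sys S "sub_edges Ed al om S" al om rv K Sg ph by (rule tree_sys_subtree[OF S])
  note S.edge [simp del]
  have sV: "S \<subseteq> V" using subtreeD(2)[OF S] .
  show ?thesis
    unfolding lim_eq
  proof (rule continuous_on_generated_topo)
    show "emb ` topspace S.lim \<subseteq> \<Union>basis"
      unfolding Union_basis
    proof (rule image_subsetI)
      fix y assume "y \<in> topspace S.lim"
      then have "y \<in> S.pts" by simp
      then show "emb y \<in> pts"
      proof (cases rule: S.pts_cases)
        case (1 t x)
        then show ?thesis using emb_pt[of S t x] pt_in_pts[of t x] sV by (auto simp: S.pt_def)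
      next
        case (2 r)
        then show ?thesis using emb_end[OF S 2(1)] end_in_pts[OF ray_subtree(1)[OF S 2(1)]] by simp
      qed
    qed
    fix A assume "A \<in> basis"
    then obtain W U where W: "finite W" "subtree W" and U: "osat W U" and A: "A = G W U"
      by (auto simp: lim_basis_def)
    show "openin S.lim (emb -` A \<inter> topspace S.lim)"
    proof (cases "W \<inter> S = {}")
      case True
      obtain s where s: "s \<in> S" using subtreeD(1)[OF S] by blast
      then obtain e where e: "e \<in> N W" "s \<in> sd e" using exit_ex[OF W(2), of s] True sV by blast
      then have "S \<subseteq> sd e"
        using conn_subset_side[OF subtreeD(3)[OF S], of e s] N_D[OF e(1)] s True by blast
      then have "emb y \<in> branch e" if "y \<in> S.pts" for y using emb_in_branch[OF S _ that] by blast
      moreover have "branch e \<subseteq> A \<or> branch e \<inter> A = {}"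
        using exit_branch_G[OF W(2) U e(1)] unfolding A by (auto split: if_splits)
      ultimately have "emb -` A \<inter> topspace S.lim = topspace S.lim \<or> emb -` A \<inter> topspace S.lim = {}"
        unfolding S.topspace_lim by blast
      then show ?thesis by (metis openin_empty openin_topspace)
    next
      case False
      define W' where "W' = W \<inter> S"
      define U' where "U' = {(t, x) \<in> U. t \<in> S}"
      have W': "finite W'" "S.subtree W'"
        using W False conn_Int[OF subtreeD(3)[OF W(2)] subtreeD(2)[OF W(2)] subtreeD(3)[OF S]]
          sub_edges_sub_edges[of W' S] unfolding W'_def is_subtree_iff conn_def by auto
      have sl: "slice U' t = slice U t" if "t \<in> S" for t using that by (auto simp: slice_def U'_def)
      have "S.osat W' U'"
        unfolding open_saturated_def
      proof (intro conjI ballI impI)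
        show "U' \<subseteq> disj_union W' Kt" using U unfolding open_saturated_def disj_union_def U'_def W'_def by auto
        show "openin (Kt t) (slice U' t)" if "t \<in> W'" for t
          using U that sl[of t] by (simp add: open_saturated_def W'_def)
        show "(al e, x) \<in> U' \<longleftrightarrow> (om e, ph e x) \<in> U'"
          if "e \<in> sub_edges (sub_edges Ed al om S) al om W'" "x \<in> Sg e" for e x
          using osat_glue[OF U, of e x] that by (auto simp: U'_def W'_def sub_edges_def)
        show "Sg e \<subseteq> slice U' (al e) \<or> Sg e \<inter> slice U' (al e) = {}"
          if "e \<in> sub_edges Ed al om S" "al e \<in> W' \<and> om e \<notin> W'" for e
          using U that sl[of "al e"] by (auto simp: open_saturated_def W'_def sub_edges_def)
      qed
      note U' = this
      have N: "e \<in> N W \<and> e \<in> sub_edges Ed al om S \<and> al e \<in> S" if "e \<in> S.N W'" for e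
        using S.N_D[OF that] by (auto simp: N_def W'_def sub_edges_def)
      have "emb y \<in> A \<longleftrightarrow> y \<in> S.G W' U'" if y: "y \<in> S.pts" for y
        using y
      proof (cases rule: S.pts_cases)
        case (1 t x)
        have t: "t \<in> V" using 1 sV by blast
        have "emb y = pt t x" using emb_pt[of S t x] 1 by (simp add: S.pt_def)
        then have "emb y \<in> A \<longleftrightarrow> (t, x) \<in> U \<or> (\<exists>e\<in>N W. Sg e \<subseteq> slice U (al e) \<and> t \<in> sd e)"
          using pt_in_G_iff[OF W(2) U t 1(2)] by (simp add: A)
        also have "(\<exists>e\<in>N W. Sg e \<subseteq> slice U (al e) \<and> t \<in> sd e) \<longleftrightarrow>
            (\<exists>e\<in>S.N W'. Sg e \<subseteq> slice U' (al e) \<and> t \<in> S.sd e)"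
        proof
          assume "\<exists>e\<in>S.N W'. Sg e \<subseteq> slice U' (al e) \<and> t \<in> S.sd e"
          then obtain e where e: "e \<in> S.N W'" "Sg e \<subseteq> slice U' (al e)" "t \<in> S.sd e" by blast
          then show "\<exists>e\<in>N W. Sg e \<subseteq> slice U (al e) \<and> t \<in> sd e"
            using N[OF e(1)] sl[of "al e"] side_subtree[OF S, of e] by auto
        next
          assume "\<exists>e\<in>N W. Sg e \<subseteq> slice U (al e) \<and> t \<in> sd e"
          then obtain e where e: "e \<in> N W" "Sg e \<subseteq> slice U (al e)" "t \<in> sd e" by blast
          then have "t \<notin> W'" using exit_disjoint[OF W(2) e(1)] by (auto simp: W'_def)
          then obtain f where f: "f \<in> S.N W'" "t \<in> S.sd f" using S.exit_ex[OF W'(2) 1(1)] by blast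
          then have "t \<in> sd f" "f \<in> N W" using N[OF f(1)] side_subtree[OF S, of f] by auto
          \<comment> \<open>The vertex is beyond an exit of \<open>W\<close> and beyond an exit of
            \<open>W'\<close> within \<open>S\<close>. The latter is an exit of \<open>W\<close> as
            well, so uniqueness identifies them.\<close>
          then have "f = e" using exit_unique[OF W(2)] e by blast
          then show "\<exists>e\<in>S.N W'. Sg e \<subseteq> slice U' (al e) \<and> t \<in> S.sd e"
            using f e sl[of "al e"] N[OF f(1)] by auto
        qed
        also have "(t, x) \<in> U \<longleftrightarrow> (t, x) \<in> U'" using 1 by (simp add: U'_def)
        finally show ?thesis using S.pt_in_G_iff[OF W'(2) U' 1(1,2)] 1(3) by simp
      next
        case (2 r)
        note r = ray_subtree[OF S 2(1)]
        have "emb y = Inr (end_pt r)" using emb_end[OF S 2(1)] 2(2) by simp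
        then have "emb y \<in> A \<longleftrightarrow> (\<exists>e\<in>N W. Sg e \<subseteq> slice U (al e) \<and> tow e r)"
          using end_in_G_iff[OF W(2) r(1)] by (simp add: A)
        also have "\<dots> \<longleftrightarrow> (\<exists>e\<in>S.N W'. Sg e \<subseteq> slice U' (al e) \<and> S.tow e r)"
        proof
          assume "\<exists>e\<in>S.N W'. Sg e \<subseteq> slice U' (al e) \<and> S.tow e r"
          then obtain e where e: "e \<in> S.N W'" "Sg e \<subseteq> slice U' (al e)" "S.tow e r" by blast
          then show "\<exists>e\<in>N W. Sg e \<subseteq> slice U (al e) \<and> tow e r"
            using N[OF e(1)] sl[of "al e"] toward_subtree[OF S _ r(2), of e] by auto
        next
          assume "\<exists>e\<in>N W. Sg e \<subseteq> slice U (al e) \<and> tow e r"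
          then obtain e where e: "e \<in> N W" "Sg e \<subseteq> slice U (al e)" "tow e r" by blast
          obtain f where f: "f \<in> S.N W'" "S.tow f r" using S.ray_exit_ex[OF W' 2(1)] by blast
          then have "tow f r" "f \<in> N W" using N[OF f(1)] toward_subtree[OF S _ r(2), of f] by auto
          then have "f = e" using ray_exit_unique[OF W(2)] e by blast
          then show "\<exists>e\<in>S.N W'. Sg e \<subseteq> slice U' (al e) \<and> S.tow e r"
            using f e sl[of "al e"] N[OF f(1)] by auto
        qed
        finally show ?thesis using S.end_in_G_iff[OF W'(2) 2(1)] 2(2) by simp
      qed
      then have "emb -` A \<inter> topspace S.lim = S.G W' U'"
        using S.G_subset_pts[OF W'(2) U'] by auto
      then show ?thesis using S.openin_G[OF W' U'] by simp
    qed
  qed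
qed

text \<open>Stated for an abstract family \<open>A i\<close> in the vertex spaces
  \<open>K (a i)\<close>, because it is applied to the sets \<open>Sg e\<close> of edges that leave
  \<open>S\<close> and so are no edges of the tree system on \<open>S\<close>.\<close>

lemma null_lim:
  assumes m: "mtopology_of m = lim"
    and a: "\<And>i. i \<in> I \<Longrightarrow> a i \<in> V" "\<And>i. i \<in> I \<Longrightarrow> A i \<noteq> {}" "\<And>i. i \<in> I \<Longrightarrow> compactin (Kt (a i)) (A i)"
    and null: "\<And>t \<epsilon>. t \<in> V \<Longrightarrow> \<epsilon> > 0 \<Longrightarrow> finite {i \<in> I. a i = t \<and> mdiam (K t) (A i) \<ge> \<epsilon>}"
    and \<epsilon>: "\<epsilon> > 0"
  shows "finite {i \<in> I. mdiam m (pt (a i) ` A i) \<ge> \<epsilon>}"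
proof -
  have ms: "mspace m = pts" using m topspace_mtopology_of[of m] by simp
  have AK: "A i \<subseteq> mspace (K (a i))" if "i \<in> I" for i using compactin_subset_topspace[OF a(3)[OF that]] by simp
  define \<T> where "\<T> = {B. openin lim B \<and> (\<exists>W. finite W \<and> subtree W \<and> tame W B) \<and> (\<forall>p\<in>B. \<forall>q\<in>B. mdist m p q \<le> \<epsilon> / 2)}"
  have "pts \<subseteq> \<Union>\<T>"
  proof
    fix p assume p: "p \<in> pts"
    \<comment> \<open>Radius \<open>\<epsilon> / 4\<close> bounds distances within the ball by
      \<open>\<epsilon> / 2\<close>, which leaves a strict gap below
      \<open>\<epsilon>\<close>.\<close>
    have "openin lim (mball_of m p (\<epsilon> / 4))" 
      using Metric_space.openin_mball[OF Metric_space_mspace_mdist, of m p "\<epsilon> / 4"] m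
      by (simp add: mtopology_of_def mball_of_def)
    moreover have "mdist m p p = 0" using p ms by simp
    then have "p \<in> mball_of m p (\<epsilon> / 4)" using p ms \<epsilon> by (simp del: mdist_zero)
    ultimately have "\<exists>B W. openin lim B \<and> finite W \<and> subtree W \<and> tame W B \<and> p \<in> B \<and> B \<subseteq> mball_of m p (\<epsilon> / 4)"
      by (rule tame_base)
    then obtain B W where B: "openin lim B" "finite W" "subtree W" "tame W B" "p \<in> B" "B \<subseteq> mball_of m p (\<epsilon> / 4)"
      by (elim exE conjE)
    have "mdist m x y \<le> \<epsilon> / 2" if "x \<in> B" "y \<in> B" for x y
    proof -
      have *: "x \<in> mspace m" "y \<in> mspace m" "mdist m p x < \<epsilon> / 4" "mdist m p y < \<epsilon> / 4" using that B(6) by auto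
      then show ?thesis using mdist_triangle[of x m p y] mdist_commute[of m x p] p ms by simp
    qed
    then have "B \<in> \<T>" unfolding \<T>_def using B by blast
    then show "p \<in> \<Union>\<T>" using B(5) by blast
  qed
  then obtain F where F: "finite F" "F \<subseteq> \<T>" "pts \<subseteq> \<Union>F"
    using compactin_cover[of lim pts \<T>] compact_lim unfolding compact_space_def by (auto simp: \<T>_def)
  then have "\<forall>B\<in>F. \<exists>W. finite W \<and> subtree W \<and> tame W B" unfolding \<T>_def by blast
  then obtain w where w: "\<And>B. B \<in> F \<Longrightarrow> finite (w B) \<and> subtree (w B) \<and> tame (w B) B" by metis
  define W where "W = (\<Union>B\<in>F. w B)"
  have W: "finite W" "W \<subseteq> V" unfolding W_def using F(1) w subtreeD(2) by blast+
  \<comment> \<open>Based off \<open>W\<close>, the set \<open>A i\<close> maps into a single branch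
    beyond \<open>w B\<close>, where \<open>B\<close> contains one of its points; tameness puts the
    image inside \<open>B\<close>.\<close>
  have far: "mdiam m (pt (a i) ` A i) < \<epsilon>" if i: "i \<in> I" "a i \<notin> W" for i
  proof -
    obtain x where x: "x \<in> A i" using a(2)[OF i(1)] by blast
    then have "pt (a i) x \<in> pts" using pt_in_pts[OF a(1)[OF i(1)]] AK[OF i(1)] by blast
    then obtain B where B: "B \<in> F" "pt (a i) x \<in> B" using F(3) by blast
    have "a i \<notin> w B" using i(2) B(1) by (auto simp: W_def)
    then obtain e where e: "e \<in> N (w B)" "a i \<in> sd e" using exit_ex[of "w B"] w[OF B(1)] a(1)[OF i(1)] by blast
    have br: "pt (a i) z \<in> branch e" if "z \<in> A i" for z using pt_in_branch[OF e(2)] AK[OF i(1)] that by blast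
    have "sd e \<inter> w B = {}" using exit_disjoint[OF _ e(1)] w[OF B(1)] by blast
    then have "branch e \<subseteq> B \<or> branch e \<inter> B = {}" using w[OF B(1)] N_D[OF e(1)] unfolding tame_def by blast
    then have "branch e \<subseteq> B" using br[OF x] B(2) by blast
    then have "pt (a i) ` A i \<subseteq> B" using br by blast
    then have "mdiam m (pt (a i) ` A i) \<le> \<epsilon> / 2"
      using B(1) F(2) x unfolding \<T>_def by (intro mdiam_le) blast+
    then show ?thesis using \<epsilon> by simp
  qed
  \<comment> \<open>At a fixed vertex, uniform continuity of \<open>pt t\<close> carries nullity
    from \<open>K t\<close> to the limit.\<close>
  have near: "finite {i \<in> I. a i = t \<and> mdiam m (pt (a i) ` A i) \<ge> \<epsilon>}" if t: "t \<in> V" for t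
  proof -
    have "uniformly_continuous_map (K t) m (pt t)"
      using continuous_imp_uniformly_continuous_map[of "K t" m "pt t"] compact_K[OF t] continuous_pt[OF t] m by simp
    then obtain \<delta> where \<delta>: "\<delta> > 0"
      "\<And>x y. x \<in> mspace (K t) \<Longrightarrow> y \<in> mspace (K t) \<Longrightarrow> mdist (K t) y x < \<delta> \<Longrightarrow> mdist m (pt t y) (pt t x) < \<epsilon> / 2"
      unfolding uniformly_continuous_map_def using \<epsilon> by (metis half_gt_zero)
    have "mdiam (K t) (A i) \<ge> \<delta>" if i: "i \<in> I" "a i = t" "mdiam m (pt (a i) ` A i) \<ge> \<epsilon>" for i
    proof (rule ccontr)
      assume small: "\<not> ?thesis"
      have c: "compactin (Kt t) (A i)" using a(3)[OF i(1)] i(2) by simp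
      have "mdist m p q \<le> \<epsilon> / 2" if pq: "p \<in> pt t ` A i" "q \<in> pt t ` A i" for p q
      proof -
        obtain x y where xy: "x \<in> A i" "y \<in> A i" "p = pt t x" "q = pt t y" using pq by blast
        then have "mdist (K t) x y < \<delta>" using mdist_le_mdiam[OF c xy(1,2)] small by simp
        then show ?thesis using \<delta>(2)[of y x] xy AK[OF i(1)] i(2) by force
      qed
      then have "mdiam m (pt t ` A i) \<le> \<epsilon> / 2" using a(2)[OF i(1)] by (intro mdiam_le) auto
      then show False using i \<epsilon> by simp
    qed
    then show ?thesis by (intro finite_subset[OF _ null[OF t \<delta>(1)]]) blast
  qed
  have "{i \<in> I. mdiam m (pt (a i) ` A i) \<ge> \<epsilon>} \<subseteq> (\<Union>t\<in>W. {i \<in> I. a i = t \<and> mdiam m (pt (a i) ` A i) \<ge> \<epsilon>})"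
  proof
    fix i assume i: "i \<in> {i \<in> I. mdiam m (pt (a i) ` A i) \<ge> \<epsilon>}"
    then have "a i \<in> W" using far[of i] by force
    then show "i \<in> (\<Union>t\<in>W. {i \<in> I. a i = t \<and> mdiam m (pt (a i) ` A i) \<ge> \<epsilon>})" using i by blast
  qed
  moreover have "finite (\<Union>t\<in>W. {i \<in> I. a i = t \<and> mdiam m (pt (a i) ` A i) \<ge> \<epsilon>})"
    using W near by (intro finite_UN_I) auto
  ultimately show ?thesis by (rule finite_subset)
qed

end

section \<open>Consolidation\<close>

text \<open>Serves to exchange \<open>cons_K\<close> for the topologies of the chosen metrics, which
  agree with it only on the vertex set.\<close>

lemma lim_top_cong:
  assumes "\<And>t. t \<in> V \<Longrightarrow> K t = K' t"
  shows "lim_top V Ed al om K Sg ph = lim_top V Ed al om K' Sg ph"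
proof -
  have d: "disj_union W K = disj_union W K'" if "W \<subseteq> V" for W
    using assms that unfolding disj_union_def by auto
  have o: "open_saturated V Ed al om K Sg ph W U = open_saturated V Ed al om K' Sg ph W U" if W: "W \<subseteq> V" for W U
  proof -
    have "(\<forall>t\<in>W. openin (K t) (slice U t)) \<longleftrightarrow> (\<forall>t\<in>W. openin (K' t) (slice U t))"
      using assms W by (intro ball_cong) auto
    then show ?thesis unfolding open_saturated_def d[OF W] by (simp only:)
  qed
  have "t \<in> V - W \<and> x \<in> topspace (K t) \<and> R \<longleftrightarrow> t \<in> V - W \<and> x \<in> topspace (K' t) \<and> R" for t x W R
    using assms by auto
  then have g: "G_set V Ed al om K Sg ph W U = G_set V Ed al om K' Sg ph W U" for W U
    unfolding G_set_def by (simp only:)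
  have "lim_basis V Ed al om K Sg ph = lim_basis V Ed al om K' Sg ph"
    unfolding lim_basis_def g using o unfolding is_subtree_def by (intro Collect_cong ex_cong1 conj_cong refl) simp
  moreover have "lim_points V Ed al om K Sg ph = lim_points V Ed al om K' Sg ph"
    unfolding lim_points_def using d by simp
  ultimately show ?thesis unfolding lim_top_def by simp
qed

locale consolidation = tree_sys V Ed al om rv K Sg ph
  for V :: "'v set" and Ed :: "'e set" and al om :: "'e \<Rightarrow> 'v" and rv :: "'e \<Rightarrow> 'e"
    and K :: "'v \<Rightarrow> 'a metric" and Sg :: "'e \<Rightarrow> 'a set" and ph :: "'e \<Rightarrow> 'a \<Rightarrow> 'a" +
  fixes P :: "'v set set"
  assumes partition: "tree_partition V Ed al om P"
begin

abbreviation CE :: "'e set" where "CE \<equiv> cons_edges Ed al om P"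
abbreviation ca :: "'e \<Rightarrow> 'v set" where "ca \<equiv> cons_al al P"
abbreviation co :: "'e \<Rightarrow> 'v set" where "co \<equiv> cons_al om P"
abbreviation cSg :: "'e \<Rightarrow> ('v, 'a) lpt set" where "cSg \<equiv> cons_Sg Ed al om Sg ph P"
abbreviation cph :: "'e \<Rightarrow> ('v, 'a) lpt \<Rightarrow> ('v, 'a) lpt" where "cph \<equiv> cons_ph Ed al om Sg ph P"
abbreviation SE :: "'v set \<Rightarrow> 'e set" where "SE S \<equiv> sub_edges Ed al om S"
abbreviation limS :: "'v set \<Rightarrow> ('v, 'a) lpt topology" where "limS S \<equiv> lim_top S (SE S) al om Kt Sg ph"
abbreviation ptsS :: "'v set \<Rightarrow> ('v, 'a) lpt set" where "ptsS S \<equiv> lim_points S (SE S) al om Kt Sg ph"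
abbreviation iota :: "'v set \<Rightarrow> 'v \<Rightarrow> 'a \<Rightarrow> ('v, 'a) lpt" where
  "iota S t x \<equiv> Inl (cls (SE S) al om Sg ph (t, x))"

section \<open>The consolidated tree\<close>

lemma part_subtree: "S \<in> P \<Longrightarrow> subtree S"
  using partition by (simp add: tree_partition_def)

lemma part_eq: "S \<in> P \<Longrightarrow> t \<in> S \<Longrightarrow> part P t = S"
  using partition unfolding part_def tree_partition_def by (intro the_equality) blast+

lemma part_in:
  assumes "t \<in> V"
  shows "part P t \<in> P" "t \<in> part P t"
proof -
  have "\<Union>P = V" using partition by (simp add: tree_partition_def)
  then obtain S where "S \<in> P" "t \<in> S" using assms by blast
  then show "part P t \<in> P" "t \<in> part P t" using part_eq by simp_all
qed

lemma part_subset_V: "S \<in> P \<Longrightarrow> S \<subseteq> V"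
  using part_subtree subtreeD(2) by blast

lemma CE_iff: "e \<in> CE \<longleftrightarrow> e \<in> Ed \<and> part P (al e) \<noteq> part P (om e)"
proof -
  have "(\<exists>S\<in>P. al e \<in> S \<and> om e \<in> S) \<longleftrightarrow> part P (al e) = part P (om e)" if e: "e \<in> Ed"
    using part_in[OF al_V[OF e]] part_in[OF om_V[OF e]] part_eq by metis
  then show ?thesis unfolding cons_edges_def by blast
qed

lemma CE_Ed: "e \<in> CE \<Longrightarrow> e \<in> Ed"
  by (simp add: CE_iff)

lemma SE_iff:
  assumes S: "S \<in> P"
  shows "e \<in> SE S \<longleftrightarrow> e \<in> Ed \<and> part P (al e) = S \<and> part P (om e) = S"
proof
  assume "e \<in> SE S"
  then show "e \<in> Ed \<and> part P (al e) = S \<and> part P (om e) = S"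
    using part_eq[OF S] by (simp add: sub_edges_def)
next
  assume e: "e \<in> Ed \<and> part P (al e) = S \<and> part P (om e) = S"
  then show "e \<in> SE S"
    using part_in(2)[of "al e"] part_in(2)[of "om e"] by (simp add: sub_edges_def)
qed

text \<open>No part contains both ends of a consolidated edge, so by connectedness no part straddles
  one.\<close>

lemma part_side:
  assumes S: "S \<in> P" and e: "e \<in> CE" and u: "u \<in> S" "u \<in> sd e"
  shows "S \<subseteq> sd e"
proof -
  have "al e \<notin> S \<or> om e \<notin> S" using e S part_eq unfolding CE_iff by metis
  then show ?thesis using conn_subset_side[OF subtreeD(3)[OF part_subtree[OF S]] CE_Ed[OF e] _ u] by blast
qed

lemma rv_CE: "e \<in> CE \<Longrightarrow> rv e \<in> CE"
  by (auto simp: CE_iff)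

lemma cons_step:
  assumes "(u, v) \<in> step (sub_edges Ed al om W) al om"
  shows "part P u = part P v \<or> (part P u, part P v) \<in> step (sub_edges CE ca co (part P ` W)) ca co"
proof -
  obtain f where f: "f \<in> sub_edges Ed al om W" "u = al f" "v = om f" using assms unfolding step_def by blast
  show ?thesis
  proof (cases "part P u = part P v")
    case False
    then have "f \<in> sub_edges CE ca co (part P ` W)"
      using f unfolding sub_edges_def cons_al_def CE_iff by blast
    then have "(ca f, co f) \<in> step (sub_edges CE ca co (part P ` W)) ca co" by (rule stepI)
    then show ?thesis using f by (simp add: cons_al_def)
  qed simp
qed

lemma cons_conn:
  assumes "conn Ed al om W"
  shows "conn CE ca co (part P ` W)"
proof -
  have "(part P u, part P v) \<in> (step (sub_edges CE ca co (part P ` W)) ca co)\<^sup>*"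
    if uv: "u \<in> W" "v \<in> W" for u v
  proof -
    have "(u, v) \<in> (step (sub_edges Ed al om W) al om)\<^sup>*" using assms uv unfolding conn_def by blast
    then show ?thesis
    proof induction
      case base
      then show ?case by simp
    next
      case (step v w)
      show ?case using cons_step[OF step.hyps(2)] step.IH by (metis rtrancl_into_rtrancl)
    qed
  qed
  then show ?thesis unfolding conn_def by blast
qed

lemma cons_subtree:
  assumes "subtree W"
  shows "is_subtree P CE ca co (part P ` W)"
  using assms cons_conn[of W] part_in unfolding is_subtree_iff by blast

text \<open>Between consecutive edges the walk rests in one part. That part lies wholly beyond the
  earlier edge and, since it contains the start of the later edge, not beyond the later one. Hence
  the half-trees nest, although the edges need not be adjacent in T.\<close>

lemma reduced_cons_walk:
  assumes "walk CE ca co es" "es \<noteq> []" "reduced rv es"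
  shows "sd (last es) \<subseteq> sd (hd es)"
  using assms
proof (induction es rule: rev_induct)
  case Nil
  then show ?case by simp
next
  case (snoc f es)
  show ?case
  proof (cases "es = []")
    case True
    then show ?thesis by simp
  next
    case False
    let ?e = "last es"
    have f: "f \<in> CE" "co ?e = ca f" "f \<noteq> rv ?e" and red: "reduced rv es" and w: "walk CE ca co es"
      using snoc.prems False by (auto simp: walk_snoc reduced_snoc)
    have e: "?e \<in> CE" using w False by (auto simp: walk_def)
    have S: "part P (om ?e) \<in> P" "om ?e \<in> part P (om ?e)" "al f \<in> part P (om ?e)"
      using part_in[OF om_V[OF CE_Ed[OF e]]] part_in[OF al_V[OF CE_Ed[OF f(1)]]] f(2) by (simp_all add: cons_al_def)
    have "al f \<in> sd ?e" using part_side[OF S(1) e S(2) om_side] S(3) by blast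
    moreover have "om ?e \<notin> sd f"
      using part_side[OF S(1) f(1) S(2)] S(3) al_notin_side[OF CE_Ed[OF f(1)]] by blast
    ultimately have "sd f \<subseteq> sd ?e" using side_nest CE_Ed e f by blast
    then show ?thesis using snoc.IH[OF w False red] False by auto
  qed
qed

lemma is_tree_cons: "is_tree P CE ca co rv"
  unfolding is_tree_def
proof (intro conjI ballI allI impI)
  obtain v where "v \<in> V" using V_nonempty by blast
  then show "P \<noteq> {}" using part_in(1) by blast
  have "P \<subseteq> part P ` V"
  proof
    fix S assume S: "S \<in> P"
    then obtain t where "t \<in> S" using subtreeD(1)[OF part_subtree] by blast
    then show "S \<in> part P ` V" using part_eq[OF S] part_subset_V[OF S] by blast
  qed
  then show "countable P" using countable_V by (meson countable_image countable_subset)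
  fix e assume e: "e \<in> CE"
  then have eE: "e \<in> Ed" by (rule CE_Ed)
  show "ca e \<in> P" "co e \<in> P" using part_in eE by (simp_all add: cons_al_def)
  show "rv e \<in> CE" using rv_CE[OF e] .
  show "rv e \<noteq> e" "rv (rv e) = e" "ca (rv e) = co e" using eE by (simp_all add: cons_al_def)
next
  fix S S' assume S: "S \<in> P" "S' \<in> P"
  obtain s s' where s: "s \<in> S" "s' \<in> S'" using S subtreeD(1)[OF part_subtree] by blast
  have "conn Ed al om V" unfolding conn_def
  proof (intro ballI)
    fix u v assume uv: "u \<in> V" "v \<in> V"
    have "sub_edges Ed al om V = Ed" unfolding sub_edges_def using al_V om_V by blast
    then show "(u, v) \<in> (step (sub_edges Ed al om V) al om)\<^sup>*" using reachable[OF uv] by (simp only:)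
  qed
  then have "(part P s, part P s') \<in> (step (sub_edges CE ca co (part P ` V)) ca co)\<^sup>*"
    using cons_conn s S part_subset_V unfolding conn_def by blast
  moreover have "(step (sub_edges CE ca co (part P ` V)) ca co)\<^sup>* \<subseteq> (step CE ca co)\<^sup>*"
    by (rule rtrancl_mono[OF step_mono]) (auto simp: sub_edges_def)
  ultimately have "(S, S') \<in> (step CE ca co)\<^sup>*" using part_eq S s by auto
  then show "\<exists>es. walk_from_to CE ca co es S S'" unfolding ex_walk_iff .
next
  fix es assume es: "walk CE ca co es \<and> es \<noteq> [] \<and> reduced rv es"
  then have in_CE: "hd es \<in> CE" "last es \<in> CE" by (auto simp: walk_def)
  have Ed: "hd es \<in> Ed" "last es \<in> Ed" using in_CE CE_Ed by blast+
  show "ca (hd es) \<noteq> co (last es)"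
  proof
    assume "ca (hd es) = co (last es)"
    then have *: "part P (al (hd es)) = part P (om (last es))" by (simp add: cons_al_def)
    \<comment> \<open>The final part lies beyond the first edge, whereas the initial part contains
      \<open>al (hd es)\<close>.\<close>
    have "om (last es) \<in> sd (hd es)" using reduced_cons_walk[of es] es om_side[of "last es"] by blast
    then have "part P (om (last es)) \<subseteq> sd (hd es)"
      using part_side[OF part_in(1)[OF om_V[OF Ed(2)]] in_CE(1) part_in(2)[OF om_V[OF Ed(2)]]] by blast
    then show False using * part_in(2)[OF al_V[OF Ed(1)]] al_notin_side[OF Ed(1)] by blast
  qed
qed

section \<open>The inclusions of the vertex spaces into the limits over the parts\<close>

lemma tree_sys_part: "S \<in> P \<Longrightarrow> tree_sys S (SE S) al om rv K Sg ph"
  by (rule tree_sys_subtree[OF part_subtree])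

lemma iota_inj:
  assumes "S \<in> P" "iota S t x = iota S t y"
  shows "x = y"
  using tree_sys.pt_inj[OF tree_sys_part[OF assms(1)], of t x y] assms(2)
  by (simp add: tree_sys.pt_def[OF tree_sys_part[OF assms(1)]])

lemma continuous_iota:
  assumes "S \<in> P" "t \<in> S"
  shows "continuous_map (Kt t) (limS S) (iota S t)"
proof -
  have "tree_sys.pt (SE S) al om Sg ph t = iota S t"
    by (rule ext) (simp add: tree_sys.pt_def[OF tree_sys_part[OF assms(1)]])
  then show ?thesis using tree_sys.continuous_pt[OF tree_sys_part[OF assms(1)] assms(2)] by simp
qed

lemma cSg_eq: "cSg e = iota (part P (al e)) (al e) ` Sg e"
  by (simp add: cons_Sg_def cons_emb_def[abs_def])

text \<open>Injectivity of the inclusion makes the choice in \<open>cons_ph\<close> unique.\<close>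

lemma cph_iota:
  assumes e: "e \<in> Ed" and x: "x \<in> Sg e"
  shows "cph e (iota (part P (al e)) (al e) x) = iota (part P (om e)) (om e) (ph e x)"
proof -
  have "(SOME z. z \<in> Sg e \<and> cons_emb Ed al om Sg ph P (al e) z = iota (part P (al e)) (al e) x) = x"
    using x iota_inj[OF part_in(1)[OF al_V[OF e]]]
    by (intro some_equality) (auto simp: cons_emb_def)
  then show ?thesis by (simp add: cons_ph_def cons_emb_def)
qed

text \<open>A continuous injection of a compact space into a Hausdorff space.\<close>

lemma homeomorphic_iota:
  assumes S: "S \<in> P" "t \<in> S" and A: "compactin (Kt t) A"
  shows "homeomorphic_map (subtopology (Kt t) A) (subtopology (limS S) (iota S t ` A)) (iota S t)"
proof -
  interpret S: tree_sys S "SE S" al om rv K Sg ph by (rule tree_sys_part[OF S(1)])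
  note S.edge [simp del]
  have AK: "A \<subseteq> mspace (K t)" using compactin_subset_topspace[OF A] by simp
  have sub: "iota S t ` A \<subseteq> ptsS S"
    using S.pt_in_pts[OF S(2)] AK unfolding S.pt_def by blast
  show ?thesis
  proof (rule continuous_imp_homeomorphic_map)
    show "continuous_map (subtopology (Kt t) A) (subtopology (limS S) (iota S t ` A)) (iota S t)"
      using continuous_map_from_subtopology[OF continuous_iota[OF S]] by (simp add: continuous_map_in_subtopology image_subset_iff)
    show "compact_space (subtopology (Kt t) A)" using A compact_space_subtopology by blast
    show "Hausdorff_space (subtopology (limS S) (iota S t ` A))" using S.Hausdorff_lim Hausdorff_space_subtopology by blast
    have "topspace (subtopology (Kt t) A) = A" using AK by auto
    moreover have "topspace (subtopology (limS S) (iota S t ` A)) = iota S t ` A"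
      using sub S.topspace_lim by auto
    ultimately show "iota S t ` topspace (subtopology (Kt t) A) = topspace (subtopology (limS S) (iota S t ` A))"
      by simp
    show "inj_on (iota S t) (topspace (subtopology (Kt t) A))"
      using iota_inj[OF S(1)] by (intro inj_onI) blast
  qed
qed

end

locale consolidation_metric = consolidation V Ed al om rv K Sg ph P
  for V :: "'v set" and Ed :: "'e set" and al om :: "'e \<Rightarrow> 'v" and rv :: "'e \<Rightarrow> 'e"
    and K :: "'v \<Rightarrow> 'a metric" and Sg :: "'e \<Rightarrow> 'a set" and ph :: "'e \<Rightarrow> 'a \<Rightarrow> 'a"
    and P :: "'v set set" +
  fixes KS :: "'v set \<Rightarrow> ('v, 'a) lpt metric"
  assumes KS: "S \<in> P \<Longrightarrow> mtopology_of (KS S) = cons_K Ed al om Kt Sg ph S"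
begin

section \<open>The consolidation as a tree system\<close>

lemma KS_lim: "S \<in> P \<Longrightarrow> mtopology_of (KS S) = limS S"
  using KS by (simp add: cons_K_def)

lemma mspace_KS: "S \<in> P \<Longrightarrow> mspace (KS S) = ptsS S"
  using KS_lim[of S] topspace_mtopology_of[of "KS S"] tree_sys.topspace_lim[OF tree_sys_part, of S] by simp

text \<open>\<open>cph e\<close> is \<open>ph e\<close> conjugated by the two inclusions;
  \<open>g\<close> inverts the first of them.\<close>

lemma homeomorphic_cph:
  assumes e: "e \<in> CE"
  shows "homeomorphic_map (subtopology (limS (ca e)) (cSg e)) (subtopology (limS (co e)) (cSg (rv e))) (cph e)"
proof -
  have eE: "e \<in> Ed" using e by (rule CE_Ed)
  let ?S = "part P (al e)" and ?S' = "part P (om e)"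
  let ?X = "subtopology (Kt (al e)) (Sg e)" and ?X' = "subtopology (Kt (om e)) (Sg (rv e))"
  let ?Y = "subtopology (limS ?S) (cSg e)" and ?Y' = "subtopology (limS ?S') (cSg (rv e))"
  have i: "homeomorphic_map ?X ?Y (iota ?S (al e))"
    unfolding cSg_eq using homeomorphic_iota part_in al_V eE Sg_compact by blast
  have i': "homeomorphic_map ?X' ?Y' (iota ?S' (om e))"
    using homeomorphic_iota[OF part_in[OF om_V[OF eE]], of "Sg (rv e)"] Sg_compact[OF rv_Ed[OF eE]] eE
    by (simp add: cSg_eq)
  obtain g where g: "homeomorphic_maps ?X ?Y (iota ?S (al e)) g" using i unfolding homeomorphic_map_maps by blast
  then have "homeomorphic_map ?Y ?X g" using homeomorphic_maps_sym homeomorphic_map_maps by blast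
  then have "homeomorphic_map ?Y ?X' (ph e \<circ> g)" using ph_homeomorphic[OF eE] homeomorphic_map_compose by blast
  then have c: "homeomorphic_map ?Y ?Y' (iota ?S' (om e) \<circ> (ph e \<circ> g))" using i' homeomorphic_map_compose by blast
  have "homeomorphic_map ?Y ?Y' (cph e)"
  proof (rule homeomorphic_map_eq[OF c])
    fix y assume "y \<in> topspace ?Y"
    then have "y \<in> cSg e" by simp
    then obtain x where x: "x \<in> Sg e" "y = iota ?S (al e) x" unfolding cSg_eq by blast
    then have "x \<in> topspace ?X" using Sg_subset[OF eE] by auto
    then have "g (iota ?S (al e) x) = x" using g unfolding homeomorphic_maps_def by blast
    then show "(iota ?S' (om e) \<circ> (ph e \<circ> g)) y = cph e y" using cph_iota[OF eE x(1)] x by simp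
  qed
  then show ?thesis by (simp add: cons_al_def)
qed

lemma cons_tree_system: "tree_system P CE ca co rv KS cSg cph"
  unfolding tree_system_def
proof (intro conjI ballI allI impI)
  show "is_tree P CE ca co rv" by (rule is_tree_cons)
  show "compact_space (mtopology_of (KS S))" if "S \<in> P" for S
    using tree_sys.compact_lim[OF tree_sys_part[OF that]] KS_lim[OF that] by simp
  fix e assume e: "e \<in> CE"
  then have eE: "e \<in> Ed" by (rule CE_Ed)
  note pa = part_in[OF al_V[OF eE]] and po = part_in[OF om_V[OF eE]]
  show "cSg e \<noteq> {}" using Sg_nonempty[OF eE] by (simp add: cSg_eq)
  have "compactin (limS (part P (al e))) (cSg e)"
    unfolding cSg_eq using image_compactin[OF Sg_compact[OF eE] continuous_iota[OF pa]] .
  then show "compactin (mtopology_of (KS (ca e))) (cSg e)"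
    using KS_lim[OF pa(1)] by (simp add: cons_al_def)
  show "homeomorphic_map (subtopology (mtopology_of (KS (ca e))) (cSg e))
     (subtopology (mtopology_of (KS (ca (rv e)))) (cSg (rv e))) (cph e)"
    using homeomorphic_cph[OF e] KS_lim[OF pa(1)] KS_lim[OF po(1)] eE by (simp add: cons_al_def)
  show "cph (rv e) (cph e y) = y" if y: "y \<in> cSg e" for y
  proof -
    obtain x where x: "x \<in> Sg e" "y = iota (part P (al e)) (al e) x" using y unfolding cSg_eq by blast
    then show ?thesis
      using cph_iota[OF eE x(1)] cph_iota[OF rv_Ed[OF eE] ph_Sg[OF eE x(1)]] ph_rv[OF eE x(1)] eE by simp
  qed
next
  fix S e f assume S: "S \<in> P" and e: "e \<in> CE" and f: "f \<in> CE" and *: "ca e = S \<and> ca f = S \<and> e \<noteq> f"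
  interpret S: tree_sys S "SE S" al om rv K Sg ph by (rule tree_sys_part[OF S])
  note S.edge [simp del]
  have p: "part P (al e) = S" "part P (al f) = S" using * by (simp_all add: cons_al_def)
  have eE: "e \<in> Ed" "f \<in> Ed" using e f CE_Ed by blast+
  have notSE: "e \<notin> SE S" "f \<notin> SE S" using e f SE_iff[OF S] CE_iff by auto
  show "cSg e \<inter> cSg f = {}"
  proof (rule ccontr)
    assume "cSg e \<inter> cSg f \<noteq> {}"
    then obtain x y where xy: "x \<in> Sg e" "y \<in> Sg f" "S.pt (al e) x = S.pt (al f) y"
      unfolding cSg_eq p S.pt_def by blast
    \<comment> \<open>Either the point is the same at one vertex, or it is glued along an edge
      \<open>g\<close> inside \<open>S\<close>. Disjointness of the sets at \<open>al e\<close> then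
      forces \<open>f = e\<close> or \<open>g = e\<close>, and \<open>e\<close> is not inside
      \<open>S\<close>.\<close>
    then consider "al f = al e" "y = x" | g where "g \<in> SE S" "al g = al e" "x \<in> Sg g"
      using S.pt_eq_iff by metis
    then show False
    proof cases
      case 1
      then show ?thesis using Sg_unique[OF eE, of x] xy * by simp
    next
      case 2
      then have "g \<in> Ed" by (simp add: sub_edges_def)
      then have "g = e" using Sg_unique[of g e x] 2 xy eE by simp
      then show ?thesis using 2 notSE by simp
    qed
  qed
next
  fix S \<epsilon> assume S: "S \<in> P" and \<epsilon>: "\<epsilon> > (0::real)"
  interpret S: tree_sys S "SE S" al om rv K Sg ph by (rule tree_sys_part[OF S])
  note S.edge [simp del]
  let ?I = "{e \<in> CE. ca e = S}"
  have "finite {i \<in> ?I. \<epsilon> \<le> mdiam (KS S) (S.pt (al i) ` Sg i)}"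
  proof (rule S.null_lim[OF KS_lim[OF S] _ _ _ _ \<epsilon>])
    fix i assume "i \<in> ?I"
    then have i: "i \<in> Ed" "part P (al i) = S" using CE_Ed by (auto simp: cons_al_def)
    show "al i \<in> S" using part_in(2)[OF al_V[OF i(1)]] i by simp
    show "Sg i \<noteq> {}" "compactin (Kt (al i)) (Sg i)" using Sg_nonempty Sg_compact i by blast+
  next
    fix t \<delta> assume "t \<in> S" "\<delta> > (0::real)"
    then have "finite {e \<in> Ed. al e = t \<and> \<delta> \<le> mdiam (K t) (Sg e)}"
      using Sg_null part_subset_V[OF S] by blast
    then show "finite {i \<in> ?I. al i = t \<and> \<delta> \<le> mdiam (K t) (Sg i)}"
      by (rule finite_subset[rotated]) (use CE_Ed in blast)
  qed
  moreover have "S.pt (al i) ` Sg i = cSg i" if "i \<in> ?I" for i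
    using that unfolding cSg_eq S.pt_def cons_al_def by simp
  ultimately show "finite {e \<in> CE. ca e = S \<and> \<epsilon> \<le> mdiam (KS S) (cSg e)}"
    by (rule_tac finite_subset[rotated]) auto
qed

sublocale C: tree_sys P "cons_edges Ed al om P" "cons_al al P" "cons_al om P" rv KS
  "cons_Sg Ed al om Sg ph P" "cons_ph Ed al om Sg ph P"
  by (rule tree_sys.intro) (rule cons_tree_system)

end

section \<open>The canonical map\<close>

context consolidation_metric
begin

abbreviation cn :: "('v set, ('v, 'a) lpt) lpt \<Rightarrow> ('v, 'a) lpt" where "cn \<equiv> canon V Ed al om Sg ph"

text \<open>A step between parts that avoids \<open>e\<close> and \<open>rv e\<close> stays on one
  side, which gives one inclusion for \<open>e\<close> and for \<open>rv e\<close>. The two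
  half-trees of the consolidated tree cover \<open>P\<close>, and a nonempty part cannot lie on both
  sides, so equality follows.\<close>

lemma C_side:
  assumes e: "e \<in> CE"
  shows "C.sd e = {S \<in> P. S \<subseteq> sd e}"
proof -
  have sub: "S \<in> P \<and> S \<subseteq> sd f" if f: "f \<in> CE" and S: "S \<in> C.sd f" for S f
  proof -
    have "(co f, S) \<in> (step (CE - {f, rv f}) ca co)\<^sup>*" using S by (simp add: side_def)
    then show ?thesis
    proof induction
      case base
      note po = part_in[OF om_V[OF CE_Ed[OF f]]]
      show ?case using po(1) part_side[OF po(1) f po(2) om_side] by (simp add: cons_al_def)
    next
      case (step S S')
      then obtain g where g: "g \<in> CE" "g \<noteq> rv f" "S = part P (al g)" "S' = part P (om g)"
        by (auto simp: step_def cons_al_def)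
      note po = part_in[OF om_V[OF CE_Ed[OF g(1)]]]
      have "al g \<in> sd f" using step.IH part_in(2)[OF al_V[OF CE_Ed[OF g(1)]]] g by blast
      then have "om g \<in> sd f" using cross_out[OF CE_Ed[OF f] CE_Ed[OF g(1)]] g(2) by blast
      then show ?case using po(1) part_side[OF po(1) f po(2)] g(4) by simp
    qed
  qed
  show ?thesis
  proof (intro set_eqI iffI)
    fix S assume "S \<in> C.sd e"
    then show "S \<in> {S \<in> P. S \<subseteq> sd e}" using sub[OF e] by simp
  next
    fix S assume S: "S \<in> {S \<in> P. S \<subseteq> sd e}"
    show "S \<in> C.sd e"
    proof (rule ccontr)
      assume "S \<notin> C.sd e"
      then have "S \<in> C.sd (rv e)" using C.side_rv[OF e] S by simp
      then have "S \<subseteq> sd (rv e)" using sub[OF rv_CE[OF e]] by blast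
      then have "S = {}" using S side_rv[OF CE_Ed[OF e]] by blast
      then show False using S subtreeD(1)[OF part_subtree] by blast
    qed
  qed
qed

lemma C_toward_iff:
  assumes "e \<in> CE" "C.ray R"
  shows "C.tow e R \<longleftrightarrow> (\<exists>n. \<forall>m\<ge>n. R m \<subseteq> sd e)"
  unfolding toward_def C_side[OF assms(1)] using C.ray_V[OF assms(2)] by simp

lemma C_redge:
  assumes "C.ray R"
  shows "C.redge R n \<in> CE" "C.redge R n \<in> Ed" "al (C.redge R n) \<in> R n" "om (C.redge R n) \<in> R (Suc n)"
proof -
  note * = C.redge[OF assms, of n]
  show "C.redge R n \<in> CE" using * by simp
  show Ed: "C.redge R n \<in> Ed" using *(1) by (rule CE_Ed)
  show "al (C.redge R n) \<in> R n" "om (C.redge R n) \<in> R (Suc n)"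
    using *(2,3) part_in(2)[OF al_V[OF Ed]] part_in(2)[OF om_V[OF Ed]] by (simp_all add: cons_al_def)
qed

text \<open>By \<open>part_side\<close> a half-tree of T beyond a consolidated edge is a union of
  parts, so strict inclusion passes from the consolidated tree to T.\<close>

lemma chain_C_redge:
  assumes R: "C.ray R"
  shows "chain (C.redge R)"
  unfolding chain_def
proof (intro allI conjI)
  fix n
  let ?e = "C.redge R n" and ?f = "C.redge R (Suc n)"
  show "?e \<in> Ed" by (rule C_redge(2)[OF R])
  have "C.sd ?f \<subset> C.sd ?e" using C.chain_redge[OF R] unfolding C.chain_def by blast
  moreover have un: "sd e = \<Union>(C.sd e)" if e: "e \<in> CE" for e
  proof -
    have "v \<in> \<Union>{S \<in> P. S \<subseteq> sd e}" if v: "v \<in> sd e" for v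
    proof -
      have "v \<in> V" using side_subset[OF CE_Ed[OF e]] v by blast
      then show ?thesis using part_in[of v] part_side[OF _ e _ v] by blast
    qed
    then show ?thesis unfolding C_side[OF e] by blast
  qed
  ultimately have "sd ?f \<subseteq> sd ?e" using C_redge(1)[OF R] by (metis Union_mono psubset_imp_subset)
  moreover have "sd ?f \<noteq> sd ?e"
    using \<open>C.sd ?f \<subset> C.sd ?e\<close> C_side[OF C_redge(1)[OF R, of n]] C_side[OF C_redge(1)[OF R, of "Suc n"]] by auto
  ultimately show "sd ?f \<subset> sd ?e" by blast
qed

text \<open>One implication, applied to \<open>e\<close> and to \<open>rv e\<close>, is enough,
  since both orientations pick exactly one edge of the pair.\<close>

lemma C_orient:
  assumes R: "C.ray R" and r: "ray r" "\<And>n. tow (C.redge R n) r" and e: "e \<in> CE"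
  shows "C.tow e R \<longleftrightarrow> tow e r"
proof -
  have imp: "tow f r" if f: "f \<in> CE" "C.tow f R" for f
  proof -
    obtain n where n: "\<forall>m\<ge>n. R m \<subseteq> sd f" using C_toward_iff[OF f(1) R] f(2) by blast
    obtain k where k: "\<forall>m\<ge>k. sd (C.redge R m) \<subseteq> sd f \<or> sd (C.redge R m) \<inter> sd f = {}"
      using chain_side_cases[OF chain_C_redge[OF R] CE_Ed[OF f(1)]] by blast
    \<comment> \<open>Late enough for the parts of \<open>R\<close> to be beyond \<open>f\<close>
      and for the crossed half-tree to be inside or disjoint from \<open>sd f\<close>; the vertex
      \<open>om (C.redge R ?m)\<close> excludes disjointness.\<close>
    let ?m = "max n k"
    have "om (C.redge R ?m) \<in> R (Suc ?m)" by (rule C_redge(4)[OF R])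
    moreover have "R (Suc ?m) \<subseteq> sd f" using n by simp
    ultimately have "om (C.redge R ?m) \<in> sd f" by blast
    moreover have "om (C.redge R ?m) \<in> sd (C.redge R ?m)" by (rule om_side)
    moreover have "sd (C.redge R ?m) \<subseteq> sd f \<or> sd (C.redge R ?m) \<inter> sd f = {}" using k by simp
    ultimately have "sd (C.redge R ?m) \<subseteq> sd f" by blast
    then show ?thesis using toward_mono[OF r(2)] by blast
  qed
  show ?thesis
  proof
    assume "tow e r"
    then have "\<not> tow (rv e) r" using toward_iff[OF r(1) CE_Ed[OF e]] by simp
    then have "\<not> C.tow (rv e) R" using imp[OF rv_CE[OF e]] by blast
    then show "C.tow e R" using C.toward_iff[OF R e] by simp
  qed (rule imp[OF e])
qed

text \<open>Both representatives of a class have the same image in the limit over T, so the choice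
  in \<open>canon\<close> is immaterial.\<close>

lemma canon_pt_C:
  assumes S: "S \<in> P" and y: "y \<in> ptsS S"
  shows "cn (C.pt S y) = emb y"
proof -
  have *: "emb (snd p) = emb y" if p: "p \<in> C.cl (S, y)" for p
  proof -
    have "(fst p, snd p) \<in> C.cl (S, y)" using p by simp
    then consider "snd p = y" | e where "e \<in> CE" "y \<in> cSg e" "snd p = cph e y"
      unfolding C.cl_mem_iff by blast
    then show ?thesis
    proof cases
      case 2
      then obtain x where x: "x \<in> Sg e" "y = iota (part P (al e)) (al e) x" unfolding cSg_eq by blast
      have e: "e \<in> Ed" using 2 CE_Ed by blast
      have "emb (snd p) = pt (om e) (ph e x)" using 2(3) cph_iota[OF e x(1)] x(2) emb_pt by simp
      also have "\<dots> = emb y" using pt_glue[OF e x(1)] x(2) emb_pt by simp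
      finally show ?thesis .
    qed simp
  qed
  have "(S, y) \<in> C.cl (S, y)" by (simp add: C.cl_mem_iff)
  then have "(SOME p. p \<in> C.cl (S, y)) \<in> C.cl (S, y)" by (rule someI[of "\<lambda>p. p \<in> C.cl (S, y)"])
  then show ?thesis using * unfolding canon_def C.pt_def by (simp add: canon_pt_eq_emb)
qed

text \<open>Evaluates the definite description in \<open>canon\<close>: the end of any ray directed
  toward all edges crossed by \<open>R\<close> satisfies it, and every solution is directed toward
  the same chain.\<close>

lemma canon_end_C:
  assumes R: "C.ray R" and r: "ray r" "\<And>n. tow (C.redge R n) r"
  shows "cn (Inr (C.end_pt R)) = Inr (end_pt r)"
proof -
  define through where "through \<eta> \<longleftrightarrow> \<eta> \<in> ends V Ed al om \<and>
           (\<exists>R'\<in>C.end_pt R. \<exists>r\<in>\<eta>. \<exists>m. strict_mono m \<and>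
              (\<forall>i. \<exists>e\<in>Ed. al e \<in> R' i \<and> om e \<in> R' (Suc i) \<and>
                        r (m i) = al e \<and> r (Suc (m i)) = om e))" for \<eta>
  have "(THE \<eta>. through \<eta>) = end_pt r"
  proof (rule the_equality)
    let ?f = "C.redge R"
    note c = chain_C_redge[OF R]
    \<comment> \<open>Starting at \<open>al (?f 0)\<close>, outside every half-tree of the chain,
      forces \<open>s\<close> to cross all the edges \<open>?f n\<close>.\<close>
    obtain s where s: "ray s" "s 0 = al (?f 0)" "\<And>n. tow (?f n) s"
      using chain_ray[OF c, of "al (?f 0)"] C_redge(2)[OF R] by auto
    have "s 0 \<notin> sd (?f n)" for n
      using chain_mono[OF c, of 0 n] al_notin_side[OF C_redge(2)[OF R, of 0]] s(2) by auto
    then have "\<exists>m. s m = al (?f n) \<and> s (Suc m) = om (?f n)" for n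
      using toward_crosses[OF s(1) C_redge(2)[OF R] _ s(3), of 0 n] by blast
    then obtain m where m: "\<And>n. s (m n) = al (?f n)" "\<And>n. s (Suc (m n)) = om (?f n)" by metis
    have "m n < m (Suc n)" for n
    proof (rule ccontr)
      assume "\<not> m n < m (Suc n)"
      then have "m (Suc n) < Suc (m n)" by simp
      \<comment> \<open>Crossing in the wrong order would place the whole part
        \<open>R (Suc n)\<close> beyond an edge that starts in it.\<close>
      then have "om (?f n) \<in> sd (?f (Suc n))"
        using ray_after[OF s(1) C_redge(2)[OF R] m(1)[of "Suc n", symmetric] m(2)[of "Suc n", symmetric]] m(2)[of n]
        by metis
      then have "R (Suc n) \<subseteq> sd (?f (Suc n))"
        using part_side[OF C.ray_V[OF R] C_redge(1)[OF R] C_redge(4)[OF R]] by blast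
      then show False using C_redge(3)[OF R, of "Suc n"] al_notin_side[OF C_redge(2)[OF R]] by blast
    qed
    then have "strict_mono m" by (simp add: strict_mono_Suc_iff)
    moreover have "\<exists>e\<in>Ed. al e \<in> R i \<and> om e \<in> R (Suc i) \<and> s (m i) = al e \<and> s (Suc (m i)) = om e" for i
      using C_redge[OF R, of i] m[of i] by blast
    moreover have "R \<in> C.end_pt R" using R C.in_end_pt ray_equiv_refl by blast
    moreover have "s \<in> end_pt r" using ray_equiv_chain[OF r(1) s(1) c r(2) s(3)] s(1) in_end_pt by blast
    moreover have "end_pt r \<in> ends V Ed al om" using r(1) ends_iff by blast
    ultimately show "through (end_pt r)" unfolding through_def by blast
  next
    fix \<eta> assume "through \<eta>"
    then obtain R' r' m where \<eta>: "\<eta> \<in> ends V Ed al om" and R': "R' \<in> C.end_pt R" and r': "r' \<in> \<eta>"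
      and ex: "\<And>i. \<exists>e\<in>Ed. al e \<in> R' i \<and> om e \<in> R' (Suc i) \<and> r' (m i) = al e \<and> r' (Suc (m i)) = om e"
      unfolding through_def by blast
    obtain q where q: "ray q" "\<eta> = end_pt q" using \<eta> ends_iff by blast
    have r'q: "ray r'" "ray_equiv q r'" using r' q(2) in_end_pt by simp_all
    have CR': "C.ray R'" "ray_equiv R R'" using R' C.in_end_pt by simp_all
    have R'r': "tow (C.redge R' i) r'" for i
    proof -
      obtain e where e: "e \<in> Ed" "al e \<in> R' i" "om e \<in> R' (Suc i)" "r' (m i) = al e" "r' (Suc (m i)) = om e"
        using ex by blast
      have p: "part P (al e) = R' i" "part P (om e) = R' (Suc i)"
        using part_eq C.ray_V[OF CR'(1)] e by blast+
      moreover have "R' i \<noteq> R' (Suc i)" using C.ray_neq[OF CR'(1), of i "Suc i"] by simp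
      ultimately have "C.redge R' i = e"
        using e(1) by (intro C.redge_eqI[OF CR'(1)]) (simp_all add: CE_iff cons_al_def)
      then show ?thesis using towardI[OF r'q(1) e(1) e(4,5)] by simp
    qed
    \<comment> \<open>The description allows any representative \<open>R'\<close> of the end; the
      orientation of the consolidated edges does not depend on it.\<close>
    have "tow (C.redge R' i) r" for i
    proof -
      have "C.tow (C.redge R' i) R"
        using C.toward_redge[OF CR'(1)] C.ray_equiv_imp_toward ray_equiv_sym[OF CR'(2)] by blast
      then show ?thesis using C_orient[OF R r C_redge(1)[OF CR'(1)]] by simp
    qed
    then have "ray_equiv r' r" using ray_equiv_chain[OF r'q(1) r(1) chain_C_redge[OF CR'(1)] R'r'] by blast
    then have "ray_equiv q r" using ray_equiv_trans[OF q(1) r'q(1) r(1) r'q(2)] by blast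
    then show "\<eta> = end_pt r" using end_pt_eq_iff[OF q(1) r(1)] q(2) by simp
  qed
  then show ?thesis unfolding canon_def through_def by simp
qed

lemma C_pts_cases:
  assumes "z \<in> C.pts"
  obtains (inner_pt) t x where "t \<in> V" "x \<in> mspace (K t)" "z = C.pt (part P t) (iota (part P t) t x)"
      "cn z = pt t x"
    | (inner_end) S r where "S \<in> P" "is_ray S (SE S) al om r" "z = C.pt S (Inr (end_of S (SE S) al om r))"
      "cn z = Inr (end_pt r)"
    | (outer_end) R r where "C.ray R" "ray r" "\<And>n. tow (C.redge R n) r" "z = Inr (C.end_pt R)"
      "cn z = Inr (end_pt r)"
  using assms
proof (cases rule: C.pts_cases)
  case (1 S y)
  then have y: "y \<in> ptsS S" using mspace_KS by simp
  interpret S: tree_sys S "SE S" al om rv K Sg ph by (rule tree_sys_part[OF 1(1)])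
  note S.edge [simp del]
  have cz: "cn z = emb y" using canon_pt_C[OF 1(1) y] 1(3) by simp
  show ?thesis using y
  proof (cases rule: S.pts_cases)
    case t: (1 t x)
    have "part P t = S" using part_eq[OF 1(1) t(1)] .
    moreover have "cn z = pt t x" using cz t(3) emb_pt by (simp add: S.pt_def)
    ultimately show ?thesis using inner_pt[of t x] t 1 part_subset_V[OF 1(1)] by (auto simp: S.pt_def)
  next
    case (2 r)
    then show ?thesis using inner_end[OF 1(1) 2(1)] cz emb_end[OF part_subtree[OF 1(1)] 2(1)] 1(3) by simp
  qed
next
  case (2 R)
  obtain r where "ray r" "\<And>n. tow (C.redge R n) r"
    using chain_ray[OF chain_C_redge[OF 2(1)]] V_nonempty by blast
  then show ?thesis using outer_end[OF 2(1)] canon_end_C[OF 2(1)] 2(2) by blast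
qed

lemma inj_canon: "inj_on cn C.pts"
proof -
  \<comment> \<open>A ray inside one part cannot follow a consolidated ray: as soon as it gets
    beyond a crossed edge the whole part does, including \<open>r 0\<close>, which the chain
    escapes.\<close>
  have in_outer: False
    if S: "S \<in> P" "is_ray S (SE S) al om r" and R: "C.ray R" "ray r'" "\<And>n. tow (C.redge R n) r'"
      and eq: "end_pt r = end_pt r'" for S r R r'
  proof -
    note rr = ray_subtree[OF part_subtree[OF S(1)] S(2)]
    have "ray_equiv r' r" using eq end_pt_eq_iff[OF rr(1) R(2)] ray_equiv_sym by blast
    then have t: "tow (C.redge R n) r" for n using ray_equiv_imp_toward R(3) by blast
    obtain n where n: "r 0 \<notin> sd (C.redge R n)"
      using chain_escape[OF chain_C_redge[OF R(1)] ray_V[OF rr(1)]] by blast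
    obtain k where "r k \<in> sd (C.redge R n)" using t[of n] unfolding toward_def by blast
    then have "S \<subseteq> sd (C.redge R n)" using part_side[OF S(1) C_redge(1)[OF R(1)] rr(2)] by blast
    then show False using n rr(2)[of 0] by blast
  qed
  show ?thesis
  proof (rule inj_onI)
    fix z z' assume z: "z \<in> C.pts" and z': "z' \<in> C.pts" and eq: "cn z = cn z'"
    show "z = z'" using z
    proof (cases rule: C_pts_cases)
      case 1: (inner_pt t x)
      show ?thesis using z'
      proof (cases rule: C_pts_cases)
        case 2: (inner_pt s y)
        have "pt t x = pt s y" using eq 1 2 by simp
        then consider "s = t" "y = x" | e where "e \<in> Ed" "al e = t" "om e = s" "x \<in> Sg e" "y = ph e x"
          using pt_eq_iff by metis
        then show ?thesis
        proof cases
          case e: 2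
          show ?thesis
          \<comment> \<open>An identification of T is made inside one K_S or along a consolidated
            edge, according to whether its edge stays inside a part.\<close>
          proof (cases "part P t = part P s")
            case True
            interpret S: tree_sys "part P t" "SE (part P t)" al om rv K Sg ph
              using tree_sys_part[OF part_in(1)[OF 1(1)]] .
            note S.edge [simp del]
            have "e \<in> SE (part P t)" using SE_iff[OF part_in(1)[OF 1(1)]] e True by simp
            then have "S.pt t x = S.pt s y" using S.pt_glue[of e x] e by simp
            then have "iota (part P t) t x = iota (part P t) s y" unfolding S.pt_def .
            then show ?thesis using 1(3) 2(3) True by simp
          next
            case False
            then have eC: "e \<in> CE" using e by (simp add: CE_iff)
            have "iota (part P t) t x \<in> cSg e" using e by (auto simp: cSg_eq)
            then have "C.pt (ca e) (iota (part P t) t x) = C.pt (co e) (cph e (iota (part P t) t x))"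
              by (rule C.pt_glue[OF eC])
            moreover have "cph e (iota (part P t) t x) = iota (part P s) s y"
              using cph_iota[OF e(1,4)] e by simp
            ultimately show ?thesis using 1 2 e by (simp add: cons_al_def)
          qed
        qed (use 1 2 in simp)
      next
        case 2: (inner_end S r)
        show ?thesis using eq 1(4) 2(4) by (simp add: pt_def)
      next
        case 2: (outer_end R r)
        show ?thesis using eq 1(4) 2(5) by (simp add: pt_def)
      qed
    next
      case 1: (inner_end S r)
      note rr = ray_subtree[OF part_subtree[OF 1(1)] 1(2)]
      show ?thesis using z'
      proof (cases rule: C_pts_cases)
        case 2: (inner_pt s y)
        show ?thesis using eq 1(4) 2(4) by (simp add: pt_def)
      next
        case 2: (inner_end S' r')
        note rr' = ray_subtree[OF part_subtree[OF 2(1)] 2(2)]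
        have "end_pt r = end_pt r'" using eq 1(4) 2(4) by simp
        then have e: "ray_equiv r r'" using end_pt_eq_iff[OF rr(1) rr'(1)] by simp
        then obtain k j where "r (0 + k) = r' (0 + j)" unfolding ray_equiv_def by blast
        then have "r k \<in> S \<inter> S'" using rr(2)[of k] rr'(2)[of j] by simp
        then have S: "S' = S" using part_eq[OF 1(1)] part_eq[OF 2(1)] by blast
        interpret S: tree_sys S "SE S" al om rv K Sg ph by (rule tree_sys_part[OF 1(1)])
        note S.edge [simp del]
        have "S.end_pt r = S.end_pt r'" using S.end_pt_eq_iff[OF 1(2)] 2(2) e S by blast
        then show ?thesis using 1(3) 2(3) S by simp
      next
        case 2: (outer_end R r')
        have "end_pt r = end_pt r'" using eq 1(4) 2(5) by simp
        then show ?thesis using in_outer[OF 1(1,2) 2(1-3)] by blast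
      qed
    next
      case 1: (outer_end R r)
      show ?thesis using z'
      proof (cases rule: C_pts_cases)
        case 2: (inner_pt s y)
        show ?thesis using eq 1(5) 2(4) by (simp add: pt_def)
      next
        case 2: (inner_end S' r')
        have "end_pt r' = end_pt r" using eq 1(5) 2(4) by simp
        then show ?thesis using in_outer[OF 2(1,2) 1(1-3)] by blast
      next
        case 2: (outer_end R' r')
        have "end_pt r = end_pt r'" using eq 1(5) 2(5) by simp
        then have e: "ray_equiv r r'" using end_pt_eq_iff[OF 1(2) 2(2)] by simp
        have "C.tow e R'" if "e \<in> CE" "C.tow e R" for e
          using C_orient[OF 1(1-3) that(1)] C_orient[OF 2(1-3) that(1)] that(2) ray_equiv_imp_toward[OF e] by blast
        then have "ray_equiv R R'" using C.ray_equiv_iff[OF 1(1) 2(1)] by blast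
        then show ?thesis using C.end_pt_eq_iff[OF 1(1) 2(1)] 1(4) 2(4) by simp
      qed
    qed
  qed
qed

text \<open>The slices of \<open>U'\<close> are preimages under \<open>emb\<close>, hence open by
  \<open>continuous_emb\<close>; the exit condition comes from tameness of the basic set in
  T.\<close>

lemma continuous_canon: "continuous_map C.lim lim cn"
  unfolding lim_eq
proof (rule continuous_on_generated_topo)
  show "cn ` topspace C.lim \<subseteq> \<Union>basis"
    unfolding Union_basis C.topspace_lim
  proof (rule image_subsetI)
    fix z assume "z \<in> C.pts"
    then show "cn z \<in> pts"
    proof (cases rule: C_pts_cases)
      case (inner_pt t x)
      then show ?thesis using pt_in_pts by simp
    next
      case (inner_end S r)
      then show ?thesis using end_in_pts ray_subtree(1)[OF part_subtree] by simp
    next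
      case (outer_end R r)
      then show ?thesis using end_in_pts by simp
    qed
  qed
  fix A assume "A \<in> basis"
  then obtain W U where W: "finite W" "subtree W" and U: "osat W U" and A: "A = G W U"
    by (auto simp: lim_basis_def)
  define W' where "W' = part P ` W"
  define U' where "U' = {(S, y). S \<in> W' \<and> y \<in> ptsS S \<and> emb y \<in> A}"
  have W': "finite W'" "C.subtree W'" unfolding W'_def using W cons_subtree by simp_all
  have W'P: "W' \<subseteq> P" using C.subtreeD(2)[OF W'(2)] .
  have tame: "branch E \<subseteq> A \<or> branch E \<inter> A = {}" if E: "E \<in> C.N W'" for E
  proof -
    have ECE: "E \<in> CE" using C.N_D[OF E] by blast
    \<comment> \<open>A vertex of \<open>W\<close> beyond \<open>E\<close> would bring its whole
      part, a member of \<open>W'\<close>, beyond an exit of \<open>W'\<close>.\<close>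
    have "sd E \<inter> W = {}"
    proof (rule ccontr)
      assume "sd E \<inter> W \<noteq> {}"
      then obtain w where w: "w \<in> W" "w \<in> sd E" by blast
      then have "w \<in> V" using subtreeD(2)[OF W(2)] by blast
      then have "part P w \<in> C.sd E" using C_side[OF ECE] part_in[of w] part_side[OF _ ECE _ w(2)] by simp
      moreover have "part P w \<in> W'" using w by (simp add: W'_def)
      ultimately show False using C.exit_disjoint[OF W'(2) E] by blast
    qed
    then show ?thesis using tame_G[OF W(2) U] CE_Ed[OF ECE] unfolding A tame_def by blast
  qed
  have sl: "slice U' S = {y \<in> ptsS S. emb y \<in> A}" if "S \<in> W'" for S using that by (auto simp: slice_def U'_def)
  have Sgl: "(if branch E \<subseteq> A then cSg E \<subseteq> slice U' (ca E) else cSg E \<inter> slice U' (ca E) = {})"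
    if E: "E \<in> C.N W'" for E
  proof -
    have ECE: "E \<in> CE" "ca E \<in> W'" using C.N_D[OF E] by blast+
    have "emb y \<in> branch E" if "y \<in> cSg E" for y
      using that Sg_in_branch[OF CE_Ed[OF ECE(1)]] emb_pt unfolding cSg_eq by auto
    moreover have "cSg E \<subseteq> ptsS (ca E)"
      using C.Sg_subset[OF ECE(1)] mspace_KS[of "ca E"] ECE(2) W'P by auto
    ultimately show ?thesis using tame[OF E] sl[OF ECE(2)] by auto
  qed
  \<comment> \<open>Nonemptiness of \<open>cSg E\<close> excludes that both alternatives of
    \<open>Sgl\<close> hold at once.\<close>
  have Sgi: "cSg E \<subseteq> slice U' (ca E) \<longleftrightarrow> branch E \<subseteq> A" if E: "E \<in> C.N W'" for E
    using Sgl[OF E] C.Sg_nonempty[of E] C.N_D[OF E] by (auto split: if_splits)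
  have U': "C.osat W' U'"
    unfolding open_saturated_def
  proof (intro conjI ballI impI)
    show "U' \<subseteq> disj_union W' C.Kt" using mspace_KS W'P unfolding U'_def disj_union_def by auto
    show "openin (C.Kt S) (slice U' S)" if S: "S \<in> W'" for S
    proof -
      have SP: "S \<in> P" using S W'P by blast
      have "openin (limS S) {y \<in> topspace (limS S). emb y \<in> A}"
        using openin_continuous_map_preimage[OF continuous_emb[OF part_subtree[OF SP]] openin_G[OF W U]]
        unfolding A .
      then show ?thesis
        using sl[OF S] KS_lim[OF SP] tree_sys.topspace_lim[OF tree_sys_part[OF SP]] by simp
    qed
    show "(ca e, y) \<in> U' \<longleftrightarrow> (co e, cph e y) \<in> U'" if ey: "e \<in> sub_edges CE ca co W'" "y \<in> cSg e" for e y
    proof -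
      have e: "e \<in> CE" "ca e \<in> W'" "co e \<in> W'" using ey(1) unfolding sub_edges_def by blast+
      have y: "y \<in> ptsS (ca e)" "cph e y \<in> ptsS (co e)"
        using C.Sg_subset[OF e(1)] ey(2) C.ph_mspace[OF e(1) ey(2)] mspace_KS e(2,3) W'P by auto
      have "cn (C.pt (ca e) y) = cn (C.pt (co e) (cph e y))" using C.pt_glue[OF e(1) ey(2)] by simp
      then have "emb y = emb (cph e y)" 
        using canon_pt_C[OF subsetD[OF W'P e(2)] y(1)] canon_pt_C[OF subsetD[OF W'P e(3)] y(2)] by simp
      then show ?thesis using y e by (simp add: U'_def)
    qed
    show "cSg E \<subseteq> slice U' (ca E) \<or> cSg E \<inter> slice U' (ca E) = {}" if "E \<in> CE" "ca E \<in> W' \<and> co E \<notin> W'" for E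
      using Sgl[of E] that by (auto simp: C.N_def split: if_splits)
  qed
  have "cn z \<in> A \<longleftrightarrow> z \<in> C.G W' U'" if z: "z \<in> C.pts" for z
    using z
  proof (cases rule: C.pts_cases)
    case (1 S y)
    have y: "y \<in> ptsS S" using 1 mspace_KS by simp
    have cz: "cn z = emb y" using canon_pt_C[OF 1(1) y] 1(3) by simp
    have iff: "z \<in> C.G W' U' \<longleftrightarrow> (S, y) \<in> U' \<or> (\<exists>E\<in>C.N W'. branch E \<subseteq> A \<and> S \<in> C.sd E)"
      using C.pt_in_G_iff[OF W'(2) U' 1(1,2)] 1(3) Sgi by auto
    show ?thesis
    proof (cases "S \<in> W'")
      case True
      then have "S \<notin> C.sd E" if "E \<in> C.N W'" for E using C.exit_disjoint[OF W'(2) that] by blast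
      then show ?thesis using iff cz True y by (auto simp: U'_def)
    next
      case False
      obtain E where E: "E \<in> C.N W'" "S \<in> C.sd E" using C.exit_ex[OF W'(2) 1(1) False] by blast
      have "S \<subseteq> sd E" using C_side[of E] C.N_D[OF E(1)] E(2) by blast
      then have b: "emb y \<in> branch E" using emb_in_branch[OF part_subtree[OF 1(1)] _ y] by blast
      have "F = E" if "F \<in> C.N W'" "S \<in> C.sd F" for F
        using C.exit_unique[OF W'(2) E(1) that(1) E(2) that(2)] by simp
      then have "(\<exists>F\<in>C.N W'. branch F \<subseteq> A \<and> S \<in> C.sd F) \<longleftrightarrow> branch E \<subseteq> A" using E by metis
      moreover have "(S, y) \<notin> U'" using False by (simp add: U'_def)
      ultimately have "z \<in> C.G W' U' \<longleftrightarrow> branch E \<subseteq> A" using iff by simp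
      then show ?thesis using cz b tame[OF E(1)] by auto
    qed
  next
    case (2 R)
    obtain r where r: "ray r" "\<And>n. tow (C.redge R n) r"
      using chain_ray[OF chain_C_redge[OF 2(1)]] V_nonempty by blast
    have cz: "cn z = Inr (end_pt r)" using canon_end_C[OF 2(1) r] 2(2) by simp
    obtain E where E: "E \<in> C.N W'" "C.tow E R" using C.ray_exit_ex[OF W' 2(1)] by blast
    have "tow E r" using C_orient[OF 2(1) r] E C.N_D[OF E(1)] by blast
    then have b: "cn z \<in> branch E" using end_in_branch[OF r(1)] cz by simp
    have "z \<in> C.G W' U' \<longleftrightarrow> (\<exists>E\<in>C.N W'. branch E \<subseteq> A \<and> C.tow E R)"
      using C.end_in_G_iff[OF W'(2) 2(1)] 2(2) Sgi by auto
    also have "\<dots> \<longleftrightarrow> branch E \<subseteq> A" using E C.ray_exit_unique[OF W'(2) E(1) _ E(2)] by metis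
    finally show ?thesis using b tame[OF E(1)] by auto
  qed
  then have "cn -` A \<inter> topspace C.lim = C.G W' U'"
    using C.G_subset_pts[OF W'(2) U'] by auto
  then show "openin C.lim (cn -` A \<inter> topspace C.lim)" using C.openin_G[OF W' U'] by simp
qed

text \<open>The image is compact and contains the dense set of points that are not ends.\<close>
lemma canon_surj: "cn ` C.pts = pts"
proof
  show "cn ` C.pts \<subseteq> pts"
    using continuous_map_image_subset_topspace[OF continuous_canon] by simp
  have "compactin C.lim C.pts" using C.compact_lim by (simp add: compact_space_def)
  then have "compactin lim (cn ` C.pts)" using image_compactin continuous_canon by blast
  then have "closedin lim (cn ` C.pts)" using compactin_imp_closedin[OF Hausdorff_lim] by blast
  then have op: "openin lim (pts - cn ` C.pts)" by (simp add: closedin_def)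
  have pt_in: "pt t x \<in> cn ` C.pts" if t: "t \<in> V" "x \<in> mspace (K t)" for t x
  proof -
    note p = part_in[OF t(1)]
    interpret S: tree_sys "part P t" "SE (part P t)" al om rv K Sg ph by (rule tree_sys_part[OF p(1)])
    note S.edge [simp del]
    have y: "iota (part P t) t x \<in> ptsS (part P t)" using S.pt_in_pts[OF p(2) t(2)] by (simp add: S.pt_def)
    have "cn (C.pt (part P t) (iota (part P t) t x)) = pt t x" using canon_pt_C[OF p(1) y] emb_pt by simp
    moreover have "C.pt (part P t) (iota (part P t) t x) \<in> C.pts" using C.pt_in_pts[OF p(1)] y mspace_KS[OF p(1)] by simp
    ultimately show ?thesis by (metis imageI)
  qed
  show "pts \<subseteq> cn ` C.pts"
  proof (rule subsetI, rule ccontr)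
    fix p assume p: "p \<in> pts" "p \<notin> cn ` C.pts"
    have "p \<in> pts - cn ` C.pts" using p by simp
    from tame_base[OF op this] obtain B W where B: "finite W" "subtree W" "tame W B" "p \<in> B" "B \<subseteq> pts - cn ` C.pts"
      by (elim exE conjE)
    show False using p(1)
    proof (cases rule: pts_cases)
      case (1 t x)
      then show ?thesis using pt_in p(2) by simp
    next
      case (2 r)
      let ?e = "redge r"
      obtain n where n: "sd (?e n) \<inter> W = {}"
        using chain_escape_finite[OF chain_redge[OF 2(1)] B(1) subtreeD(2)[OF B(2)]] by blast
      have e: "?e n \<in> Ed" by (rule redge(1)[OF 2(1)])
      have "p \<in> branch (?e n)" using end_in_branch[OF 2(1) toward_redge[OF 2(1)]] 2(2) by simp
      \<comment> \<open>A tame neighbourhood of an end contains a whole branch, and with it points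
        of some \<open>Sg e\<close>, which are in the image.\<close>
      then have "branch (?e n) \<subseteq> B" using B(3,4) n e unfolding tame_def by blast
      moreover obtain x where x: "x \<in> Sg (?e n)" using Sg_nonempty[OF e] by blast
      ultimately have "pt (al (?e n)) x \<in> B" using Sg_in_branch[OF e] by blast
      moreover have "pt (al (?e n)) x \<in> cn ` C.pts" using pt_in[OF al_V[OF e]] Sg_subset[OF e] x by blast
      ultimately show ?thesis using B(5) by blast
    qed
  qed
qed

lemma homeomorphic_canon: "homeomorphic_map C.lim lim cn"
  using continuous_imp_homeomorphic_map[OF continuous_canon C.compact_lim Hausdorff_lim] canon_surj inj_canon
  by simp

end

theorem theorem3:
  fixes V :: "'v set" and Ed :: "'e set" and al om :: "'e \<Rightarrow> 'v" and rv :: "'e \<Rightarrow> 'e"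
    and K :: "'v \<Rightarrow> 'a metric" and Sg :: "'e \<Rightarrow> 'a set" and ph :: "'e \<Rightarrow> 'a \<Rightarrow> 'a"
    and P :: "'v set set"
  assumes "tree_system V Ed al om rv K Sg ph"
    and "tree_partition V Ed al om P"
  shows "(\<exists>KS :: 'v set \<Rightarrow> ('v, 'a) lpt metric.
            (\<forall>S\<in>P. mtopology_of (KS S) = cons_K Ed al om (\<lambda>t. mtopology_of (K t)) Sg ph S) \<and>
            tree_system P (cons_edges Ed al om P) (cons_al al P) (cons_al om P) rv KS
              (cons_Sg Ed al om Sg ph P) (cons_ph Ed al om Sg ph P))
       \<and> homeomorphic_map
           (lim_top P (cons_edges Ed al om P) (cons_al al P) (cons_al om P)
              (cons_K Ed al om (\<lambda>t. mtopology_of (K t)) Sg ph)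
              (cons_Sg Ed al om Sg ph P) (cons_ph Ed al om Sg ph P))
           (lim_top V Ed al om (\<lambda>t. mtopology_of (K t)) Sg ph)
           (canon V Ed al om Sg ph)"
proof -
  interpret consolidation V Ed al om rv K Sg ph P
    by (rule consolidation.intro[OF tree_sys.intro[OF assms(1)] consolidation_axioms.intro[OF assms(2)]])
  have "\<exists>m. mtopology_of m = cons_K Ed al om Kt Sg ph S" if "S \<in> P" for S
    unfolding cons_K_def using mtopology_of_exists tree_sys.metrizable_lim[OF tree_sys_part[OF that]] by blast
  then obtain KS where KS: "\<And>S. S \<in> P \<Longrightarrow> mtopology_of (KS S) = cons_K Ed al om Kt Sg ph S" by metis
  interpret M: consolidation_metric V Ed al om rv K Sg ph P KS
    by (rule consolidation_metric.intro[OF consolidation_axioms consolidation_metric_axioms.intro[OF KS]])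
  \<comment> \<open>The statement is about \<open>cons_K\<close>, with which the chosen metrics
    agree on \<open>P\<close> only.\<close>
  have "lim_top P CE ca co (\<lambda>S. mtopology_of (KS S)) cSg cph = lim_top P CE ca co (cons_K Ed al om Kt Sg ph) cSg cph"
    by (rule lim_top_cong) (rule KS)
  then show ?thesis using M.homeomorphic_canon M.cons_tree_system KS by auto
qed

end
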